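(* The theory DTR (the model completion of the theory TR defined in the context) is inp-minimal.
   Context: $\mathcal{L}_{TR}=\{\leq,\wedge,R\}$ where $\leq$ is a binary relation symbol, $\wedge$ a binary function symbol and $R$ a ternary relation symbol; $\&$ denotes logical conjunction and $x<y$ means $x\leq y$ and $x\ne y$. TR is the theory with axioms: (T1) $\forall x\,(x\leq x)$; (T2) $\forall x,y\,(x\leq y\ \&\ y\leq x\to x=y)$; (T3) $\forall x,y,z\,(x\leq y\ \&\ y\leq z\to x\leq z)$; (T4) $\forall x,y,z\,(y,z\leq x\to y\leq z\lor z\leq y)$; (T5) $\forall x,y\,(x\wedge y\leq x,y)$; (T6) $\forall x,y,z\,(z\leq x,y\to z\leq x\wedge y)$; (R1) $\forall x,y,z\,(x<y\wedge z\to\neg R(x,y,z))$; (R2) $\forall x,y,z\,(R(x,y,z)\to R(x,z,y))$; (R3) $\forall x,y,y',z\,(R(x,y,z)\ \&\ x<y\wedge y'\to R(x,y',z))$; (R4) $\forall x,y,z\,(R(x,y,z)\to x<y,z)$. DTR is the model completion of TR; it is the theory of the Fraïssé limit of the class of finite models of TR, is $\omega$-categorical and has quantifier elimination. Burden: for a partial type $\Sigma(x)$ over $A$ and a cardinal $\kappa$, $\mathrm{bdn}(\Sigma)<\kappa$ if for every family of $A$-mutually indiscernible sequences $(\bar a_\alpha)_{\alpha<\kappa}$, $\bar a_\alpha=(a_{\alpha,i})_{i<\omega}$, and every $b\models\Sigma$ there are $\beta<\kappa$ and a sequence $\bar a'$ indiscernible over $bA$ with $\bar a'\equiv_{a_{\beta,0}A}\bar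 a_\beta$. A theory is inp-minimal if $\mathrm{bdn}(x=x)<2$, where $x$ is a single variable. *)

theory Defs
  imports Complex_Main
begin

unbundle cardinal_syntax

text \<open>First-order logic over the language with a binary relation symbol \<open>\<le>\<close>, a binary
  function symbol \<open>\<and>\<close> and a ternary relation symbol \<open>R\<close>. Variables are natural numbers.\<close>

datatype tm = Var nat | Meet tm tm

datatype fm =
    Eq tm tm
  | Le tm tm
  | Rel tm tm tm
  | Neg fm
  | And fm fm
  | Ex nat fm

abbreviation Or :: "fm \<Rightarrow> fm \<Rightarrow> fm" where
  "Or \<phi> \<psi> \<equiv> Neg (And (Neg \<phi>) (Neg \<psi>))"

abbreviation Imp :: "fm \<Rightarrow> fm \<Rightarrow> fm" where
  "Imp \<phi> \<psi> \<equiv> Neg (And \<phi> (Neg \<psi>))"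

abbreviation All :: "nat \<Rightarrow> fm \<Rightarrow> fm" where
  "All x \<phi> \<equiv> Neg (Ex x (Neg \<phi>))"

abbreviation Lt :: "tm \<Rightarrow> tm \<Rightarrow> fm" where
  "Lt t u \<equiv> And (Le t u) (Neg (Eq t u))"

primrec tvars :: "tm \<Rightarrow> nat set" where
  "tvars (Var x) = {x}"
| "tvars (Meet t u) = tvars t \<union> tvars u"

primrec fv :: "fm \<Rightarrow> nat set" where
  "fv (Eq t u) = tvars t \<union> tvars u"
| "fv (Le t u) = tvars t \<union> tvars u"
| "fv (Rel t u v) = tvars t \<union> tvars u \<union> tvars v"
| "fv (Neg \<phi>) = fv \<phi>"
| "fv (And \<phi> \<psi>) = fv \<phi> \<union> fv \<psi>"
| "fv (Ex x \<phi>) = fv \<phi> - {x}"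

definition is_theory :: "fm set \<Rightarrow> bool" where
  "is_theory T \<longleftrightarrow> (\<forall>\<phi>\<in>T. fv \<phi> = {})"

record 'a struct =
  univ :: "'a set"
  le :: "'a \<Rightarrow> 'a \<Rightarrow> bool"
  meet :: "'a \<Rightarrow> 'a \<Rightarrow> 'a"
  rel :: "'a \<Rightarrow> 'a \<Rightarrow> 'a \<Rightarrow> bool"

definition is_structure :: "'a struct \<Rightarrow> bool" where
  "is_structure M \<longleftrightarrow> univ M \<noteq> {} \<and> (\<forall>a\<in>univ M. \<forall>b\<in>univ M. meet M a b \<in> univ M)"

primrec tval :: "'a struct \<Rightarrow> (nat \<Rightarrow> 'a) \<Rightarrow> tm \<Rightarrow> 'a" where
  "tval M s (Var x) = s x"
| "tval M s (Meet t u) = meet M (tval M s t) (tval M s u)"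

primrec sat :: "'a struct \<Rightarrow> (nat \<Rightarrow> 'a) \<Rightarrow> fm \<Rightarrow> bool" where
  "sat M s (Eq t u) \<longleftrightarrow> tval M s t = tval M s u"
| "sat M s (Le t u) \<longleftrightarrow> le M (tval M s t) (tval M s u)"
| "sat M s (Rel t u v) \<longleftrightarrow> rel M (tval M s t) (tval M s u) (tval M s v)"
| "sat M s (Neg \<phi>) \<longleftrightarrow> \<not> sat M s \<phi>"
| "sat M s (And \<phi> \<psi>) \<longleftrightarrow> sat M s \<phi> \<and> sat M s \<psi>"
| "sat M s (Ex x \<phi>) \<longleftrightarrow> (\<exists>a\<in>univ M. sat M (s(x := a)) \<phi>)"

definition models :: "'a struct \<Rightarrow> fm set \<Rightarrow> bool" where
  "models M T \<longleftrightarrow> is_structure M \<and> (\<forall>\<phi>\<in>T. \<forall>s. range s \<subseteq> univ M \<longrightarrow> sat M s \<phi>)"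

text \<open>\<open>M \<Turnstile> \<phi>(a\<^sub>0, \<dots>, a\<^sub>n\<^sub>-\<^sub>1)\<close>. This is only meaningful when
  \<open>fv \<phi> \<subseteq> {..<n}\<close>, which every use below requires; variables beyond the length of the
  list are then irrelevant.\<close>

abbreviation holds :: "'a struct \<Rightarrow> fm \<Rightarrow> 'a list \<Rightarrow> bool" where
  "holds M \<phi> as \<equiv> sat M ((!) as) \<phi>"

definition TR :: "fm set" where
  "TR = (let x = Var 0; y = Var 1; z = Var 2; y' = Var 3 in
    { All 0 (Le x x),
      All 0 (All 1 (Imp (And (Le x y) (Le y x)) (Eq x y))),
      All 0 (All 1 (All 2 (Imp (And (Le x y) (Le y z)) (Le x z)))),
      All 0 (All 1 (All 2 (Imp (And (Le y x) (Le z x)) (Or (Le y z) (Le z y))))),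
      All 0 (All 1 (And (Le (Meet x y) x) (Le (Meet x y) y))),
      All 0 (All 1 (All 2 (Imp (And (Le z x) (Le z y)) (Le z (Meet x y))))),
      All 0 (All 1 (All 2 (Imp (Lt x (Meet y z)) (Neg (Rel x y z))))),
      All 0 (All 1 (All 2 (Imp (Rel x y z) (Rel x z y)))),
      All 0 (All 1 (All 3 (All 2
               (Imp (And (Rel x y z) (Lt x (Meet y y'))) (Rel x y' z))))),
      All 0 (All 1 (All 2 (Imp (Rel x y z) (And (Lt x y) (Lt x z))))) })"


definition embedding :: "('a \<Rightarrow> 'b) \<Rightarrow> 'a struct \<Rightarrow> 'b struct \<Rightarrow> bool" where
  "embedding f M N \<longleftrightarrow>
     f ` univ M \<subseteq> univ N \<and> inj_on f (univ M) \<and>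
     (\<forall>a\<in>univ M. \<forall>b\<in>univ M. f (meet M a b) = meet N (f a) (f b)) \<and>
     (\<forall>a\<in>univ M. \<forall>b\<in>univ M. le M a b \<longleftrightarrow> le N (f a) (f b)) \<and>
     (\<forall>a\<in>univ M. \<forall>b\<in>univ M. \<forall>c\<in>univ M. rel M a b c \<longleftrightarrow> rel N (f a) (f b) (f c))"

definition automorphism :: "('a \<Rightarrow> 'a) \<Rightarrow> 'a struct \<Rightarrow> bool" where
  "automorphism f M \<longleftrightarrow> embedding f M M \<and> f ` univ M = univ M"

text \<open>\<open>T'\<close> is a model completion of \<open>T\<close>: every model of \<open>T'\<close> is a model of \<open>T\<close>, and for every
  \<open>M \<Turnstile> T\<close> the theory \<open>T' \<union> Diag(M)\<close> is consistent and complete. A model of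
  \<open>T' \<union> Diag(M)\<close> is a model \<open>N\<close> of \<open>T'\<close> with an embedding of \<open>M\<close> into \<open>N\<close>, and the sentences
  to be decided have parameters from \<open>M\<close>.

  The structures are those with universe contained in \<open>nat\<close>, i.e. up to isomorphism all
  countable ones. As the language is countable, this is the same as quantifying over all
  structures, by the downward Loewenheim--Skolem theorem (for completeness, applied to a
  pair of embeddings of \<open>M\<close> into two models of \<open>T'\<close>; for consistency, also by compactness).\<close>

definition model_completion :: "fm set \<Rightarrow> fm set \<Rightarrow> bool" where
  "model_completion T T' \<longleftrightarrow>
     is_theory T \<and> is_theory T' \<and>
     (\<forall>M :: nat struct. models M T' \<longrightarrow> models M T) \<and>
     (\<forall>M :: nat struct. models M T \<longrightarrow>
        (\<exists>(N :: nat struct) f. models N T' \<and> embedding f M N)) \<and>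
     (\<forall>(M :: nat struct) (N1 :: nat struct) (N2 :: nat struct) f1 f2.
        models M T \<and> models N1 T' \<and> models N2 T' \<and>
        embedding f1 M N1 \<and> embedding f2 M N2 \<longrightarrow>
        (\<forall>\<phi> c. set c \<subseteq> univ M \<and> fv \<phi> \<subseteq> {..<length c} \<longrightarrow>
           (holds N1 \<phi> (map f1 c) \<longleftrightarrow> holds N2 \<phi> (map f2 c))))"


text \<open>A formula over \<open>A\<close> in \<open>n\<close> variables is a pair \<open>(\<phi>, c)\<close>: the variables of \<open>\<phi>\<close> below \<open>n\<close> are
  the variables proper, the following ones stand for the parameters \<open>c\<close>.\<close>

definition formula_over :: "'a set \<Rightarrow> nat \<Rightarrow> fm \<times> 'a list \<Rightarrow> bool" where
  "formula_over A n = (\<lambda>(\<phi>, c). set c \<subseteq> A \<and> fv \<phi> \<subseteq> {..<n + length c})"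

definition realizes :: "'a struct \<Rightarrow> 'a list \<Rightarrow> (fm \<times> 'a list) set \<Rightarrow> bool" where
  "realizes M b \<Sigma> \<longleftrightarrow> set b \<subseteq> univ M \<and> (\<forall>(\<phi>, c)\<in>\<Sigma>. holds M \<phi> (b @ c))"

definition partial_type :: "'a struct \<Rightarrow> 'a set \<Rightarrow> nat \<Rightarrow> (fm \<times> 'a list) set \<Rightarrow> bool" where
  "partial_type M A n \<Sigma> \<longleftrightarrow>
     (\<forall>p\<in>\<Sigma>. formula_over A n p) \<and>
     (\<forall>\<Sigma>0. finite \<Sigma>0 \<and> \<Sigma>0 \<subseteq> \<Sigma> \<longrightarrow> (\<exists>b. length b = n \<and> realizes M b \<Sigma>0))"

definition saturated :: "'k rel \<Rightarrow> 'a struct \<Rightarrow> bool" where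
  "saturated \<kappa> M \<longleftrightarrow>
     (\<forall>A \<Sigma>. A \<subseteq> univ M \<and> |A| <o \<kappa> \<and> partial_type M A 1 \<Sigma> \<longrightarrow>
        (\<exists>b. realizes M [b] \<Sigma>))"

definition partial_elementary :: "'a struct \<Rightarrow> 'a set \<Rightarrow> ('a \<Rightarrow> 'a) \<Rightarrow> bool" where
  "partial_elementary M A f \<longleftrightarrow>
     A \<subseteq> univ M \<and> f ` A \<subseteq> univ M \<and>
     (\<forall>\<phi> c. set c \<subseteq> A \<and> fv \<phi> \<subseteq> {..<length c} \<longrightarrow>
        (holds M \<phi> c \<longleftrightarrow> holds M \<phi> (map f c)))"

definition strongly_homogeneous :: "'k rel \<Rightarrow> 'a struct \<Rightarrow> bool" where
  "strongly_homogeneous \<kappa> M \<longleftrightarrow>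
     (\<forall>A f. |A| <o \<kappa> \<and> partial_elementary M A f \<longrightarrow>
        (\<exists>\<sigma>. automorphism \<sigma> M \<and> (\<forall>a\<in>A. \<sigma> a = f a)))"

text \<open>Small means of cardinality less than \<open>\<kappa>\<close>; as the language is countable and
  indiscernible sequences are indexed by \<open>\<omega>\<close>, \<open>\<kappa>\<close> is uncountable.\<close>

definition monster_model :: "'k rel \<Rightarrow> fm set \<Rightarrow> 'a struct \<Rightarrow> bool" where
  "monster_model \<kappa> T M \<longleftrightarrow>
     Card_order \<kappa> \<and> natLeq <o \<kappa> \<and>
     models M T \<and> saturated \<kappa> M \<and> strongly_homogeneous \<kappa> M"


text \<open>Sequences are indexed by \<open>\<omega>\<close>; their terms are finite tuples of one common length.\<close>

definition tuple_seq :: "'a struct \<Rightarrow> (nat \<Rightarrow> 'a list) \<Rightarrow> bool" where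
  "tuple_seq M a \<longleftrightarrow> (\<forall>i. set (a i) \<subseteq> univ M \<and> length (a i) = length (a 0))"

definition indiscernible :: "'a struct \<Rightarrow> 'a set \<Rightarrow> (nat \<Rightarrow> 'a list) \<Rightarrow> bool" where
  "indiscernible M B a \<longleftrightarrow>
     tuple_seq M a \<and>
     (\<forall>\<phi> c is js. set c \<subseteq> B \<and>
        sorted_wrt (<) is \<and> sorted_wrt (<) js \<and> length is = length js \<and>
        fv \<phi> \<subseteq> {..<length (concat (map a is) @ c)} \<longrightarrow>
        (holds M \<phi> (concat (map a is) @ c) \<longleftrightarrow> holds M \<phi> (concat (map a js) @ c)))"

definition mutually_indiscernible ::
  "'a struct \<Rightarrow> 'a set \<Rightarrow> 'k set \<Rightarrow> ('k \<Rightarrow> nat \<Rightarrow> 'a list) \<Rightarrow> bool" where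
  "mutually_indiscernible M A K a \<longleftrightarrow>
     (\<forall>\<alpha>\<in>K. indiscernible M (A \<union> (\<Union>\<gamma>\<in>K - {\<alpha>}. \<Union>i. set (a \<gamma> i))) (a \<alpha>))"

text \<open>\<open>a' \<equiv>\<^sub>B a\<close> for sequences of tuples: equality of the types over \<open>B\<close> of the infinite tuples.\<close>

definition same_type ::
  "'a struct \<Rightarrow> 'a set \<Rightarrow> (nat \<Rightarrow> 'a list) \<Rightarrow> (nat \<Rightarrow> 'a list) \<Rightarrow> bool" where
  "same_type M B a' a \<longleftrightarrow>
     (\<forall>i. length (a' i) = length (a i)) \<and>
     (\<forall>\<phi> c is. set c \<subseteq> B \<and> fv \<phi> \<subseteq> {..<length (concat (map a is) @ c)} \<longrightarrow>
        (holds M \<phi> (concat (map a' is) @ c) \<longleftrightarrow> holds M \<phi> (concat (map a is) @ c)))"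

text \<open>\<open>bdn(\<Sigma>) < \<kappa>\<close> for a partial type \<open>\<Sigma>\<close> in \<open>n\<close> variables over a small set \<open>A\<close>, computed in the
  monster model \<open>M\<close>. The cardinal \<open>\<kappa>\<close> is a cardinal order and its field is the index set.\<close>

definition bdn_less ::
  "'a struct \<Rightarrow> 'a set \<Rightarrow> nat \<Rightarrow> (fm \<times> 'a list) set \<Rightarrow> 'k rel \<Rightarrow> bool" where
  "bdn_less M A n \<Sigma> \<kappa> \<longleftrightarrow>
     (\<forall>a b. mutually_indiscernible M A (Field \<kappa>) a \<and> length b = n \<and> realizes M b \<Sigma> \<longrightarrow>
        (\<exists>\<beta>\<in>Field \<kappa>. \<exists>a'.
           indiscernible M (set b \<union> A) a' \<and>
           same_type M (set (a \<beta> 0) \<union> A) a' (a \<beta>)))"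

text \<open>\<open>bdn(x = x) < 2\<close>, where \<open>x = x\<close> is a type over \<open>{}\<close> in one variable. The monster models
  range over the structures with universe contained in the type \<open>'a\<close>, which is arbitrary. A
  cardinal \<open>\<kappa>\<close> that admits an infinite \<open>\<kappa>\<close>-saturated model with universe in \<open>'a\<close> is at most
  the cardinality of \<open>'a\<close>, so it can be taken to be a relation on \<open>'a\<close>.\<close>

definition inp_minimal :: "'a itself \<Rightarrow> fm set \<Rightarrow> bool" where
  "inp_minimal _ T \<longleftrightarrow>
     (\<forall>(\<kappa> :: 'a rel) (M :: 'a struct). monster_model \<kappa> T M \<longrightarrow>
        bdn_less M {} 1 {(Eq (Var 0) (Var 0), [])} ctwo)"

end

theory Submission
  imports Defs "HOL-Library.Countable_Set"
begin

text \<open>Completeness of \<open>DTR\<close> over the diagram of every countable model of \<open>TR\<close> is quantifier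
  elimination: an isomorphism between two substructures of the monster model preserves all
  formulas (\<open>partial_iso_preserves\<close>) and, between countable sets, extends to an automorphism.
  Consistency with these diagrams, together with saturation, realizes cuts and new cones with
  prescribed edges (\<open>realize_cut\<close>, \<open>realize_cone\<close>). Given a sequence \<open>a\<close> and a point \<open>b\<close>,
  it therefore suffices to find a point \<open>x\<close> with the same type as \<open>b\<close> over the tuple \<open>a 0\<close> such
  that \<open>a\<close> is indiscernible over \<open>x\<close>: an automorphism that fixes \<open>a 0\<close> and takes \<open>x\<close> to
  \<open>b\<close> moves \<open>a\<close> to the required sequence.

  Let \<open>e\<close> be the highest point at which \<open>b\<close> branches off the entries of \<open>a 0\<close>, with \<open>e = b\<close>
  if \<open>b\<close> is below an entry. The type of \<open>b\<close>
  over \<open>a 0\<close> is given by the position of \<open>e\<close>, which is a point of the substructure generated by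
  \<open>a 0\<close> or fills a cut in it, and, if \<open>e < b\<close>, by the cones above \<open>e\<close> to which the cone of \<open>b\<close>
  is joined in the graph at \<open>e\<close>. If \<open>a\<close> is indiscernible over \<open>e\<close>, then \<open>x\<close> exists
  (\<open>indisc_copy_above\<close>): the edges that the various terms of \<open>a\<close> ask for never conflict, and a
  new cone above \<open>e\<close> can have any prescribed edges.

  For two mutually indiscernible sequences \<open>a\<close> and \<open>c\<close>, the two points at which \<open>b\<close> branches
  off are comparable, both being below \<open>b\<close>. If the one for \<open>a\<close> is strictly lower, then an
  entry of \<open>c 0\<close> lies in the cone of \<open>b\<close> above it, hence has the same type as \<open>b\<close> over \<open>a 0\<close>,
  and \<open>a\<close> is indiscernible over that entry. So let both be \<open>e\<close>. If \<open>e\<close> is generated by one of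
  the tuples, then the other sequence is indiscernible over \<open>e\<close>. Otherwise \<open>e\<close> fills a cut in
  each of them. The cuts of the terms of \<open>a\<close> and of \<open>c\<close> form a grid, each cut of one sequence
  overlapping each cut of the other, and in a tree this forces the cuts of at least one sequence
  to have a common point (\<open>cuts_compatible_or\<close>). That sequence is indiscernible over such a
  point if it is chosen outside of the substructure generated by the sequence
  (\<open>indisc_copy_into_cut\<close>), and the case of a sequence indiscernible over \<open>e\<close>, treated above,
  finishes the proof.\<close>

section \<open>Satisfaction, restriction and isomorphic copies\<close>

instance tm :: countable by countable_datatype
instance fm :: countable by countable_datatype

lemma finite_tvars: "finite (tvars t)"
  by (induction t) auto

lemma finite_fv: "finite (fv \<phi>)"
  by (induction \<phi>) (auto simp: finite_tvars)

lemma tval_cong: "(\<And>x. x \<in> tvars t \<Longrightarrow> s x = s' x) \<Longrightarrow> tval M s t = tval M s' t"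
  by (induction t) auto

lemma sat_cong: "(\<And>x. x \<in> fv \<phi> \<Longrightarrow> s x = s' x) \<Longrightarrow> sat M s \<phi> \<longleftrightarrow> sat M s' \<phi>"
proof (induction \<phi> arbitrary: s s')
  case (Eq t u)
  then have "tval M s t = tval M s' t" "tval M s u = tval M s' u" by (auto intro!: tval_cong)
  then show ?case by simp
next
  case (Le t u)
  then have "tval M s t = tval M s' t" "tval M s u = tval M s' u" by (auto intro!: tval_cong)
  then show ?case by simp
next
  case (Rel t u v)
  then have "tval M s t = tval M s' t" "tval M s u = tval M s' u" "tval M s v = tval M s' v"
    by (auto intro!: tval_cong)
  then show ?case by simp
next
  case (Neg \<phi>)
  have "sat M s \<phi> \<longleftrightarrow> sat M s' \<phi>" using Neg.prems by (intro Neg.IH) auto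
  then show ?case by simp
next
  case (And \<phi> \<psi>)
  have "sat M s \<phi> \<longleftrightarrow> sat M s' \<phi>" using And.prems by (intro And.IH(1)) auto
  moreover have "sat M s \<psi> \<longleftrightarrow> sat M s' \<psi>" using And.prems by (intro And.IH(2)) auto
  ultimately show ?case by simp
next
  case (Ex x \<phi>)
  have "sat M (s(x := a)) \<phi> \<longleftrightarrow> sat M (s'(x := a)) \<phi>" for a
    using Ex.prems by (intro Ex.IH) auto
  then show ?case by simp
qed

lemma tval_in_univ:
  "is_structure M \<Longrightarrow> (\<And>x. x \<in> tvars t \<Longrightarrow> s x \<in> univ M) \<Longrightarrow> tval M s t \<in> univ M"
  by (induction t) (auto simp: is_structure_def)

text \<open>The assignments \<open>(!) c\<close> are arbitrary beyond the length of \<open>c\<close>; padding them with an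
  element of the universe makes them assignments into the structure.\<close>

definition padded :: "'a \<Rightarrow> 'a list \<Rightarrow> nat \<Rightarrow> 'a" where
  "padded d c i = (if i < length c then c ! i else d)"

lemma holds_padded: "fv \<phi> \<subseteq> {..<length c} \<Longrightarrow> holds M \<phi> c \<longleftrightarrow> sat M (padded d c) \<phi>"
  by (intro sat_cong) (auto simp: padded_def)

lemma range_padded: "set c \<subseteq> S \<Longrightarrow> d \<in> S \<Longrightarrow> range (padded d c) \<subseteq> S"
  by (auto simp: padded_def)

definition restr :: "'a struct \<Rightarrow> 'a set \<Rightarrow> 'a struct" where
  "restr M S = M\<lparr>univ := S\<rparr>"

lemma restr_simps [simp]:
  "univ (restr M S) = S" "le (restr M S) = le M" "meet (restr M S) = meet M"
  "rel (restr M S) = rel M"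
  by (simp_all add: restr_def)

lemma tval_restr [simp]: "tval (restr M S) s t = tval M s t"
  by (induction t) auto

lemma tval_embedding:
  assumes "is_structure M" "embedding f M N" "range s \<subseteq> univ M"
  shows "tval N (f \<circ> s) t = f (tval M s t)"
proof (induction t)
  case (Meet t u)
  have "tval M s t \<in> univ M" "tval M s u \<in> univ M"
    using assms by (auto intro!: tval_in_univ)
  then show ?case using assms(2) Meet by (auto simp: embedding_def)
qed simp

lemma sat_isomorphism:
  assumes "is_structure M" "embedding f M N" "f ` univ M = univ N" "range s \<subseteq> univ M"
  shows "sat N (f \<circ> s) \<phi> \<longleftrightarrow> sat M s \<phi>"
  using assms(4)
proof (induction \<phi> arbitrary: s)
  case (Eq t u)
  have "tval M s t \<in> univ M" "tval M s u \<in> univ M"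
    using assms(1) Eq by (auto intro!: tval_in_univ)
  then show ?case using assms(2) unfolding sat.simps tval_embedding[OF assms(1,2) Eq]
    by (auto simp: embedding_def inj_on_def)
next
  case (Le t u)
  have "tval M s t \<in> univ M" "tval M s u \<in> univ M"
    using assms(1) Le by (auto intro!: tval_in_univ)
  then show ?case using assms(2) unfolding sat.simps tval_embedding[OF assms(1,2) Le]
    by (simp add: embedding_def)
next
  case (Rel t u v)
  have "tval M s t \<in> univ M" "tval M s u \<in> univ M" "tval M s v \<in> univ M"
    using assms(1) Rel by (auto intro!: tval_in_univ)
  then show ?case using assms(2) unfolding sat.simps tval_embedding[OF assms(1,2) Rel]
    by (simp add: embedding_def)
next
  case (Ex x \<phi>)
  have *: "sat N ((f \<circ> s)(x := f a)) \<phi> \<longleftrightarrow> sat M (s(x := a)) \<phi>" if "a \<in> univ M" for a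
  proof -
    have "sat N (f \<circ> (s(x := a))) \<phi> \<longleftrightarrow> sat M (s(x := a)) \<phi>"
      using Ex.prems that by (intro Ex.IH) auto
    moreover have "f \<circ> (s(x := a)) = (f \<circ> s)(x := f a)" by auto
    ultimately show ?thesis by simp
  qed
  have "sat N (f \<circ> s) (Ex x \<phi>) \<longleftrightarrow> (\<exists>a\<in>univ N. sat N ((f \<circ> s)(x := a)) \<phi>)"
    by (simp only: sat.simps)
  also have "\<dots> \<longleftrightarrow> (\<exists>a\<in>univ M. sat N ((f \<circ> s)(x := f a)) \<phi>)"
    unfolding assms(3)[symmetric] by blast
  also have "\<dots> \<longleftrightarrow> sat M s (Ex x \<phi>)" using * by simp
  finally show ?case .
qed auto

lemma holds_isomorphism:
  assumes "is_structure M" "embedding f M N" "f ` univ M = univ N"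
    and "set c \<subseteq> univ M" "fv \<phi> \<subseteq> {..<length c}"
  shows "holds N \<phi> (map f c) \<longleftrightarrow> holds M \<phi> c"
proof -
  obtain d where d: "d \<in> univ M" using assms(1) by (auto simp: is_structure_def)
  have "holds N \<phi> (map f c) \<longleftrightarrow> sat N (padded (f d) (map f c)) \<phi>"
    using assms(5) by (intro holds_padded) auto
  also have "padded (f d) (map f c) = f \<circ> padded d c" by (auto simp: padded_def)
  also have "sat N (f \<circ> padded d c) \<phi> \<longleftrightarrow> sat M (padded d c) \<phi>"
    using assms d by (intro sat_isomorphism range_padded)
  also have "\<dots> \<longleftrightarrow> holds M \<phi> c" using holds_padded[OF assms(5)] by simp
  finally show ?thesis .
qed

lemma models_isomorphism:
  assumes "models M T" "embedding f M N" "f ` univ M = univ N"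
  shows "models N T"
  unfolding models_def
proof (intro conjI ballI allI impI)
  have M: "is_structure M" using assms(1) by (simp add: models_def)
  have "meet N (f a) (f b) \<in> univ N" if "a \<in> univ M" "b \<in> univ M" for a b
  proof -
    have "meet N (f a) (f b) = f (meet M a b)" using that assms(2) by (simp add: embedding_def)
    then show ?thesis using M that assms(3) by (auto simp: is_structure_def)
  qed
  then show "is_structure N"
    using M unfolding is_structure_def assms(3)[symmetric] by auto
  fix \<phi> and s :: "nat \<Rightarrow> _" assume \<phi>: "\<phi> \<in> T" and s: "range s \<subseteq> univ N"
  define s' where "s' = inv_into (univ M) f \<circ> s"
  have s_in: "s i \<in> f ` univ M" for i using s assms(3) by auto
  have "f (s' i) = s i" for i using f_inv_into_f[OF s_in] by (simp add: s'_def)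
  then have 1: "f \<circ> s' = s" by auto
  have "range s' \<subseteq> univ M" using inv_into_into[OF s_in] by (auto simp: s'_def)
  then show "sat N s \<phi>"
    using sat_isomorphism[OF M assms(2,3), of s' \<phi>] \<phi> assms(1) 1 by (auto simp: models_def)
qed

lemma embedding_comp:
  assumes "embedding f M N" "embedding g N P"
  shows "embedding (g \<circ> f) M P"
proof -
  have f: "a \<in> univ M \<Longrightarrow> f a \<in> univ N" for a using assms(1) by (auto simp: embedding_def)
  show ?thesis
    using assms f unfolding embedding_def
    by (auto intro!: comp_inj_on intro: inj_on_subset)
qed

lemma embedding_inverse:
  assumes "is_structure M" "embedding f M N" "f ` univ M = univ N"
  shows "embedding (inv_into (univ M) f) N M" (is "embedding ?g N M")
proof -
  have inj: "inj_on f (univ M)" using assms(2) by (simp add: embedding_def)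
  have g: "?g (f a) = a" if "a \<in> univ M" for a using inj that by simp
  have m: "a \<in> univ M \<Longrightarrow> b \<in> univ M \<Longrightarrow> meet M a b \<in> univ M" for a b
    using assms(1) by (simp add: is_structure_def)
  have fm: "meet N (f a) (f b) = f (meet M a b)" if "a \<in> univ M" "b \<in> univ M" for a b
    using assms(2) that by (simp add: embedding_def)
  show ?thesis
    using assms(2) unfolding embedding_def assms(3)[symmetric]
    by (auto simp: g m fm inj_on_def)
qed

lemma countable_struct_nat_copy:
  assumes "is_structure M" "countable (univ M)"
  obtains N :: "nat struct" and j where "embedding j M N" "j ` univ M = univ N"
proof -
  define j where "j = to_nat_on (univ M)"
  define g where "g = inv_into (univ M) j"
  have inj: "inj_on j (univ M)" using assms(2) by (simp add: j_def inj_on_to_nat_on)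
  then have g: "g (j a) = a" if "a \<in> univ M" for a using that by (simp add: g_def)
  define N where "N = \<lparr>univ = j ` univ M, le = \<lambda>a b. le M (g a) (g b),
    meet = \<lambda>a b. j (meet M (g a) (g b)), rel = \<lambda>a b c. rel M (g a) (g b) (g c)\<rparr>"
  have "embedding j M N" using inj by (auto simp: embedding_def N_def g)
  moreover have "j ` univ M = univ N" by (simp add: N_def)
  ultimately show ?thesis by (rule that)
qed

section \<open>Countable elementary substructures\<close>

lemma finite_subset_chain:
  assumes "\<And>n. S n \<subseteq> S (Suc n)" "finite F" "F \<subseteq> (\<Union>n::nat. S n)"
  shows "\<exists>n. F \<subseteq> S n"
  using assms(2,3)
proof (induction F)
  case (insert x F)
  then obtain m n where mn: "F \<subseteq> S m" "x \<in> S n" by auto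
  have mono: "S i \<subseteq> S j" if "i \<le> j" for i j using that assms(1) by (rule lift_Suc_mono_le[rotated])
  have "insert x F \<subseteq> S (max m n)" using mn mono[of m "max m n"] mono[of n "max m n"] by auto
  then show ?case by blast
qed auto

text \<open>Closing a countable set under the meet and under witnesses for all existential formulas.
  An assignment enters a formula through a finite initial segment only, so there are countably
  many formulas with parameters at each stage.\<close>

lemma downward_Loewenheim_Skolem:
  assumes M: "is_structure M" and X: "X \<subseteq> univ M" "countable X"
  obtains S where "X \<subseteq> S" "S \<subseteq> univ M" "countable S" "is_structure (restr M S)"
    "\<And>\<phi> s. range s \<subseteq> S \<Longrightarrow> sat (restr M S) s \<phi> \<longleftrightarrow> sat M s \<phi>"
proof -
  obtain d where d: "d \<in> univ M" using M by (auto simp: is_structure_def)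
  define w where "w = (\<lambda>(\<phi>, x, l). if \<exists>a\<in>univ M. sat M ((padded d l)(x := a)) \<phi>
      then SOME a. a \<in> univ M \<and> sat M ((padded d l)(x := a)) \<phi> else d)"
  have w_in: "w p \<in> univ M" for p
  proof (cases p)
    case (fields \<phi> x l)
    show ?thesis
    proof (cases "\<exists>a\<in>univ M. sat M ((padded d l)(x := a)) \<phi>")
      case True
      then have "\<exists>a. a \<in> univ M \<and> sat M ((padded d l)(x := a)) \<phi>" by auto
      from someI_ex[OF this] show ?thesis using True by (simp add: w_def fields)
    qed (simp add: w_def fields d)
  qed
  have w_sat: "sat M ((padded d l)(x := w (\<phi>, x, l))) \<phi>"
    if "\<exists>a\<in>univ M. sat M ((padded d l)(x := a)) \<phi>" for \<phi> x l
  proof -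
    have "\<exists>a. a \<in> univ M \<and> sat M ((padded d l)(x := a)) \<phi>" using that by auto
    from someI_ex[OF this] show ?thesis using that by (simp add: w_def)
  qed
  define F where "F = (\<lambda>S. insert d S \<union> (\<lambda>(a, b). meet M a b) ` (S \<times> S) \<union> w ` (UNIV \<times> UNIV \<times> lists S))"
  define G where "G = (\<lambda>n. (F ^^ n) X)"
  have G0: "G 0 = X" and GS: "G (Suc n) = F (G n)" for n by (simp_all add: G_def)
  have step: "G n \<subseteq> G (Suc n)" for n by (auto simp: GS F_def)
  have in_univ: "G n \<subseteq> univ M" for n
  proof (induction n)
    case 0 then show ?case by (simp add: G0 X)
  next
    case (Suc n)
    have "meet M a b \<in> univ M" if "a \<in> G n" "b \<in> G n" for a b
      using M Suc that by (auto simp: is_structure_def)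
    then show ?case using Suc w_in d by (auto simp: GS F_def)
  qed
  have count: "countable (G n)" for n
  proof (induction n)
    case (Suc n) then show ?case
      by (auto simp: GS F_def intro!: countable_image countable_SIGMA countable_lists)
  qed (simp add: G0 X)
  define S where "S = (\<Union>n. G n)"
  have dS: "d \<in> S" by (auto simp: S_def GS F_def intro!: exI[of _ "Suc 0"])
  have wS: "w (\<phi>, x, l) \<in> S" if l: "l \<in> lists S" for \<phi> x l
  proof -
    obtain n where "set l \<subseteq> G n"
      using finite_subset_chain[of G "set l", OF step finite_set] l
      unfolding S_def in_lists_conv_set by blast
    then have "l \<in> lists (G n)" by auto
    then have "w (\<phi>, x, l) \<in> G (Suc n)" by (auto simp: GS F_def)
    then show ?thesis by (auto simp: S_def)
  qed
  have mS: "meet M a b \<in> S" if ab: "a \<in> S" "b \<in> S" for a b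
  proof -
    obtain n where "{a, b} \<subseteq> G n"
      using finite_subset_chain[of G "{a, b}", OF step] ab by (auto simp: S_def)
    then have "meet M a b \<in> G (Suc n)" by (auto simp: GS F_def)
    then show ?thesis by (auto simp: S_def)
  qed
  show ?thesis
  proof
    show "X \<subseteq> S" using G0 by (auto simp: S_def)
    show "S \<subseteq> univ M" using in_univ by (auto simp: S_def)
    show "countable S" using count by (auto simp: S_def)
    show "is_structure (restr M S)" using dS mS by (auto simp: is_structure_def)
    show "sat (restr M S) s \<phi> \<longleftrightarrow> sat M s \<phi>" if "range s \<subseteq> S" for \<phi> s
      using that
    proof (induction \<phi> arbitrary: s)
      case (Ex x \<phi>)
      have IH: "sat (restr M S) (s(x := a)) \<phi> \<longleftrightarrow> sat M (s(x := a)) \<phi>" if "a \<in> S" for a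
        using Ex.prems that by (intro Ex.IH) auto
      have "\<exists>a\<in>S. sat M (s(x := a)) \<phi>" if ex: "\<exists>a\<in>univ M. sat M (s(x := a)) \<phi>"
      proof -
        obtain n where n: "fv \<phi> \<subseteq> {..<n}"
          using finite_fv[of \<phi>] by (auto simp: finite_nat_iff_bounded)
        let ?l = "map s [0..<n]"
        have eq: "sat M ((padded d ?l)(x := a)) \<phi> \<longleftrightarrow> sat M (s(x := a)) \<phi>" for a
          using n by (intro sat_cong) (auto simp: padded_def)
        have "?l \<in> lists S" using Ex.prems by (auto simp: image_subset_iff)
        with wS w_sat[of ?l x \<phi>] ex show ?thesis unfolding eq by blast
      qed
      then show ?case using IH \<open>S \<subseteq> univ M\<close> by auto
    qed auto
  qed
qed

text \<open>A model completion is defined by its models on \<open>nat\<close>. Its properties transfer to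
  models of any size, because a model can be replaced by a copy on \<open>nat\<close> of a countable
  elementary substructure containing the image of a given countable structure.\<close>

lemma countable_elementary_copy:
  assumes M: "models M T" and f: "embedding f D M" and D: "countable (univ D)"
  obtains N :: "nat struct" and g where "models N T" "embedding g D N"
    "\<And>\<phi> c. set c \<subseteq> univ D \<Longrightarrow> fv \<phi> \<subseteq> {..<length c} \<Longrightarrow>
       holds N \<phi> (map g c) \<longleftrightarrow> holds M \<phi> (map f c)"
proof -
  have M': "is_structure M" using M by (simp add: models_def)
  have "f ` univ D \<subseteq> univ M" "countable (f ` univ D)" using f D by (auto simp: embedding_def)
  from downward_Loewenheim_Skolem[OF M' this] obtain S where
    S: "f ` univ D \<subseteq> S" "S \<subseteq> univ M" "countable S" "is_structure (restr M S)"
    "\<And>\<phi> s. range s \<subseteq> S \<Longrightarrow> sat (restr M S) s \<phi> \<longleftrightarrow> sat M s \<phi>" by metis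
  obtain N :: "nat struct" and j where j: "embedding j (restr M S) N" "j ` univ (restr M S) = univ N"
    using countable_struct_nat_copy[OF S(4)] S(3) by (metis restr_simps(1))
  have f': "embedding f D (restr M S)" using f S(1) by (auto simp: embedding_def)
  have S': "models (restr M S) T" using M S by (auto simp: models_def)
  show ?thesis
  proof
    show "models N T" using S' j by (rule models_isomorphism)
    show "embedding (j \<circ> f) D N" using f' j(1) by (rule embedding_comp)
    fix \<phi> c assume c: "set c \<subseteq> univ D" and \<phi>: "fv \<phi> \<subseteq> {..<length c}"
    obtain d where d: "d \<in> S" using S(4) by (auto simp: is_structure_def)
    have fc: "set (map f c) \<subseteq> S" using c S(1) by auto
    have "holds N \<phi> (map (j \<circ> f) c) \<longleftrightarrow> holds N \<phi> (map j (map f c))" by simp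
    also have "\<dots> \<longleftrightarrow> holds (restr M S) \<phi> (map f c)"
      using fc \<phi> by (intro holds_isomorphism[OF S(4) j]) auto
    also have "\<dots> \<longleftrightarrow> sat (restr M S) (padded d (map f c)) \<phi>" using \<phi> by (intro holds_padded) auto
    also have "\<dots> \<longleftrightarrow> sat M (padded d (map f c)) \<phi>"
      using fc d by (intro S(5) range_padded)
    also have "\<dots> \<longleftrightarrow> holds M \<phi> (map f c)" using holds_padded[of \<phi> "map f c" M d] \<phi> by simp
    finally show "holds N \<phi> (map (j \<circ> f) c) \<longleftrightarrow> holds M \<phi> (map f c)" .
  qed
qed

lemma model_completion_models:
  assumes mc: "model_completion T T'" and M: "models M T'"
  shows "models M T"
proof -
  have M': "is_structure M" using M by (simp add: models_def)
  show ?thesis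
    unfolding models_def
  proof (intro conjI ballI allI impI M')
    fix \<phi> and s :: "nat \<Rightarrow> _" assume \<phi>: "\<phi> \<in> T" and s: "range s \<subseteq> univ M"
    have "countable (range s)" by simp
    from downward_Loewenheim_Skolem[OF M' s this] obtain S where S: "range s \<subseteq> S" "S \<subseteq> univ M" "countable S" "is_structure (restr M S)"
      "\<And>\<phi> s. range s \<subseteq> S \<Longrightarrow> sat (restr M S) s \<phi> \<longleftrightarrow> sat M s \<phi>" by metis
    obtain N :: "nat struct" and j where j: "embedding j (restr M S) N" "j ` univ (restr M S) = univ N"
      using countable_struct_nat_copy[OF S(4)] S(3) by (metis restr_simps(1))
    have "models (restr M S) T'" using M S by (auto simp: models_def)
    then have "models N T'" using j by (rule models_isomorphism)
    then have "models N T" using mc by (auto simp: model_completion_def)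
    then have "models (restr M S) T"
    proof (rule models_isomorphism)
      show "embedding (inv_into (univ (restr M S)) j) N (restr M S)"
        using S(4) j by (rule embedding_inverse)
      show "inv_into (univ (restr M S)) j ` univ N = univ (restr M S)"
        using j(1) unfolding j(2)[symmetric] embedding_def by (intro inv_into_image_cancel) auto
    qed
    then have "sat (restr M S) s \<phi>" using S(1) \<phi> by (simp add: models_def)
    then show "sat M s \<phi>" using S(5)[OF S(1)] by simp
  qed
qed

lemma model_completion_complete:
  assumes mc: "model_completion T T'"
    and D: "models D T" "countable (univ D)"
    and M1: "models M1 T'" "embedding f1 D M1"
    and M2: "models M2 T'" "embedding f2 D M2"
    and c: "set c \<subseteq> univ D" "fv \<phi> \<subseteq> {..<length c}"
  shows "holds M1 \<phi> (map f1 c) \<longleftrightarrow> holds M2 \<phi> (map f2 c)"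
proof -
  have D': "is_structure D" using D by (simp add: models_def)
  obtain E :: "nat struct" and j where j: "embedding j D E" "j ` univ D = univ E"
    using countable_struct_nat_copy[OF D' D(2)] by metis
  have E: "models E T" using D(1) j by (rule models_isomorphism)
  let ?i = "inv_into (univ D) j"
  have i: "embedding ?i E D" using D' j by (rule embedding_inverse)
  obtain N1 :: "nat struct" and g1 where N1: "models N1 T'" "embedding g1 D N1"
    "holds N1 \<phi> (map g1 c) \<longleftrightarrow> holds M1 \<phi> (map f1 c)"
    using countable_elementary_copy[OF M1 D(2)] c by metis
  obtain N2 :: "nat struct" and g2 where N2: "models N2 T'" "embedding g2 D N2"
    "holds N2 \<phi> (map g2 c) \<longleftrightarrow> holds M2 \<phi> (map f2 c)"
    using countable_elementary_copy[OF M2 D(2)] c by metis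
  have jc: "set (map j c) \<subseteq> univ E" "fv \<phi> \<subseteq> {..<length (map j c)}" using c j by auto
  have "holds N1 \<phi> (map (g1 \<circ> ?i) (map j c)) \<longleftrightarrow> holds N2 \<phi> (map (g2 \<circ> ?i) (map j c))"
    using mc E N1(1) N2(1) embedding_comp[OF i N1(2)] embedding_comp[OF i N2(2)] jc
    unfolding model_completion_def by blast
  moreover have "map (g \<circ> ?i) (map j c) = map g c" for g :: "_ \<Rightarrow> nat"
    using c(1) j(1) by (auto simp: embedding_def)
  ultimately show ?thesis using N1(3) N2(3) by (simp only:)
qed

lemma model_completion_extends:
  assumes mc: "model_completion T T'" and D: "models D T" "countable (univ D)"
  obtains N :: "nat struct" and g where "models N T'" "embedding g D N"
proof -
  have D': "is_structure D" using D by (simp add: models_def)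
  obtain E :: "nat struct" and j where j: "embedding j D E" "j ` univ D = univ E"
    using countable_struct_nat_copy[OF D' D(2)] by metis
  have "models E T" using D(1) j by (rule models_isomorphism)
  then obtain N :: "nat struct" and g where "models N T'" "embedding g E N"
    using mc unfolding model_completion_def by metis
  then show ?thesis using that embedding_comp[OF j(1)] by blast
qed

section \<open>Meet-trees with a graph on the cones above each point\<close>

locale tr =
  fixes M :: "'a struct"
  assumes struct: "is_structure M"
    and refl: "x \<in> univ M \<Longrightarrow> le M x x"
    and antisym: "\<lbrakk>x \<in> univ M; y \<in> univ M; le M x y; le M y x\<rbrakk> \<Longrightarrow> x = y"
    and trans: "\<lbrakk>x \<in> univ M; y \<in> univ M; z \<in> univ M; le M x y; le M y z\<rbrakk> \<Longrightarrow> le M x z"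
    and chain: "\<lbrakk>x \<in> univ M; y \<in> univ M; z \<in> univ M; le M y x; le M z x\<rbrakk> \<Longrightarrow> le M y z \<or> le M z y"
    and meet_le1: "\<lbrakk>x \<in> univ M; y \<in> univ M\<rbrakk> \<Longrightarrow> le M (meet M x y) x"
    and meet_le2: "\<lbrakk>x \<in> univ M; y \<in> univ M\<rbrakk> \<Longrightarrow> le M (meet M x y) y"
    and meet_greatest: "\<lbrakk>x \<in> univ M; y \<in> univ M; z \<in> univ M; le M z x; le M z y\<rbrakk> \<Longrightarrow> le M z (meet M x y)"
    and rel_irrefl: "\<lbrakk>x \<in> univ M; y \<in> univ M; z \<in> univ M; le M x (meet M y z); x \<noteq> meet M y z\<rbrakk>
      \<Longrightarrow> \<not> rel M x y z"
    and rel_sym: "\<lbrakk>x \<in> univ M; y \<in> univ M; z \<in> univ M; rel M x y z\<rbrakk> \<Longrightarrow> rel M x z y"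
    and rel_step: "\<lbrakk>x \<in> univ M; y \<in> univ M; y' \<in> univ M; z \<in> univ M; rel M x y z;
      le M x (meet M y y'); x \<noteq> meet M y y'\<rbrakk> \<Longrightarrow> rel M x y' z"
    and rel_below: "\<lbrakk>x \<in> univ M; y \<in> univ M; z \<in> univ M; rel M x y z\<rbrakk>
      \<Longrightarrow> le M x y \<and> x \<noteq> y \<and> le M x z \<and> x \<noteq> z"

lemma sat_TR:
  "(\<forall>\<phi>\<in>TR. sat M s \<phi>) \<longleftrightarrow>
     (\<forall>x\<in>univ M. le M x x) \<and>
     (\<forall>x\<in>univ M. \<forall>y\<in>univ M. le M x y \<and> le M y x \<longrightarrow> x = y) \<and>
     (\<forall>x\<in>univ M. \<forall>y\<in>univ M. \<forall>z\<in>univ M. le M x y \<and> le M y z \<longrightarrow> le M x z) \<and>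
     (\<forall>x\<in>univ M. \<forall>y\<in>univ M. \<forall>z\<in>univ M. le M y x \<and> le M z x \<longrightarrow> le M y z \<or> le M z y) \<and>
     (\<forall>x\<in>univ M. \<forall>y\<in>univ M. le M (meet M x y) x \<and> le M (meet M x y) y) \<and>
     (\<forall>x\<in>univ M. \<forall>y\<in>univ M. \<forall>z\<in>univ M. le M z x \<and> le M z y \<longrightarrow> le M z (meet M x y)) \<and>
     (\<forall>x\<in>univ M. \<forall>y\<in>univ M. \<forall>z\<in>univ M. le M x (meet M y z) \<and> x \<noteq> meet M y z \<longrightarrow> \<not> rel M x y z) \<and>
     (\<forall>x\<in>univ M. \<forall>y\<in>univ M. \<forall>z\<in>univ M. rel M x y z \<longrightarrow> rel M x z y) \<and>
     (\<forall>x\<in>univ M. \<forall>y\<in>univ M. \<forall>y'\<in>univ M. \<forall>z\<in>univ M.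
        rel M x y z \<and> (le M x (meet M y y') \<and> x \<noteq> meet M y y') \<longrightarrow> rel M x y' z) \<and>
     (\<forall>x\<in>univ M. \<forall>y\<in>univ M. \<forall>z\<in>univ M. rel M x y z \<longrightarrow> (le M x y \<and> x \<noteq> y) \<and> (le M x z \<and> x \<noteq> z))"
  by (simp only: TR_def Let_def ball_simps sat.simps tval.simps fun_upd_apply simp_thms
      bex_simps de_Morgan_conj de_Morgan_disj not_not imp_conv_disj if_True if_False
      zero_neq_one one_neq_zero num.distinct numeral_eq_iff zero_neq_numeral numeral_neq_zero one_eq_numeral_iff
      numeral_eq_one_iff disj_assoc conj_assoc)

lemma models_TR_iff: "models M TR \<longleftrightarrow> tr M"
proof
  assume m: "models M TR"
  then have st: "is_structure M" by (simp add: models_def)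
  then obtain d where d: "d \<in> univ M" by (auto simp: is_structure_def)
  then have "range (\<lambda>_::nat. d) \<subseteq> univ M" by auto
  then have "\<forall>\<phi>\<in>TR. sat M (\<lambda>_. d) \<phi>" using m unfolding models_def by blast
  then have ax: "\<forall>\<phi>\<in>TR. sat M (\<lambda>_. d) \<phi>" .
  note 1 = ax[unfolded sat_TR]
  note 2 = 1[THEN conjunct2] note 3 = 2[THEN conjunct2] note 4 = 3[THEN conjunct2]
  note 5 = 4[THEN conjunct2] note 6 = 5[THEN conjunct2] note 7 = 6[THEN conjunct2]
  note 8 = 7[THEN conjunct2] note 9 = 8[THEN conjunct2] note 10 = 9[THEN conjunct2]
  show "tr M"
    by unfold_locales (fact st, use 1[THEN conjunct1] in blast, use 2[THEN conjunct1] in blast,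
        use 3[THEN conjunct1] in blast, use 4[THEN conjunct1] in blast,
        use 5[THEN conjunct1] in blast, use 5[THEN conjunct1] in blast,
        use 6[THEN conjunct1] in blast, use 7[THEN conjunct1] in blast,
        use 8[THEN conjunct1] in blast, use 9[THEN conjunct1] in blast, use 10 in blast)
next
  assume "tr M"
  then interpret tr M .
  have "\<forall>\<phi>\<in>TR. sat M s \<phi>" for s
    unfolding sat_TR
    by (intro conjI, use refl in blast, use antisym in blast, use trans in blast,
        use chain in blast, use meet_le1 meet_le2 in blast, use meet_greatest in blast,
        use rel_irrefl in blast, use rel_sym in blast, use rel_step in blast, use rel_below in blast)
  then show "models M TR" using struct by (simp add: models_def)
qed

inductive_set meet_closure :: "'a struct \<Rightarrow> 'a set \<Rightarrow> 'a set" for M X where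
  gen: "x \<in> X \<Longrightarrow> x \<in> meet_closure M X"
| meet: "x \<in> meet_closure M X \<Longrightarrow> y \<in> meet_closure M X \<Longrightarrow> meet M x y \<in> meet_closure M X"

lemma cl_mono: "X \<subseteq> Y \<Longrightarrow> meet_closure M X \<subseteq> meet_closure M Y"
proof
  fix x assume "X \<subseteq> Y" and x: "x \<in> meet_closure M X"
  from x show "x \<in> meet_closure M Y" by induction (use \<open>X \<subseteq> Y\<close> in \<open>auto intro: meet_closure.intros\<close>)
qed

lemma cl_gens: "X \<subseteq> meet_closure M X"
  by (auto intro: meet_closure.gen)

lemma cl_terms:
  assumes "x \<in> meet_closure M (set c)"
  shows "\<exists>t. tvars t \<subseteq> {..<length c} \<and> x = tval M ((!) c) t"
  using assms
proof induction
  case (gen x)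
  then obtain i where "i < length c" "c ! i = x" by (auto simp: in_set_conv_nth)
  then show ?case by (intro exI[of _ "Var i"]) auto
next
  case (meet x y)
  then obtain t u where "tvars t \<subseteq> {..<length c}" "x = tval M ((!) c) t"
    "tvars u \<subseteq> {..<length c}" "y = tval M ((!) c) u" by auto
  then show ?case by (intro exI[of _ "Meet t u"]) auto
qed

lemma countable_cl:
  assumes "countable X"
  shows "countable (meet_closure M X)"
proof (cases "X = {}")
  case True
  have "x \<in> meet_closure M X \<Longrightarrow> False" for x by (induction rule: meet_closure.induct) (auto simp: True)
  then have "meet_closure M X = {}" by auto
  then show ?thesis by simp
next
  case False
  define s where "s = from_nat_into X"
  have X: "X = range s" using assms False by (simp add: s_def)
  have "\<exists>t. x = tval M s t" if "x \<in> meet_closure M X" for x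
    using that
  proof induction
    case (gen x) then show ?case using X by (metis rangeE tval.simps(1))
  next
    case (meet x y) then show ?case by (metis tval.simps(2))
  qed
  then have "meet_closure M X \<subseteq> range (tval M s)" by auto
  then show ?thesis by (rule countable_subset) simp
qed

context tr
begin

abbreviation U :: "'a set" where "U \<equiv> univ M"
abbreviation leq (infix "\<preceq>" 50) where "x \<preceq> y \<equiv> le M x y"
abbreviation lt (infix "\<prec>" 50) where "x \<prec> y \<equiv> le M x y \<and> x \<noteq> y"
abbreviation mt (infixl "\<sqinter>" 70) where "x \<sqinter> y \<equiv> meet M x y"

definition closed :: "'a set \<Rightarrow> bool" where
  "closed C \<longleftrightarrow> C \<subseteq> U \<and> (\<forall>x\<in>C. \<forall>y\<in>C. x \<sqinter> y \<in> C)"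

lemma meet_in [simp, intro]: "x \<in> U \<Longrightarrow> y \<in> U \<Longrightarrow> x \<sqinter> y \<in> U"
  using struct by (simp add: is_structure_def)

lemma closed_cl: "X \<subseteq> U \<Longrightarrow> closed (meet_closure M X)"
proof -
  assume X: "X \<subseteq> U"
  have "x \<in> U" if "x \<in> meet_closure M X" for x
    using that by induction (use X in auto)
  then show ?thesis by (auto simp: closed_def intro: meet_closure.meet)
qed

lemma cl_in_U: "X \<subseteq> U \<Longrightarrow> x \<in> meet_closure M X \<Longrightarrow> x \<in> U"
  using closed_cl by (auto simp: closed_def)

lemma cl_least: "closed C \<Longrightarrow> X \<subseteq> C \<Longrightarrow> meet_closure M X \<subseteq> C"
proof
  fix x assume C: "closed C" "X \<subseteq> C" and x: "x \<in> meet_closure M X"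
  from x show "x \<in> C" by induction (use C in \<open>auto simp: closed_def\<close>)
qed

lemma cl_below_generator: 
  assumes "X \<subseteq> U" "x \<in> meet_closure M X"
  shows "\<exists>g\<in>X. x \<preceq> g"
  using assms(2)
proof induction
  case (gen x) then show ?case using refl assms by auto
next
  case (meet x y)
  then obtain g where g: "g \<in> X" "x \<preceq> g" by blast
  have "x \<in> U" "y \<in> U" "g \<in> U" using meet g assms(1) cl_in_U by auto
  then show ?case using g meet_le1[of x y] trans[of "x \<sqinter> y" x g] by auto
qed

lemma meet_eq1: "x \<in> U \<Longrightarrow> y \<in> U \<Longrightarrow> x \<preceq> y \<Longrightarrow> x \<sqinter> y = x"
  using antisym[of "x \<sqinter> y" x] meet_le1[of x y] meet_greatest[of x y x] refl by simp

lemma meet_comm: "x \<in> U \<Longrightarrow> y \<in> U \<Longrightarrow> x \<sqinter> y = y \<sqinter> x"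
  using antisym[of "x \<sqinter> y" "y \<sqinter> x"] meet_le1[of x y] meet_le2[of x y] meet_le1[of y x]
    meet_le2[of y x] meet_greatest[of x y "y \<sqinter> x"] meet_greatest[of y x "x \<sqinter> y"] by simp

lemma le_meet_iff: "x \<in> U \<Longrightarrow> y \<in> U \<Longrightarrow> z \<in> U \<Longrightarrow> z \<preceq> x \<sqinter> y \<longleftrightarrow> z \<preceq> x \<and> z \<preceq> y"
  using meet_greatest[of x y z] meet_le1[of x y] meet_le2[of x y]
    trans[of z "x \<sqinter> y" x] trans[of z "x \<sqinter> y" y] by auto

lemma lt_le_trans: "x \<in> U \<Longrightarrow> y \<in> U \<Longrightarrow> z \<in> U \<Longrightarrow> x \<prec> y \<Longrightarrow> y \<preceq> z \<Longrightarrow> x \<prec> z"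
  using trans[of x y z] antisym[of x y] by auto

lemma le_lt_trans: "x \<in> U \<Longrightarrow> y \<in> U \<Longrightarrow> z \<in> U \<Longrightarrow> x \<preceq> y \<Longrightarrow> y \<prec> z \<Longrightarrow> x \<prec> z"
  using trans[of x y z] antisym[of y z] by auto

text \<open>\<open>u \<prec> a \<sqinter> b\<close> says that \<open>a\<close> and \<open>b\<close> lie in the same open cone above \<open>u\<close>. The
  meets \<open>a \<sqinter> b\<close> and \<open>b \<sqinter> c\<close> are comparable, as both lie below \<open>b\<close>.\<close>

lemma cone_trans:
  assumes "u \<in> U" "a \<in> U" "b \<in> U" "c \<in> U" "u \<prec> a \<sqinter> b" "u \<prec> b \<sqinter> c"
  shows "u \<prec> a \<sqinter> c"
proof -
  have in_U: "a \<sqinter> b \<in> U" "b \<sqinter> c \<in> U" using assms by auto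
  have "a \<sqinter> b \<preceq> b \<sqinter> c \<or> b \<sqinter> c \<preceq> a \<sqinter> b"
    using assms by (intro chain[of b]) (auto intro: meet_le1 meet_le2)
  then obtain m where m: "m \<in> U" "u \<prec> m" "m \<preceq> a \<sqinter> b" "m \<preceq> b \<sqinter> c"
    using assms refl[OF in_U(1)] refl[OF in_U(2)] in_U by blast
  then have "m \<preceq> a \<sqinter> c" using assms by (auto simp: le_meet_iff)
  then show ?thesis using lt_le_trans[of u m "a \<sqinter> c"] m assms by auto
qed

lemma cone_mono:
  assumes "u \<in> U" "a \<in> U" "b \<in> U" "u \<prec> a" "a \<preceq> b"
  shows "u \<prec> a \<sqinter> b"
  using assms by (simp add: meet_eq1)

lemma rel_cong_cone:
  assumes "u \<in> U" "a \<in> U" "b \<in> U" "c \<in> U" "u \<prec> a \<sqinter> b"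
  shows "rel M u a c \<longleftrightarrow> rel M u b c" "rel M u c a \<longleftrightarrow> rel M u c b"
proof -
  have 1: "rel M u a c \<longleftrightarrow> rel M u b c"
    using assms rel_step[of u a b c] rel_step[of u b a c] meet_comm[of a b] by metis
  have "rel M u c x \<longleftrightarrow> rel M u x c" if "x \<in> U" for x using rel_sym that assms by blast
  with 1 show "rel M u a c \<longleftrightarrow> rel M u b c" "rel M u c a \<longleftrightarrow> rel M u c b" using assms by auto
qed

lemma not_rel_same: "u \<in> U \<Longrightarrow> a \<in> U \<Longrightarrow> \<not> rel M u a a"
  using rel_below[of u a a] rel_irrefl[of u a a] meet_eq1[of a a] refl[of a] by auto

lemma rel_comm: "x \<in> U \<Longrightarrow> y \<in> U \<Longrightarrow> z \<in> U \<Longrightarrow> rel M x y z \<longleftrightarrow> rel M x z y"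
  using rel_sym by blast

lemma tr_restr:
  assumes "closed C" "C \<noteq> {}"
  shows "tr (restr M C)" (is "tr ?R")
proof -
  have CU: "x \<in> C \<Longrightarrow> x \<in> U" for x using assms by (auto simp: closed_def)
  have Cm: "x \<in> C \<Longrightarrow> y \<in> C \<Longrightarrow> x \<sqinter> y \<in> C" for x y using assms by (auto simp: closed_def)
  show ?thesis
  proof
    show "is_structure ?R" using Cm assms by (simp add: is_structure_def)
    fix x assume "x \<in> univ ?R"
    then have x: "x \<in> C" "x \<in> U" using CU by auto
    show "le ?R x x" using refl x by simp
    fix y assume "y \<in> univ ?R"
    then have y: "y \<in> C" "y \<in> U" using CU by auto
    show "le ?R (meet ?R x y) x" "le ?R (meet ?R x y) y" using x y meet_le1 meet_le2 by auto
    show "x = y" if "le ?R x y" "le ?R y x" using that x y antisym by simp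
    fix z assume "z \<in> univ ?R"
    then have z: "z \<in> C" "z \<in> U" using CU by auto
    show "le ?R x z" if "le ?R x y" "le ?R y z" using that x y z trans[of x y z] by simp
    show "le ?R y z \<or> le ?R z y" if "le ?R y x" "le ?R z x" using that x y z chain[of x y z] by simp
    show "le ?R z (meet ?R x y)" if "le ?R z x" "le ?R z y"
      using that x y z meet_greatest[of x y z] by simp
    show "\<not> rel ?R x y z" if "le ?R x (meet ?R y z)" "x \<noteq> meet ?R y z"
      using that x y z rel_irrefl[of x y z] by simp
    show "rel ?R x z y" if "rel ?R x y z" using that x y z rel_sym[of x y z] by simp
    show "le ?R x y \<and> x \<noteq> y \<and> le ?R x z \<and> x \<noteq> z" if "rel ?R x y z"
      using that x y z rel_below[of x y z] by simp
    fix z' assume "z' \<in> univ ?R"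
    then have "z' \<in> U" using CU by simp
    then show "rel ?R x z z'" if "rel ?R x y z'" "le ?R x (meet ?R y z)" "x \<noteq> meet ?R y z"
      using that x y z rel_step[of x y z z'] by simp
  qed
qed

text \<open>The extension of \<open>C\<close> by a point \<open>None\<close> in a new cone above \<open>e\<close>, joined in the graph at
  \<open>e\<close> to the cones that meet \<open>G\<close>. Above a point below \<open>e\<close> it lies in the cone of \<open>e\<close> and
  inherits the edges of that cone.\<close>

definition add_cone :: "'a set \<Rightarrow> 'a \<Rightarrow> 'a set \<Rightarrow> 'a option struct" where
  "add_cone C e G = \<lparr>univ = insert None (Some ` C),
     le = (\<lambda>p q. case (p, q) of (Some a, Some b) \<Rightarrow> a \<preceq> b | (Some a, None) \<Rightarrow> a \<preceq> e
            | (None, Some b) \<Rightarrow> False | (None, None) \<Rightarrow> True),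
     meet = (\<lambda>p q. case (p, q) of (Some a, Some b) \<Rightarrow> Some (a \<sqinter> b) | (Some a, None) \<Rightarrow> Some (a \<sqinter> e)
            | (None, Some b) \<Rightarrow> Some (e \<sqinter> b) | (None, None) \<Rightarrow> None),
     rel = (\<lambda>p q r. case (p, q, r) of (Some a, Some b, Some c) \<Rightarrow> rel M a b c
            | (Some a, None, Some c) \<Rightarrow> a = e \<and> c \<in> G \<or> a \<prec> e \<and> rel M a e c
            | (Some a, Some b, None) \<Rightarrow> a = e \<and> b \<in> G \<or> a \<prec> e \<and> rel M a b e
            | _ \<Rightarrow> False)\<rparr>"

lemma add_cone_simps [simp]:
  "univ (add_cone C e G) = insert None (Some ` C)"
  "le (add_cone C e G) (Some a) (Some b) \<longleftrightarrow> a \<preceq> b"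
  "le (add_cone C e G) (Some a) None \<longleftrightarrow> a \<preceq> e"
  "\<not> le (add_cone C e G) None (Some b)"
  "le (add_cone C e G) None None"
  "meet (add_cone C e G) (Some a) (Some b) = Some (a \<sqinter> b)"
  "meet (add_cone C e G) (Some a) None = Some (a \<sqinter> e)"
  "meet (add_cone C e G) None (Some b) = Some (e \<sqinter> b)"
  "meet (add_cone C e G) None None = None"
  "rel (add_cone C e G) (Some a) (Some b) (Some c) \<longleftrightarrow> rel M a b c"
  "rel (add_cone C e G) (Some a) None (Some c) \<longleftrightarrow> a = e \<and> c \<in> G \<or> a \<prec> e \<and> rel M a e c"
  "rel (add_cone C e G) (Some a) (Some c) None \<longleftrightarrow> a = e \<and> c \<in> G \<or> a \<prec> e \<and> rel M a c e"
  "\<not> rel (add_cone C e G) None q r"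
  "\<not> rel (add_cone C e G) p None None"
  by (cases p; simp add: add_cone_def)+

lemma tr_add_cone:
  assumes C: "closed C" and e: "e \<in> C"
    and G: "G \<subseteq> C" "\<And>a. a \<in> G \<Longrightarrow> e \<prec> a"
    and G_cone: "\<And>a b. a \<in> G \<Longrightarrow> b \<in> C \<Longrightarrow> e \<prec> a \<sqinter> b \<Longrightarrow> b \<in> G"
  shows "tr (add_cone C e G)" (is "tr ?D")
proof -
  have CU: "a \<in> C \<Longrightarrow> a \<in> U" for a using C by (auto simp: closed_def)
  have Cm: "a \<in> C \<Longrightarrow> b \<in> C \<Longrightarrow> a \<sqinter> b \<in> C" for a b using C by (auto simp: closed_def)
  have eU: "e \<in> U" using e CU by blast
  have not_new: "\<not> e \<prec> a \<sqinter> e" "\<not> e \<prec> e \<sqinter> a" if "a \<in> C" for a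
    using that CU eU antisym[of e "a \<sqinter> e"] meet_le2[of a e] antisym[of e "e \<sqinter> a"] meet_le1[of e a]
    by auto
  (* The projection that replaces the new point by e preserves the order, the meets and the
     edges at points other than e; so most axioms follow from those of M at projected points. *)
  define \<pi> where "\<pi> p = (case p of Some a \<Rightarrow> a | None \<Rightarrow> e)" for p
  have \<pi>_simps [simp]: "\<pi> (Some a) = a" "\<pi> None = e" for a by (simp_all add: \<pi>_def)
  have \<pi>U: "p \<in> univ ?D \<Longrightarrow> \<pi> p \<in> U" for p using CU eU by (cases p) auto
  show ?thesis
  proof
    show "is_structure ?D" using Cm e by (auto simp: is_structure_def)
  next
    fix x assume "x \<in> univ ?D" then show "le ?D x x" using refl CU by (cases x) auto
  next
    fix x y assume *: "x \<in> univ ?D" "y \<in> univ ?D" "le ?D x y" "le ?D y x"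
    then show "x = y" using antisym CU by (cases x; cases y) auto
  next
    fix x y z assume *: "x \<in> univ ?D" "y \<in> univ ?D" "z \<in> univ ?D" "le ?D x y" "le ?D y z"
    with * show "le ?D x z" using trans[OF \<pi>U[OF *(1)] \<pi>U[OF *(2)] \<pi>U[OF *(3)]] by (cases x; cases y; cases z) simp_all
  next
    fix x y z assume *: "x \<in> univ ?D" "y \<in> univ ?D" "z \<in> univ ?D" "le ?D y x" "le ?D z x"
    then show "le ?D y z \<or> le ?D z y" using chain[OF \<pi>U[OF *(1)] \<pi>U[OF *(2)] \<pi>U[OF *(3)]] by (cases x; cases y; cases z) simp_all
  next
    fix x y assume *: "x \<in> univ ?D" "y \<in> univ ?D"
    then show "le ?D (meet ?D x y) x" "le ?D (meet ?D x y) y"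
      using meet_le1[OF \<pi>U[OF *(1)] \<pi>U[OF *(2)]] meet_le2[OF \<pi>U[OF *(1)] \<pi>U[OF *(2)]] *
      by (cases x; cases y; simp)+
  next
    fix x y z assume *: "x \<in> univ ?D" "y \<in> univ ?D" "z \<in> univ ?D" "le ?D z x" "le ?D z y"
    then show "le ?D z (meet ?D x y)"
      using meet_greatest[OF \<pi>U[OF *(1)] \<pi>U[OF *(2)] \<pi>U[OF *(3)]] by (cases x; cases y; cases z) simp_all
  next
    fix x y z assume *: "x \<in> univ ?D" "y \<in> univ ?D" "z \<in> univ ?D" "le ?D x (meet ?D y z)"
      "x \<noteq> meet ?D y z"
    then show "\<not> rel ?D x y z"
      using rel_irrefl[OF \<pi>U[OF *(1)] \<pi>U[OF *(2)] \<pi>U[OF *(3)]] not_new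
      by (cases x; cases y; cases z) (simp_all, blast+)
  next
    fix x y z assume *: "x \<in> univ ?D" "y \<in> univ ?D" "z \<in> univ ?D" "rel ?D x y z"
    then show "rel ?D x z y"
      using rel_sym[OF \<pi>U[OF *(1)] \<pi>U[OF *(2)] \<pi>U[OF *(3)]] by (cases x; cases y; cases z) auto
  next
    fix x y y' z assume *: "x \<in> univ ?D" "y \<in> univ ?D" "y' \<in> univ ?D" "z \<in> univ ?D" "rel ?D x y z"
      "le ?D x (meet ?D y y')" "x \<noteq> meet ?D y y'"
    obtain a where a: "x = Some a" "a \<in> C" "a \<in> U" using * CU by (cases x) auto
    show "rel ?D x y' z"
    proof (cases z)
      case None
      then obtain b where b: "y = Some b" "b \<in> C" "b \<in> U" using * CU by (cases y) (auto simp: a)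
      show ?thesis
      proof (cases y')
        case None
        then have "a \<prec> b \<sqinter> e" "rel M a b e" using * \<open>z = None\<close> a b not_new by auto
        then show ?thesis using rel_irrefl a b eU by blast
      next
        case (Some b')
        then show ?thesis using * \<open>z = None\<close> a b CU eU G_cone rel_step[of a b b' e] by auto
      qed
    next
      case (Some c)
      then have c: "c \<in> C" "c \<in> U" using * CU by auto
      have mono: "a \<prec> e" if "a \<prec> e \<sqinter> b \<or> a \<prec> b \<sqinter> e" "b \<in> C" for b
        using that a eU CU lt_le_trans[of a "e \<sqinter> b" e] lt_le_trans[of a "b \<sqinter> e" e]
          meet_le1[of e b] meet_le2[of b e] by auto
      show ?thesis
      proof (cases y)
        case None
        show ?thesis
        proof (cases y')
          case None then show ?thesis using * \<open>y = None\<close> by simp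
        next
          case (Some b')
          then have "b' \<in> C" "a \<prec> e \<sqinter> b'" using * a \<open>y = None\<close> by auto
          then show ?thesis using mono[of b'] * a c eU CU \<open>y = None\<close> \<open>z = Some c\<close> Some rel_step[of a e b' c] by auto
        qed
      next
        case (Some b)
        then have b: "b \<in> C" "b \<in> U" using * CU by auto
        show ?thesis
        proof (cases y')
          case None
          then have "a \<prec> b \<sqinter> e" using * a \<open>y = Some b\<close> by auto
          then show ?thesis using mono[of b] * a b c eU None \<open>y = Some b\<close> \<open>z = Some c\<close> rel_step[of a b e c] by auto
        next
          case (Some b')
          then show ?thesis using * a b c CU \<open>y = Some b\<close> \<open>z = Some c\<close> rel_step[of a b b' c] by auto
        qed
      qed
    qed
  next
    fix x y z assume *: "x \<in> univ ?D" "y \<in> univ ?D" "z \<in> univ ?D" "rel ?D x y z"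
    then show "le ?D x y \<and> x \<noteq> y \<and> le ?D x z \<and> x \<noteq> z"
      using rel_below[OF \<pi>U[OF *(1)] \<pi>U[OF *(2)] \<pi>U[OF *(3)]] G(2) refl[OF eU]
      by (cases x; cases y; cases z) (simp_all, blast+)
  qed
qed

end

definition nat_chain :: "nat set \<Rightarrow> nat struct" where
  "nat_chain S = \<lparr>univ = S, le = (\<le>), meet = min, rel = \<lambda>_ _ _. False\<rparr>"

lemma nat_chain_simps [simp]:
  "univ (nat_chain S) = S" "le (nat_chain S) = (\<le>)" "meet (nat_chain S) = min"
  "\<not> rel (nat_chain S) a b c"
  by (simp_all add: nat_chain_def)

lemma tr_nat_chain: "S \<noteq> {} \<Longrightarrow> tr (nat_chain S)"
  by unfold_locales (auto simp: is_structure_def min_def)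

section \<open>Homogeneity and saturation of the monster model\<close>

lemma countable_less_uncountable:
  assumes "natLeq <o \<kappa>" "countable A"
  shows "|A| <o \<kappa>"
proof -
  have "|A| \<le>o |UNIV :: nat set|"
    using assms(2) by (auto simp: countable_def card_of_ordLeq[symmetric])
  also have "|UNIV :: nat set| =o natLeq" by (rule card_of_nat)
  finally show ?thesis using assms(1) by (rule ordLeq_ordLess_trans)
qed

definition big_And :: "fm list \<Rightarrow> fm" where
  "big_And \<phi>s = foldr And \<phi>s (Eq (Var 0) (Var 0))"

lemma sat_big_And [simp]: "sat M s (big_And \<phi>s) \<longleftrightarrow> (\<forall>\<phi>\<in>set \<phi>s. sat M s \<phi>)"
  unfolding big_And_def by (induction \<phi>s) auto

lemma fv_big_And: "fv (big_And \<phi>s) = insert 0 (\<Union>\<phi>\<in>set \<phi>s. fv \<phi>)"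
  unfolding big_And_def by (induction \<phi>s) auto

locale dtr_monster =
  fixes DTR :: "fm set" and \<kappa> :: "'k rel" and M :: "'a struct"
  assumes completion: "model_completion TR DTR" and monster: "monster_model \<kappa> DTR M"
begin

lemma models_M: "models M DTR"
  using monster by (simp add: monster_model_def)

sublocale tr M
  using model_completion_models[OF completion models_M] by (simp add: models_TR_iff)

lemma small: "countable A \<Longrightarrow> |A| <o \<kappa>"
  using monster by (auto simp: monster_model_def intro: countable_less_uncountable)

lemma saturation:
  assumes "countable A" "partial_type M A 1 \<Sigma>" "A \<subseteq> U"
  shows "\<exists>b\<in>U. \<forall>\<phi> c. (\<phi>, c) \<in> \<Sigma> \<longrightarrow> holds M \<phi> (b # c)"
proof -
  have "saturated \<kappa> M" using monster by (simp add: monster_model_def)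
  then obtain b where b: "realizes M [b] \<Sigma>"
    using assms small[OF assms(1)] unfolding saturated_def by blast
  then show ?thesis by (auto simp: realizes_def intro!: bexI[of _ b])
qed

definition partial_iso :: "'a set \<Rightarrow> ('a \<Rightarrow> 'a) \<Rightarrow> bool" where
  "partial_iso C f \<longleftrightarrow> closed C \<and> embedding f (restr M C) M"

lemma partial_iso_mono: "partial_iso C f \<Longrightarrow> D \<subseteq> C \<Longrightarrow> closed D \<Longrightarrow> partial_iso D f"
  by (auto simp: partial_iso_def embedding_def subset_iff inj_on_def)

lemma
  assumes "partial_iso C f"
  shows partial_iso_closed: "closed C"
    and partial_iso_subset: "x \<in> C \<Longrightarrow> x \<in> U"
    and partial_iso_in: "x \<in> C \<Longrightarrow> f x \<in> U"
    and partial_iso_meet: "x \<in> C \<Longrightarrow> y \<in> C \<Longrightarrow> f (x \<sqinter> y) = f x \<sqinter> f y"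
    and partial_iso_meet_in: "x \<in> C \<Longrightarrow> y \<in> C \<Longrightarrow> x \<sqinter> y \<in> C"
    and partial_iso_le: "x \<in> C \<Longrightarrow> y \<in> C \<Longrightarrow> f x \<preceq> f y \<longleftrightarrow> x \<preceq> y"
    and partial_iso_eq: "x \<in> C \<Longrightarrow> y \<in> C \<Longrightarrow> f x = f y \<longleftrightarrow> x = y"
    and partial_iso_rel: "x \<in> C \<Longrightarrow> y \<in> C \<Longrightarrow> z \<in> C \<Longrightarrow> rel M (f x) (f y) (f z) \<longleftrightarrow> rel M x y z"
  using assms by (auto simp: partial_iso_def embedding_def closed_def inj_on_def)

lemma partial_iso_id: "closed C \<Longrightarrow> partial_iso C (\<lambda>x. x)"
  by (auto simp: partial_iso_def embedding_def closed_def)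

lemma partial_iso_cl: "partial_iso C f \<Longrightarrow> x \<in> meet_closure M X \<Longrightarrow> X \<subseteq> C \<Longrightarrow> x \<in> C"
  using cl_least partial_iso_closed by blast

lemma partial_iso_image_cl:
  assumes "partial_iso C f" "X \<subseteq> C" "x \<in> meet_closure M X"
  shows "f x \<in> meet_closure M (f ` X)"
  using assms(3)
proof induction
  case (gen x) then show ?case by (auto intro: meet_closure.gen)
next
  case (meet x y)
  then show ?case using partial_iso_meet[OF assms(1)] partial_iso_cl[OF assms(1) _ assms(2)]
    by (auto intro: meet_closure.meet)
qed

lemma partial_iso_fixes_cl:
  assumes "partial_iso C f" "X \<subseteq> C" "\<And>x. x \<in> X \<Longrightarrow> f x = x" "x \<in> meet_closure M X"
  shows "f x = x"
  using assms(4)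
proof induction
  case (gen x) then show ?case by (simp add: assms)
next
  case (meet x y)
  then show ?case using partial_iso_meet[OF assms(1)] partial_iso_cl[OF assms(1) _ assms(2)] by auto
qed

text \<open>This is quantifier elimination: the substructure generated by \<open>c\<close> is a countable model
  of \<open>TR\<close>, and both the inclusion and \<open>f\<close> embed it into \<open>M\<close>, so the completeness of \<open>DTR\<close> over
  its diagram applies.\<close>

lemma partial_iso_preserves:
  assumes f: "partial_iso C f" and c: "set c \<subseteq> C" and \<phi>: "fv \<phi> \<subseteq> {..<length c}"
  shows "holds M \<phi> (map f c) \<longleftrightarrow> holds M \<phi> c"
proof (cases "c = []")
  case False
  let ?D = "restr M (meet_closure M (set c))"
  have CU: "C \<subseteq> U" using partial_iso_subset[OF f] by blast
  have cU: "set c \<subseteq> U" using CU c by blast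
  have "meet_closure M (set c) \<subseteq> C" using cl_least[OF partial_iso_closed[OF f] c] .
  then have f': "partial_iso (meet_closure M (set c)) f" using partial_iso_mono[OF f] closed_cl[OF cU] by blast
  have "meet_closure M (set c) \<noteq> {}" using False cl_gens[of "set c" M] by auto
  then have D: "models ?D TR"
    using closed_cl[OF cU] tr_restr by (simp add: models_TR_iff)
  have id: "embedding (\<lambda>x. x) ?D M" using partial_iso_id[OF closed_cl[OF cU]] by (simp add: partial_iso_def)
  have "holds M \<phi> (map f c) \<longleftrightarrow> holds M \<phi> (map (\<lambda>x. x) c)"
    using f' id \<phi> cl_gens[of "set c" M]
    by (intro model_completion_complete[OF completion D _ models_M _ models_M])
      (auto simp: partial_iso_def countable_cl countable_finite)
  then show ?thesis by simp
qed simp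

text \<open>Conversely, tuples of the same type generate isomorphic substructures; the isomorphism
  maps the value of a term at one tuple to its value at the other.\<close>

lemma partial_iso_of_same_type:
  assumes len: "length c = length d" and c: "set c \<subseteq> U" and d: "set d \<subseteq> U"
    and same: "\<And>\<phi>. fv \<phi> \<subseteq> {..<length c} \<Longrightarrow> holds M \<phi> c \<longleftrightarrow> holds M \<phi> d"
  obtains f where "partial_iso (meet_closure M (set c)) f" "map f c = d"
proof -
  define f where "f x = tval M ((!) d) (SOME t. tvars t \<subseteq> {..<length c} \<and> x = tval M ((!) c) t)" for x
  let ?C = "{t. tvars t \<subseteq> {..<length c}}"
  have eq: "tval M ((!) c) t = tval M ((!) c) u \<longleftrightarrow> tval M ((!) d) t = tval M ((!) d) u"
    if "t \<in> ?C" "u \<in> ?C" for t u using same[of "Eq t u"] that by simp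
  have f: "f (tval M ((!) c) t) = tval M ((!) d) t" if t: "t \<in> ?C" for t
  proof -
    let ?P = "\<lambda>u. tvars u \<subseteq> {..<length c} \<and> tval M ((!) c) t = tval M ((!) c) u"
    have "?P (SOME u. ?P u)" by (rule someI[of ?P t]) (use t in auto)
    then show ?thesis using eq[OF t, of "SOME u. ?P u"] by (simp add: f_def)
  qed
  have meet_closure: "\<exists>t\<in>?C. x = tval M ((!) c) t" if "x \<in> meet_closure M (set c)" for x
    using cl_terms[OF that] by auto
  have "tval M ((!) d) t \<in> U" if "t \<in> ?C" for t
    using struct that d len by (intro tval_in_univ) (auto simp: subset_iff)
  then have 1: "f ` meet_closure M (set c) \<subseteq> U" using meet_closure f by fastforce
  have 2: "inj_on f (meet_closure M (set c))"
  proof (rule inj_onI)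
    fix x y assume xy: "x \<in> meet_closure M (set c)" "y \<in> meet_closure M (set c)" "f x = f y"
    then show "x = y" using meet_closure[of x] meet_closure[of y] f eq by auto
  qed
  have 3: "f (x \<sqinter> y) = f x \<sqinter> f y" if xy: "x \<in> meet_closure M (set c)" "y \<in> meet_closure M (set c)" for x y
  proof -
    obtain t u where "t \<in> ?C" "x = tval M ((!) c) t" "u \<in> ?C" "y = tval M ((!) c) u"
      using meet_closure[OF xy(1)] meet_closure[OF xy(2)] by auto
    then show ?thesis using f[of t] f[of u] f[of "Meet t u"] by simp
  qed
  have 4: "x \<preceq> y \<longleftrightarrow> f x \<preceq> f y" if xy: "x \<in> meet_closure M (set c)" "y \<in> meet_closure M (set c)" for x y
  proof -
    obtain t u where "t \<in> ?C" "x = tval M ((!) c) t" "u \<in> ?C" "y = tval M ((!) c) u"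
      using meet_closure[OF xy(1)] meet_closure[OF xy(2)] by auto
    then show ?thesis using f[of t] f[of u] same[of "Le t u"] by simp
  qed
  have 5: "rel M x y z \<longleftrightarrow> rel M (f x) (f y) (f z)"
    if xyz: "x \<in> meet_closure M (set c)" "y \<in> meet_closure M (set c)" "z \<in> meet_closure M (set c)" for x y z
  proof -
    obtain t u v where "t \<in> ?C" "x = tval M ((!) c) t" "u \<in> ?C" "y = tval M ((!) c) u"
      "v \<in> ?C" "z = tval M ((!) c) v"
      using meet_closure[OF xyz(1)] meet_closure[OF xyz(2)] meet_closure[OF xyz(3)] by auto
    then show ?thesis using f[of t] f[of u] f[of v] same[of "Rel t u v"] by simp
  qed
  show ?thesis
  proof
    show "partial_iso (meet_closure M (set c)) f"
      using closed_cl[OF c] 1 2 3 4 5 by (simp add: partial_iso_def embedding_def)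
    show "map f c = d"
    proof (rule nth_equalityI)
      fix i assume "i < length (map f c)"
      then show "map f c ! i = d ! i" using f[of "Var i"] by simp
    qed (simp add: len)
  qed
qed

lemma automorphism_of_partial_iso:
  assumes f: "partial_iso C f" and A: "countable A" "A \<subseteq> C"
  obtains \<sigma> where "automorphism \<sigma> M" "\<And>a. a \<in> A \<Longrightarrow> \<sigma> a = f a"
proof -
  have "partial_elementary M A f"
    unfolding partial_elementary_def
  proof (intro conjI allI impI)
    show "A \<subseteq> U" "f ` A \<subseteq> U" using A partial_iso_subset[OF f] partial_iso_in[OF f] by auto
    fix \<phi> c assume "set c \<subseteq> A \<and> fv \<phi> \<subseteq> {..<length c}"
    then show "holds M \<phi> c \<longleftrightarrow> holds M \<phi> (map f c)"
      using partial_iso_preserves[OF f, of c \<phi>] A by auto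
  qed
  moreover have "strongly_homogeneous \<kappa> M" using monster by (simp add: monster_model_def)
  ultimately show ?thesis using that small[OF A(1)] unfolding strongly_homogeneous_def by blast
qed

section \<open>Realizing cuts and new cones\<close>

text \<open>Density and the absence of minimal points are existential statements about a chain in \<open>M\<close>
  that become true in an extension of the chain; the extension embeds into a model of \<open>DTR\<close>, and
  by completeness over the diagram of the chain the statement holds in \<open>M\<close> as well.\<close>

lemma chain_extends:
  assumes S: "S \<noteq> {}" "S \<subseteq> S'" and h: "embedding h (nat_chain S) M"
    and c: "set c \<subseteq> S" and \<phi>: "fv \<phi> \<subseteq> {..<length c}"
    and ex: "\<And>(N :: nat struct) g. embedding g (nat_chain S') N \<Longrightarrow> holds N \<phi> (map g c)"
  shows "holds M \<phi> (map h c)"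
proof -
  have "S' \<noteq> {}" using S by auto
  then have "models (nat_chain S') TR" "models (nat_chain S) TR"
    using S tr_nat_chain by (simp_all add: models_TR_iff)
  then obtain N :: "nat struct" and g where N: "models N DTR" "embedding g (nat_chain S') N"
    using model_completion_extends[OF completion] by (metis countableI_type)
  have g: "embedding g (nat_chain S) N"
    using N(2) S(2) unfolding embedding_def by (auto intro: inj_on_subset simp: subset_iff)
  have "holds M \<phi> (map h c) \<longleftrightarrow> holds N \<phi> (map g c)"
    using c by (intro model_completion_complete[OF completion \<open>models (nat_chain S) TR\<close> _ models_M h
       N(1) g _ \<phi>]) auto
  then show ?thesis using ex[OF N(2)] by simp
qed

lemma dense:
  assumes "u \<in> U" "v \<in> U" "u \<prec> v"
  obtains x where "x \<in> U" "u \<prec> x" "x \<prec> v"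
proof -
  let ?\<phi> = "Ex 2 (And (Lt (Var 0) (Var 2)) (Lt (Var 2) (Var 1)))"
  define h where "h n = (if n = 0 then u else v)" for n :: nat
  have vu: "\<not> v \<preceq> u" using assms antisym by blast
  have h: "embedding h (nat_chain {0, 2}) M"
    using assms vu meet_eq1[of u v] meet_eq1[of u u] meet_eq1[of v v] meet_comm[of u v] refl[of u] refl[of v]
      not_rel_same[of u v] rel_below[of u] rel_below[of v]
    by (auto simp: embedding_def h_def inj_on_def)
  have "holds M ?\<phi> (map h [0, 2])"
  proof (rule chain_extends[OF _ _ h, of "{0, 1, 2}"])
    fix N :: "nat struct" and g assume g: "embedding g (nat_chain {0, 1, 2}) N"
    have "le N (g 0) (g 1)" "le N (g 1) (g 2)" "g 0 \<noteq> g 1" "g 1 \<noteq> g 2" "g 1 \<in> univ N"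
      using g by (auto simp: embedding_def inj_on_def)
    then show "holds N ?\<phi> (map g [0, 2])" by auto
  qed auto
  then show ?thesis using that by (auto simp: h_def)
qed

lemma no_minimum:
  assumes "v \<in> U"
  obtains x where "x \<in> U" "x \<prec> v"
proof -
  let ?\<phi> = "Ex 1 (Lt (Var 1) (Var 0))"
  define h where "h n = v" for n :: nat
  have h: "embedding h (nat_chain {1}) M"
    using assms meet_eq1[of v v] refl[of v] not_rel_same[of v v]
    by (auto simp: embedding_def h_def inj_on_def)
  have "holds M ?\<phi> (map h [1])"
  proof (rule chain_extends[OF _ _ h, of "{0, 1}"])
    fix N :: "nat struct" and g assume g: "embedding g (nat_chain {0, 1}) N"
    have "le N (g 0) (g 1)" "g 0 \<noteq> g 1" "g 0 \<in> univ N" using g by (auto simp: embedding_def inj_on_def)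
    then show "holds N ?\<phi> (map g [1])" by auto
  qed auto
  then show ?thesis using that by (auto simp: h_def)
qed

end

context dtr_monster begin

lemma finite_chain_max:
  assumes "finite L" "L \<noteq> {}" "L \<subseteq> U" "v \<in> U" "\<And>u. u \<in> L \<Longrightarrow> u \<preceq> v"
  shows "\<exists>m\<in>L. \<forall>u\<in>L. u \<preceq> m"
  using assms(1-3,5)
proof (induction L rule: finite_ne_induct)
  case (singleton x) then show ?case using refl by auto
next
  case (insert x L)
  then obtain m where m: "m \<in> L" "\<forall>u\<in>L. u \<preceq> m" by auto
  have in_U: "m \<in> U" "x \<in> U" using m insert.prems by auto
  show ?case
  proof (cases "m \<preceq> x")
    case True
    then have "u \<preceq> x" if "u \<in> L" for u using that m(2) insert.prems(1) in_U trans[of u m x] by auto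
    then show ?thesis using refl in_U by auto
  next
    case False
    then have "x \<preceq> m" using chain[of v m x] insert.prems in_U m(1) assms(4) by auto
    then show ?thesis using m by auto
  qed
qed

text \<open>A point of \<open>Z\<close> that lies in the interval is avoided by looking below it.\<close>

lemma dense_avoiding:
  assumes "finite Z" "finite L" "L \<subseteq> U" "v \<in> U" "\<And>u. u \<in> L \<Longrightarrow> u \<prec> v"
  shows "\<exists>x\<in>U. x \<prec> v \<and> x \<notin> Z \<and> (\<forall>u\<in>L. u \<prec> x)"
  using assms(1,4,5)
proof (induction Z arbitrary: v)
  case empty
  show ?case
  proof (cases "L = {}")
    case True then show ?thesis using no_minimum[OF empty(1)] by auto
  next
    case False
    then obtain m where m: "m \<in> L" "\<forall>u\<in>L. u \<preceq> m"
      using finite_chain_max[of L v] assms(2,3) empty by auto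
    have "m \<in> U" "m \<prec> v" using m(1) empty assms(3) by auto
    then obtain x where x: "x \<in> U" "m \<prec> x" "x \<prec> v" using dense[of m v] empty(1) by blast
    have "u \<prec> x" if "u \<in> L" for u using le_lt_trans[of u m x] that m x assms(3) by auto
    then show ?thesis using x by auto
  qed
next
  case (insert z Z)
  show ?case
  proof (cases "z \<in> U \<and> z \<prec> v \<and> (\<forall>u\<in>L. u \<prec> z)")
    case True
    then obtain x where x: "x \<in> U" "x \<prec> z" "x \<notin> Z" "\<forall>u\<in>L. u \<prec> x" using insert.IH[of z] by auto
    moreover have "x \<prec> v" using x True insert.prems lt_le_trans[of x z v] by auto
    ultimately show ?thesis by auto
  next
    case False then show ?thesis using insert.IH[of v] insert.prems by auto
  qed
qed

lemma finite_cone_meet: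
  assumes "finite V" "V \<noteq> {}" "V \<subseteq> U" "L \<subseteq> U"
    "\<And>u v v'. u \<in> L \<Longrightarrow> v \<in> V \<Longrightarrow> v' \<in> V \<Longrightarrow> u \<prec> v \<sqinter> v'"
  shows "\<exists>m\<in>U. (\<forall>v\<in>V. m \<preceq> v) \<and> (\<forall>u\<in>L. u \<prec> m)"
  using assms(1-3,5)
proof (induction V rule: finite_ne_induct)
  case (singleton v)
  then show ?case using refl[of v] meet_eq1[of v v] by auto
next
  case (insert v V)
  have "\<exists>m\<in>U. (\<forall>v\<in>V. m \<preceq> v) \<and> (\<forall>u\<in>L. u \<prec> m)"
    using insert.prems by (intro insert.IH) auto
  then obtain m where m: "m \<in> U" "\<forall>v\<in>V. m \<preceq> v" "\<forall>u\<in>L. u \<prec> m" by blast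
  obtain w where w: "w \<in> V" "w \<in> U" using insert.hyps insert.prems(1) by blast
  have v: "v \<in> U" using insert.prems by auto
  have le: "m \<sqinter> v \<preceq> x" if "x \<in> insert v V" for x
    using that m v insert.prems(1) meet_le1[of m v] meet_le2[of m v] trans[of "m \<sqinter> v" m x] by auto
  have "u \<prec> m \<sqinter> v" if "u \<in> L" for u
  proof (rule cone_trans)
    show "u \<in> U" "m \<in> U" "w \<in> U" "v \<in> U" using that assms(4) m w v by auto
    show "u \<prec> w \<sqinter> v" using that w insert.prems(2)[of u w v] by auto
    show "u \<prec> m \<sqinter> w" using that w m assms(4) cone_mono[of u m w] by auto
  qed
  then show ?case using le m v by (intro bexI[of _ "m \<sqinter> v"]) auto
qed

text \<open>The hypothesis says that \<open>V\<close> lies in a single open cone above each point of \<open>L\<close>. This is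
  what makes finite meets of \<open>V\<close> stay strictly above \<open>L\<close>; it does not suffice that each point
  of \<open>V\<close> is above \<open>L\<close>, as \<open>V\<close> could branch at a point of \<open>L\<close>. Finitely many of the
  conditions on \<open>x\<close> are then met by density, and all of them by saturation. The set \<open>Z\<close> will be
  a generated substructure, so that \<open>x\<close> fills a cut in it.\<close>

lemma realize_cut:
  assumes count: "countable L" "countable V" "countable Z"
    and sub: "L \<subseteq> U" "V \<subseteq> U" "Z \<subseteq> U" "V \<noteq> {}"
    and cone: "\<And>u v v'. u \<in> L \<Longrightarrow> v \<in> V \<Longrightarrow> v' \<in> V \<Longrightarrow> u \<prec> v \<sqinter> v'"
  obtains x where "x \<in> U" "\<And>u. u \<in> L \<Longrightarrow> u \<prec> x" "\<And>v. v \<in> V \<Longrightarrow> x \<preceq> v" "x \<notin> Z"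
proof -
  define fL where "fL u = (Lt (Var 1) (Var 0), [u])" for u :: 'a
  define fV where "fV v = (Le (Var 0) (Var 1), [v])" for v :: 'a
  define fZ where "fZ z = (Neg (Eq (Var 0) (Var 1)), [z])" for z :: 'a
  have inj: "inj fL" "inj fV" "inj fZ" by (simp_all add: inj_def fL_def fV_def fZ_def)
  define \<Sigma> where "\<Sigma> = fL ` L \<union> fV ` V \<union> fZ ` Z"
  obtain v0 where v0: "v0 \<in> V" using sub by auto
  have pt: "partial_type M (L \<union> V \<union> Z) 1 \<Sigma>"
    unfolding partial_type_def
  proof (intro conjI allI impI)
    show "\<forall>p\<in>\<Sigma>. formula_over (L \<union> V \<union> Z) 1 p"
      by (auto simp: \<Sigma>_def fL_def fV_def fZ_def formula_over_def)
    fix \<Sigma>0 assume 0: "finite \<Sigma>0 \<and> \<Sigma>0 \<subseteq> \<Sigma>"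
    let ?L = "{u\<in>L. fL u \<in> \<Sigma>0}" let ?V = "insert v0 {v\<in>V. fV v \<in> \<Sigma>0}" let ?Z = "{z\<in>Z. fZ z \<in> \<Sigma>0}"
    have fin: "finite ?L" "finite ?V" "finite ?Z"
      using 0 inj[THEN finite_vimageI[of \<Sigma>0, rotated]] by (auto intro: finite_subset simp: vimage_def)
    have "?V \<subseteq> U" "?L \<subseteq> U" using v0 sub by auto
    have "\<exists>m\<in>U. (\<forall>v\<in>?V. m \<preceq> v) \<and> (\<forall>u\<in>?L. u \<prec> m)"
    proof (rule finite_cone_meet[OF fin(2) _ \<open>?V \<subseteq> U\<close> \<open>?L \<subseteq> U\<close>])
      show "u \<prec> v \<sqinter> v'" if "u \<in> ?L" "v \<in> ?V" "v' \<in> ?V" for u v v'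
        using that v0 by (intro cone) auto
    qed simp
    then obtain m where m: "m \<in> U" "\<forall>v\<in>?V. m \<preceq> v" "\<forall>u\<in>?L. u \<prec> m" by blast
    then obtain x where x: "x \<in> U" "x \<prec> m" "x \<notin> ?Z" "\<forall>u\<in>?L. u \<prec> x"
      using dense_avoiding[OF fin(3,1) \<open>?L \<subseteq> U\<close> m(1)] by blast
    have xV: "x \<preceq> v" if "v \<in> ?V" for v using trans[of x m v] that x m \<open>?V \<subseteq> U\<close> by blast
    have split: "p \<in> fL ` ?L \<union> fV ` ?V \<union> fZ ` ?Z" if "p \<in> \<Sigma>0" for p
      using that 0 unfolding \<Sigma>_def by blast
    have "holds M \<phi> ([x] @ c)" if "(\<phi>, c) \<in> \<Sigma>0" for \<phi> c
    proof -
      have "(\<phi>, c) \<in> fL ` ?L \<union> fV ` ?V \<union> fZ ` ?Z" using split[OF that] .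
      then show ?thesis using x(3,4) xV by (auto simp: fL_def fV_def fZ_def)
    qed
    then show "\<exists>b. length b = 1 \<and> realizes M b \<Sigma>0" using x(1) by (intro exI[of _ "[x]"]) (auto simp: realizes_def)
  qed
  have "countable (L \<union> V \<union> Z)" "L \<union> V \<union> Z \<subseteq> U" using count sub by auto
  then obtain x where x: "x \<in> U" "\<And>\<phi> c. (\<phi>, c) \<in> \<Sigma> \<Longrightarrow> holds M \<phi> (x # c)"
    using saturation[OF _ pt] by blast
  have 1: "u \<prec> x" if "u \<in> L" for u
    using x(2)[of "Lt (Var 1) (Var 0)" "[u]"] that by (auto simp: \<Sigma>_def fL_def)
  have 2: "x \<preceq> v" if "v \<in> V" for v
    using x(2)[of "Le (Var 0) (Var 1)" "[v]"] that by (auto simp: \<Sigma>_def fV_def)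
  have 3: "x \<noteq> z" if "z \<in> Z" for z
    using x(2)[of "Neg (Eq (Var 0) (Var 1))" "[z]"] that by (auto simp: \<Sigma>_def fZ_def)
  show ?thesis using that[OF x(1) 1 2] 3 by blast
qed

text \<open>The substructure generated by \<open>e\<close> and \<open>ys\<close> is extended by \<open>add_cone\<close>. The extension
  embeds into a model of \<open>DTR\<close>, so the existential formula \<open>\<phi>\<close> holds there and by completeness
  in \<open>M\<close>.\<close>

lemma realize_cone_finite:
  assumes e: "e \<in> U" and ys: "set ys \<subseteq> U" "\<And>y. y \<in> set ys \<Longrightarrow> e \<prec> y"
    and P: "\<And>y y'. y \<in> set ys \<Longrightarrow> y' \<in> set ys \<Longrightarrow> e \<prec> y \<sqinter> y' \<Longrightarrow> P y \<Longrightarrow> P y'"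
  shows "\<exists>x\<in>U. e \<prec> x \<and> (\<forall>y\<in>set ys. \<not> e \<prec> x \<sqinter> y \<and> (rel M e x y \<longleftrightarrow> P y))"
proof -
  define C where "C = meet_closure M (insert e (set ys))"
  define G where "G = {c\<in>C. \<exists>y\<in>set ys. P y \<and> e \<prec> y \<sqinter> c}"
  have C: "closed C" using e ys(1) by (auto simp: C_def intro: closed_cl)
  have CU: "c \<in> U" if "c \<in> C" for c using that C by (auto simp: closed_def)
  have eC: "e \<in> C" and ysC: "y \<in> set ys \<Longrightarrow> y \<in> C" for y by (auto simp: C_def intro: meet_closure.gen)
  let ?D = "add_cone C e G"
  have "tr ?D"
  proof (rule tr_add_cone[OF C eC])
    show "G \<subseteq> C" by (auto simp: G_def)
    show "e \<prec> a" if a: "a \<in> G" for a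
    proof -
      obtain y where y: "y \<in> set ys" "e \<prec> y \<sqinter> a" "a \<in> C" using a by (auto simp: G_def)
      then show ?thesis using lt_le_trans[of e "y \<sqinter> a" a] meet_le2[of y a] e ys(1) CU by auto
    qed
    show "b \<in> G" if ab: "a \<in> G" "b \<in> C" "e \<prec> a \<sqinter> b" for a b
    proof -
      obtain y where y: "y \<in> set ys" "P y" "e \<prec> y \<sqinter> a" "a \<in> C" using ab(1) by (auto simp: G_def)
      then have "e \<prec> y \<sqinter> b" using cone_trans[of e y a b] ab e ys(1) CU by auto
      then show ?thesis using y ab by (auto simp: G_def)
    qed
  qed
  moreover have "countable (univ ?D)" by (simp add: C_def countable_cl countable_finite)
  ultimately obtain N :: "nat struct" and g where N: "models N DTR" "embedding g ?D N"
    using model_completion_extends[OF completion] by (metis models_TR_iff)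
  let ?R = "restr M C" let ?c = "e # ys" let ?n = "length ?c"
  have R: "models ?R TR" "countable (univ ?R)" using tr_restr[OF C] eC
    by (auto simp: models_TR_iff C_def countable_cl countable_finite)
  have g: "embedding (g \<circ> Some) ?R N"
    by (rule embedding_comp[OF _ N(2)]) (auto simp: embedding_def)
  have id: "embedding (\<lambda>x. x) ?R M" using partial_iso_id[OF C] by (simp add: partial_iso_def)
  define \<psi> where "\<psi> i = And (Neg (Lt (Var 0) (Meet (Var ?n) (Var i))))
    (if P (?c ! i) then Rel (Var 0) (Var ?n) (Var i) else Neg (Rel (Var 0) (Var ?n) (Var i)))" for i
  define \<phi> where "\<phi> = Ex ?n (And (Lt (Var 0) (Var ?n)) (big_And (map \<psi> [1..<?n])))"
  have "fv (\<psi> i) = {0, ?n, i}" for i by (auto simp: \<psi>_def)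
  then have fv: "fv \<phi> \<subseteq> {..<?n}" by (auto simp: \<phi>_def fv_big_And)
  have yG: "y \<in> G \<longleftrightarrow> P y" if "y \<in> set ys" for y
  proof
    assume "y \<in> G" then show "P y" using P that by (auto simp: G_def)
  next
    have yU: "y \<in> U" using that ys(1) by blast
    assume "P y"
    then have "P y \<and> e \<prec> y \<sqinter> y" using ys(2)[OF that] meet_eq1[OF yU yU refl[OF yU]] by simp
    then show "y \<in> G" using that ysC[OF that] by (auto simp: G_def)
  qed
  have "holds N \<phi> (map (g \<circ> Some) ?c)"
  proof -
    let ?s = "((!) (map (g \<circ> Some) ?c))(?n := g None)"
    have gN: "g None \<in> univ N" using N(2) by (auto simp: embedding_def)
    have Lt: "le N (g (Some e)) (g None)" "g (Some e) \<noteq> g None"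
      using N(2) eC refl[OF e] by (auto simp: embedding_def inj_on_def)
    have "sat N ?s (\<psi> i)" if i: "i \<in> {1..<?n}" for i
    proof -
      obtain j where j: "i = Suc j" "j < length ys" using i by (cases i) auto
      then have y: "?c ! i \<in> set ys" by auto
      have si: "?s i = g (Some (?c ! i))" "?s 0 = g (Some e)" "?s ?n = g None"
        using j by simp_all
      have "e \<sqinter> (?c ! i) = e" using y ys e by (intro meet_eq1) auto
      moreover have "g (Some (e \<sqinter> (?c ! i))) = meet N (g None) (g (Some (?c ! i)))"
        using N(2) ysC[OF y] by (auto simp: embedding_def)
      ultimately have m: "meet N (g None) (g (Some (?c ! i))) = g (Some e)" by simp
      have r: "rel N (g (Some e)) (g None) (g (Some (?c ! i))) \<longleftrightarrow> P (?c ! i)"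
        using N(2) y ysC eC yG[OF y] by (auto simp: embedding_def)
      show ?thesis unfolding \<psi>_def by (simp only: sat.simps tval.simps si m r if_split) (simp add: si m r)
    qed
    then have 1: "sat N ?s (big_And (map \<psi> [1..<?n]))" unfolding sat_big_And by auto
    have 2: "sat N ?s (Lt (Var 0) (Var ?n))" using Lt by simp
    show ?thesis unfolding \<phi>_def sat.simps(6)
    proof
      show "sat N ?s (And (Lt (Var 0) (Var ?n)) (big_And (map \<psi> [1..<?n])))"
        using 1 2 unfolding sat.simps(5)[of _ _ "Lt _ _"] by blast
    qed (rule gN)
  qed
  then have "holds M \<phi> ?c"
    using model_completion_complete[OF completion R models_M id N(1) g _ fv] eC ysC by (auto simp: subset_iff)
  then obtain x where x: "x \<in> U" "sat M (((!) ?c)(?n := x)) (And (Lt (Var 0) (Var ?n)) (big_And (map \<psi> [1..<?n])))"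
    unfolding \<phi>_def by auto
  have "\<not> e \<prec> x \<sqinter> y \<and> (rel M e x y \<longleftrightarrow> P y)" if y: "y \<in> set ys" for y
  proof -
    obtain j where j: "j < length ys" "y = ys ! j" using y by (auto simp: in_set_conv_nth)
    then have "Suc j \<in> set [1..<?n]" by (simp del: upt_Suc)
    then have "\<psi> (Suc j) \<in> set (map \<psi> [1..<?n])" unfolding set_map by (rule imageI)
    then have "sat M (((!) ?c)(?n := x)) (\<psi> (Suc j))"
      using x(2) unfolding sat.simps(5)[of _ _ _ "big_And _"] sat_big_And by blast
    then show ?thesis using j by (simp add: \<psi>_def split: if_splits)
  qed
  then show ?thesis using x by auto
qed

text \<open>The graph on the cones above \<open>e\<close> is random: the only condition on the edges prescribed by
  \<open>P\<close> is that they respect the cones.\<close>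

lemma realize_cone:
  assumes e: "e \<in> U" and Y: "countable Y" "Y \<subseteq> U" "\<And>y. y \<in> Y \<Longrightarrow> e \<prec> y"
    and P: "\<And>y y'. y \<in> Y \<Longrightarrow> y' \<in> Y \<Longrightarrow> e \<prec> y \<sqinter> y' \<Longrightarrow> P y \<Longrightarrow> P y'"
  obtains x where "x \<in> U" "e \<prec> x" "\<And>y. y \<in> Y \<Longrightarrow> \<not> e \<prec> x \<sqinter> y"
    "\<And>y. y \<in> Y \<Longrightarrow> rel M e x y \<longleftrightarrow> P y"
proof -
  define \<psi> where "\<psi> y = And (Neg (Lt (Var 1) (Meet (Var 0) (Var 2))))
    (if P y then Rel (Var 1) (Var 0) (Var 2) else Neg (Rel (Var 1) (Var 0) (Var 2)))" for y
  define f where "f y = (\<psi> y, [e, y])" for y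
  define \<Sigma> where "\<Sigma> = insert (Lt (Var 1) (Var 0), [e]) (f ` Y)"
  have pt: "partial_type M (insert e Y) 1 \<Sigma>"
    unfolding partial_type_def
  proof (intro conjI allI impI)
    show "\<forall>p\<in>\<Sigma>. formula_over (insert e Y) 1 p"
      by (auto simp: \<Sigma>_def f_def \<psi>_def formula_over_def)
    fix \<Sigma>0 assume 0: "finite \<Sigma>0 \<and> \<Sigma>0 \<subseteq> \<Sigma>"
    then have "finite (\<Sigma>0 - {(Lt (Var 1) (Var 0), [e])})" "\<Sigma>0 - {(Lt (Var 1) (Var 0), [e])} \<subseteq> f ` Y"
      by (auto simp: \<Sigma>_def)
    then obtain F where F: "F \<subseteq> Y" "finite F" "\<Sigma>0 - {(Lt (Var 1) (Var 0), [e])} = f ` F"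
      by (meson finite_subset_image)
    obtain ys where ys: "set ys = F" using finite_list[OF F(2)] by auto
    have "\<exists>x\<in>U. e \<prec> x \<and> (\<forall>y\<in>set ys. \<not> e \<prec> x \<sqinter> y \<and> (rel M e x y \<longleftrightarrow> P y))"
    proof (rule realize_cone_finite[OF e])
      show "set ys \<subseteq> U" using ys F(1) Y(2) by blast
      show "e \<prec> y" if "y \<in> set ys" for y using ys F(1) Y(3) that by blast
      show "P y'" if "y \<in> set ys" "y' \<in> set ys" "e \<prec> y \<sqinter> y'" "P y" for y y'
        using ys F(1) P[of y y'] that by blast
    qed
    then obtain x where x: "x \<in> U" "e \<prec> x" "\<forall>y\<in>F. \<not> e \<prec> x \<sqinter> y \<and> (rel M e x y \<longleftrightarrow> P y)"
      unfolding ys by blast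
    have "holds M \<phi> ([x] @ c)" if "(\<phi>, c) \<in> \<Sigma>0" for \<phi> c
    proof -
      have "(\<phi>, c) = (Lt (Var 1) (Var 0), [e]) \<or> (\<phi>, c) \<in> f ` F" using that F(3) by blast
      then show ?thesis using x by (auto simp: f_def \<psi>_def)
    qed
    then show "\<exists>b. length b = 1 \<and> realizes M b \<Sigma>0" using x(1) by (intro exI[of _ "[x]"]) (auto simp: realizes_def)
  qed
  have "countable (insert e Y)" "insert e Y \<subseteq> U" using e Y by auto
  then obtain x where x: "x \<in> U" "\<And>\<phi> c. (\<phi>, c) \<in> \<Sigma> \<Longrightarrow> holds M \<phi> (x # c)"
    using saturation[OF _ pt] by blast
  have 1: "e \<prec> x" using x(2)[of "Lt (Var 1) (Var 0)" "[e]"] by (auto simp: \<Sigma>_def)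
  have 2: "\<not> e \<prec> x \<sqinter> y \<and> (rel M e x y \<longleftrightarrow> P y)" if "y \<in> Y" for y
    using x(2)[of "\<psi> y" "[e, y]"] that by (auto simp: \<Sigma>_def f_def \<psi>_def split: if_splits)
  show ?thesis using that[OF x(1) 1] 2 by blast
qed

end

section \<open>One-point extensions of partial isomorphisms\<close>

context tr begin

text \<open>A generated element lies below a generator, so a point in a new cone with respect to the
  generators is in a new cone with respect to all of the generated substructure.\<close>

lemma new_cone_cl:
  assumes X: "X \<subseteq> U" and x: "x \<in> U" "e \<in> U" and new: "\<And>g. g \<in> X \<Longrightarrow> \<not> e \<prec> x \<sqinter> g"
    and c: "c \<in> meet_closure M X"
  shows "\<not> e \<prec> x \<sqinter> c"
proof
  obtain g where g: "g \<in> X" "c \<preceq> g" using cl_below_generator[OF X c] by blast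
  have U: "c \<in> U" "g \<in> U" using cl_in_U[OF X c] g X by auto
  assume "e \<prec> x \<sqinter> c"
  moreover have "x \<sqinter> c \<preceq> x \<sqinter> g"
    using U x g meet_le1[of x c] meet_le2[of x c] trans[of "x \<sqinter> c" c g] by (auto simp: le_meet_iff)
  ultimately have "e \<prec> x \<sqinter> g" using lt_le_trans[of e "x \<sqinter> c" "x \<sqinter> g"] U x by auto
  then show False using new g by blast
qed

text \<open>A point \<open>x\<close> in a new cone above \<open>e\<close> has the same meets with \<open>C\<close> as \<open>e\<close>, and it lies in
  the cone of \<open>e\<close> above each point below \<open>e\<close>; only its edges at \<open>e\<close> are new information.\<close>

lemma new_cone_facts:
  assumes C: "C \<subseteq> U" "e \<in> C" and x: "x \<in> U" "e \<prec> x" and new: "\<forall>c\<in>C. \<not> e \<prec> x \<sqinter> c"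
  shows new_cone_meet: "c \<in> C \<Longrightarrow> x \<sqinter> c = e \<sqinter> c"
    and new_cone_le: "c \<in> C \<Longrightarrow> c \<preceq> x \<longleftrightarrow> c \<preceq> e"
    and new_cone_not_le: "c \<in> C \<Longrightarrow> \<not> x \<preceq> c"
    and new_cone_not_rel: "a \<in> insert x C \<Longrightarrow> d \<in> insert x C \<Longrightarrow> \<not> rel M x a d"
    and new_cone_rel: "c \<in> C \<Longrightarrow> d \<in> C \<Longrightarrow>
      rel M c x d \<longleftrightarrow> c = e \<and> e \<prec> d \<and> rel M e x d \<or> c \<prec> e \<and> rel M c e d"
proof -
  have e: "e \<in> U" using C by blast
  have le: "x \<sqinter> c \<preceq> e" if "c \<in> C" for c
    using chain[of x e "x \<sqinter> c"] bspec[OF new that] meet_le1[of x c] x e C that refl[OF e] by auto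
  show meet: "x \<sqinter> c = e \<sqinter> c" if "c \<in> C" for c
  proof (rule antisym)
    have c: "c \<in> U" using that C by blast
    show "x \<sqinter> c \<preceq> e \<sqinter> c" using le[OF that] meet_le2[of x c] c x e by (auto simp: le_meet_iff)
    show "e \<sqinter> c \<preceq> x \<sqinter> c"
      using meet_le1[of e c] meet_le2[of e c] trans[of "e \<sqinter> c" e x] c x e by (auto simp: le_meet_iff)
    show "x \<sqinter> c \<in> U" "e \<sqinter> c \<in> U" using c x e by auto
  qed
  show cle: "c \<preceq> x \<longleftrightarrow> c \<preceq> e" if "c \<in> C" for c
  proof
    have c: "c \<in> U" using that C by blast
    show "c \<preceq> x" if "c \<preceq> e" using trans[of c e x] that c x e by auto
    assume "c \<preceq> x"
    then have "x \<sqinter> c = c" using meet_eq1[of c x] meet_comm[of c x] c x by auto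
    then show "c \<preceq> e" using le[OF \<open>c \<in> C\<close>] by simp
  qed
  show not_le: "\<not> x \<preceq> c" if "c \<in> C" for c
  proof
    assume "x \<preceq> c"
    then have "x \<preceq> e" using meet_eq1[of x c] le[OF that] that C x by auto
    then show False using antisym[of x e] x e by auto
  qed
  show "\<not> rel M x a d" if "a \<in> insert x C" "d \<in> insert x C" for a d
    using rel_below[of x a d] not_le that C x by blast
  show "rel M c x d \<longleftrightarrow> c = e \<and> e \<prec> d \<and> rel M e x d \<or> c \<prec> e \<and> rel M c e d"
    if "c \<in> C" "d \<in> C" for c d
  proof -
    have U: "c \<in> U" "d \<in> U" using that C by auto
    have 1: "c \<preceq> e \<and> c \<prec> d" if "rel M c x d"
      using that rel_below[of c x d] U x cle[OF \<open>c \<in> C\<close>] by auto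
    have 2: "rel M c x d \<longleftrightarrow> rel M c e d" if "c \<prec> e"
    proof (rule rel_cong_cone)
      show "c \<prec> x \<sqinter> e" using that meet_eq1[of e x] meet_comm[of e x] x e by auto
    qed (use U x e in auto)
    show ?thesis using 1 2 by blast
  qed
qed

text \<open>A point of a cut: below a point \<open>v\<close> of the closed set \<open>C\<close> but not in \<open>C\<close>. Two points of
  \<open>C\<close> above it lie in one cone, so it carries no edges, and seen from below it is
  indistinguishable from \<open>v\<close>.\<close>

lemma cut_facts:
  assumes C: "closed C" "v \<in> C" and x: "x \<in> U" "x \<preceq> v" "x \<notin> C"
  shows cut_meet: "c \<in> C \<Longrightarrow> x \<sqinter> c = (if x \<preceq> c then x else v \<sqinter> c)"
    and cut_le: "c \<in> C \<Longrightarrow> c \<preceq> x \<longleftrightarrow> c \<preceq> v \<and> \<not> x \<preceq> c"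
    and cut_not_rel: "a \<in> insert x C \<Longrightarrow> d \<in> insert x C \<Longrightarrow> \<not> rel M x a d"
    and cut_rel: "c \<in> C \<Longrightarrow> d \<in> C \<Longrightarrow> rel M c x d \<longleftrightarrow> c \<preceq> x \<and> rel M c v d"
proof -
  have CU: "c \<in> C \<Longrightarrow> c \<in> U" for c using C by (auto simp: closed_def)
  note v = CU[OF C(2)]
  show cle: "c \<preceq> x \<longleftrightarrow> c \<preceq> v \<and> \<not> x \<preceq> c" if c: "c \<in> C" for c
  proof
    show "c \<preceq> v \<and> \<not> x \<preceq> c" if "c \<preceq> x"
      using that trans[of c x v] antisym[of c x] c CU x v by blast
    show "c \<preceq> x" if "c \<preceq> v \<and> \<not> x \<preceq> c" using that chain[of v c x] c CU x v by blast
  qed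
  show "x \<sqinter> c = (if x \<preceq> c then x else v \<sqinter> c)" if c: "c \<in> C" for c
  proof (cases "x \<preceq> c")
    case True then show ?thesis using meet_eq1 x CU[OF c] by simp
  next
    case False
    note cU = CU[OF c]
    have "\<not> x \<preceq> v \<sqinter> c" using False v cU x by (simp add: le_meet_iff)
    moreover have "v \<sqinter> c \<in> C" using C c by (auto simp: closed_def)
    ultimately have "v \<sqinter> c \<preceq> x" using cle[of "v \<sqinter> c"] meet_le1[OF v cU] by blast
    then have "v \<sqinter> c \<preceq> x \<sqinter> c" using meet_le2[OF v cU] v cU x by (simp add: le_meet_iff)
    moreover have "x \<sqinter> c \<preceq> v \<sqinter> c"
      using v cU x meet_le1[of x c] meet_le2[of x c] trans[of "x \<sqinter> c" x v] by (auto simp: le_meet_iff)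
    ultimately show ?thesis using False antisym[of "x \<sqinter> c" "v \<sqinter> c"] v cU x by auto
  qed
  show "\<not> rel M x a d" if "a \<in> insert x C" "d \<in> insert x C" for a d
  proof
    assume r: "rel M x a d"
    have U: "a \<in> U" "d \<in> U" using that CU x by auto
    then have lt: "x \<prec> a" "x \<prec> d" using rel_below[OF x(1) _ _ r] by auto
    then have "a \<sqinter> d \<in> C" using that C by (auto simp: closed_def)
    then have "x \<prec> a \<sqinter> d" using lt U x by (auto simp: le_meet_iff)
    then show False using rel_irrefl[of x a d] r U x by auto
  qed
  show "rel M c x d \<longleftrightarrow> c \<preceq> x \<and> rel M c v d" if cd: "c \<in> C" "d \<in> C" for c d
  proof -
    have U: "c \<in> U" "d \<in> U" using cd CU by auto
    have "rel M c x d \<longleftrightarrow> rel M c v d" if "c \<preceq> x"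
    proof (rule rel_cong_cone)
      show "c \<prec> x \<sqinter> v" using that cd(1) x meet_eq1[of x v] v by auto
    qed (use U x v in auto)
    then show ?thesis using rel_below[of c x d] U x by blast
  qed
qed

end

context dtr_monster begin

lemma partial_iso_lt: "partial_iso C f \<Longrightarrow> x \<in> C \<Longrightarrow> y \<in> C \<Longrightarrow> f x \<prec> f y \<longleftrightarrow> x \<prec> y"
  using partial_iso_le[of C f x y] partial_iso_eq[of C f x y] by simp

lemma closed_image:
  assumes f: "partial_iso C f"
  shows "closed (f ` C)"
proof -
  have "f a \<sqinter> f b \<in> f ` C" if "a \<in> C" "b \<in> C" for a b
    using partial_iso_meet[OF f that] partial_iso_meet_in[OF f that] by (metis imageI)
  then show ?thesis using partial_iso_in[OF f] by (auto simp: closed_def)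
qed

lemma partial_iso_comp:
  assumes f: "partial_iso C f" and g: "partial_iso D g" and sub: "f ` C \<subseteq> D"
  shows "partial_iso C (g \<circ> f)"
proof -
  have fD: "f c \<in> D" if "c \<in> C" for c using that sub by auto
  have "(g \<circ> f) ` C \<subseteq> U" using fD partial_iso_in[OF g] by auto
  moreover have "inj_on (g \<circ> f) C"
    using fD partial_iso_eq[OF f] partial_iso_eq[OF g] by (simp add: inj_on_def)
  ultimately show ?thesis
    unfolding partial_iso_def embedding_def restr_simps using partial_iso_closed[OF f]
    by (simp add: fD partial_iso_meet[OF f] partial_iso_meet[OF g] partial_iso_le[OF f] partial_iso_le[OF g]
        partial_iso_rel[OF f] partial_iso_rel[OF g])
qed

text \<open>Both kinds of one-point extension below reduce to this: the new point carries no edges in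
  the graph at itself, and a point is never joined to its own cone, so the only edges to compare
  are those between the new point and a point of the domain.\<close>

lemma partial_iso_insertI:
  assumes f: "partial_iso C f" and x: "x \<in> U" "x \<notin> C" and y: "y \<in> U" "y \<notin> f ` C"
    and meet: "\<And>c. c \<in> C \<Longrightarrow> x \<sqinter> c = x \<and> y \<sqinter> f c = y \<or> x \<sqinter> c \<in> C \<and> y \<sqinter> f c = f (x \<sqinter> c)"
    and le: "\<And>c. c \<in> C \<Longrightarrow> x \<preceq> c \<longleftrightarrow> y \<preceq> f c" "\<And>c. c \<in> C \<Longrightarrow> c \<preceq> x \<longleftrightarrow> f c \<preceq> y"
    and rel1: "\<And>a d. a \<in> insert x C \<Longrightarrow> d \<in> insert x C \<Longrightarrow> \<not> rel M x a d"
      "\<And>a d. a \<in> insert y (f ` C) \<Longrightarrow> d \<in> insert y (f ` C) \<Longrightarrow> \<not> rel M y a d"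
    and rel2: "\<And>c d. c \<in> C \<Longrightarrow> d \<in> C \<Longrightarrow> rel M c x d \<longleftrightarrow> rel M (f c) y (f d)"
  shows "partial_iso (insert x C) (f(x := y))" (is "partial_iso ?D ?g")
proof -
  have CU: "c \<in> C \<Longrightarrow> c \<in> U" for c using partial_iso_subset[OF f] .
  have fU: "c \<in> C \<Longrightarrow> f c \<in> U" for c using partial_iso_in[OF f] .
  have g: "?g x = y" "\<And>c. c \<in> C \<Longrightarrow> ?g c = f c" using x by auto
  have mx: "x \<sqinter> x = x" "y \<sqinter> y = y" using x y refl meet_eq1 by auto
  have in_D: "x \<sqinter> c \<in> ?D" if "c \<in> C" for c using meet[OF that] by auto
  have mg: "?g (x \<sqinter> c) = y \<sqinter> f c" if "c \<in> C" for c
    using meet[OF that]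
  proof
    assume "x \<sqinter> c = x \<and> y \<sqinter> f c = y" then show ?thesis by simp
  next
    assume "x \<sqinter> c \<in> C \<and> y \<sqinter> f c = f (x \<sqinter> c)" then show ?thesis using g(2) by metis
  qed
  have "closed ?D"
    unfolding closed_def
  proof (intro conjI ballI)
    show "?D \<subseteq> U" using CU x by auto
    show "a \<sqinter> b \<in> ?D" if "a \<in> ?D" "b \<in> ?D" for a b
      using that in_D[of a] in_D[of b] partial_iso_meet_in[OF f, of a b] mx meet_comm[of a x] CU[of a] x(1)
      by (cases "a = x"; cases "b = x") auto
  qed
  moreover have "embedding ?g (restr M ?D) M"
    unfolding embedding_def restr_simps
  proof (intro conjI ballI)
    show "?g ` ?D \<subseteq> U" using g fU y by auto
    show "inj_on ?g ?D"
    proof (rule inj_onI)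
      fix a b assume "a \<in> ?D" "b \<in> ?D" "?g a = ?g b"
      then show "a = b" using g y(2) partial_iso_eq[OF f, of a b] by (cases "a = x"; cases "b = x") auto
    qed
    show "?g (a \<sqinter> b) = ?g a \<sqinter> ?g b" if "a \<in> ?D" "b \<in> ?D" for a b
    proof (cases "a = x")
      case True
      then show ?thesis using that mg[of b] mx g x by (cases "b = x") auto
    next
      case False
      then have a: "a \<in> C" using that by auto
      show ?thesis
      proof (cases "b = x")
        case True
        then show ?thesis using mg[OF a] meet_comm[of a x] meet_comm[of "f a" y] CU[OF a] fU[OF a] x y g a by auto
      next
        case False
        then have b: "b \<in> C" using that by auto
        show ?thesis using g(2)[OF a] g(2)[OF b] g(2)[OF partial_iso_meet_in[OF f a b]] partial_iso_meet[OF f a b] by simp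
      qed
    qed
    show "a \<preceq> b \<longleftrightarrow> ?g a \<preceq> ?g b" if "a \<in> ?D" "b \<in> ?D" for a b
      using that le partial_iso_le[OF f, of a b] g refl x y by (cases "a = x"; cases "b = x") auto
    show "rel M a b c \<longleftrightarrow> rel M (?g a) (?g b) (?g c)" if abc: "a \<in> ?D" "b \<in> ?D" "c \<in> ?D" for a b c
    proof (cases "a = x")
      case True
      have "?g b \<in> insert y (f ` C)" "?g c \<in> insert y (f ` C)" using abc by auto
      then show ?thesis using rel1(1)[OF abc(2,3)] rel1(2)[of "?g b" "?g c"] True by simp
    next
      case False
      then have a: "a \<in> C" using abc by auto
      note aU = CU[OF a] fU[OF a]
      show ?thesis
      proof (cases "b = x")
        case bx: True
        show ?thesis
        proof (cases "c = x")
          case True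
          then show ?thesis using bx g a not_rel_same aU x y by simp
        next
          case False
          then have "c \<in> C" using abc by auto
          then show ?thesis using bx g a rel2[OF a] by simp
        qed
      next
        case False
        then have b: "b \<in> C" using abc by auto
        show ?thesis
        proof (cases "c = x")
          case True
          then show ?thesis using rel2[OF a b] rel_comm[OF aU(1) CU[OF b] x(1)] rel_comm[OF aU(2) fU[OF b] y(1)] g a b
            by simp
        next
          case False
          then have c: "c \<in> C" using abc by auto
          show ?thesis using g(2)[OF a] g(2)[OF b] g(2)[OF c] partial_iso_rel[OF f a b c] by simp
        qed
      qed
    qed
  qed
  ultimately show ?thesis by (simp add: partial_iso_def)
qed

lemma partial_iso_insert_cone:
  assumes f: "partial_iso C f" and e: "e \<in> C" and x: "x \<in> U" "e \<prec> x" and y: "y \<in> U" "f e \<prec> y"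
    and new_x: "\<And>c. c \<in> C \<Longrightarrow> \<not> e \<prec> x \<sqinter> c" and new_y: "\<And>c. c \<in> C \<Longrightarrow> \<not> f e \<prec> y \<sqinter> f c"
    and rel: "\<And>c. c \<in> C \<Longrightarrow> e \<prec> c \<Longrightarrow> rel M e x c \<longleftrightarrow> rel M (f e) y (f c)"
  shows "x \<notin> C" "partial_iso (insert x C) (f(x := y))"
proof -
  have CU: "C \<subseteq> U" "f ` C \<subseteq> U" "f e \<in> f ` C" using partial_iso_subset[OF f] partial_iso_in[OF f] e by auto
  have new_x': "\<forall>c\<in>C. \<not> e \<prec> x \<sqinter> c" and new_y': "\<forall>d\<in>f ` C. \<not> f e \<prec> y \<sqinter> d"
    using new_x new_y by blast+
  note X = new_cone_facts[OF CU(1) e x new_x']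
  note Y = new_cone_facts[OF CU(2,3) y new_y']
  show xC: "x \<notin> C" using X(3) refl[OF x(1)] by blast
  show "partial_iso (insert x C) (f(x := y))"
  proof (rule partial_iso_insertI[OF f x(1) xC y(1)])
    show "y \<notin> f ` C" using Y(3) refl[OF y(1)] by blast
    show "x \<sqinter> c = x \<and> y \<sqinter> f c = y \<or> x \<sqinter> c \<in> C \<and> y \<sqinter> f c = f (x \<sqinter> c)" if c: "c \<in> C" for c
      using X(1)[OF c] Y(1)[OF imageI[OF c]] partial_iso_meet[OF f e c] partial_iso_meet_in[OF f e c] by simp
    show "x \<preceq> c \<longleftrightarrow> y \<preceq> f c" "c \<preceq> x \<longleftrightarrow> f c \<preceq> y" if c: "c \<in> C" for c
      using X(2,3)[OF c] Y(2,3)[OF imageI[OF c]] partial_iso_le[OF f c e] by simp_all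
    show "\<not> rel M x a d" if "a \<in> insert x C" "d \<in> insert x C" for a d using X(4)[OF that] .
    show "\<not> rel M y a d" if "a \<in> insert y (f ` C)" "d \<in> insert y (f ` C)" for a d using Y(4)[OF that] .
    show "rel M c x d \<longleftrightarrow> rel M (f c) y (f d)" if c: "c \<in> C" and d: "d \<in> C" for c d
      using X(5)[OF c d] Y(5)[OF imageI[OF c] imageI[OF d]] partial_iso_le[OF f c e] partial_iso_eq[OF f c e]
        partial_iso_le[OF f e d] partial_iso_eq[OF f e d] partial_iso_rel[OF f c e d] rel[OF d] by auto
  qed
qed

lemma partial_iso_insert_cut:
  assumes f: "partial_iso C f" and v: "v \<in> C" and x: "x \<in> U" "x \<preceq> v" "x \<notin> C"
    and y: "y \<in> U" "y \<preceq> f v" "y \<notin> f ` C" and cut: "\<And>c. c \<in> C \<Longrightarrow> x \<preceq> c \<longleftrightarrow> y \<preceq> f c"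
  shows "partial_iso (insert x C) (f(x := y))"
proof -
  note X = cut_facts[OF partial_iso_closed[OF f] v x]
  note Y = cut_facts[OF closed_image[OF f] imageI[OF v] y]
  show ?thesis
  proof (rule partial_iso_insertI[OF f x(1,3) y(1,3)])
    show "x \<sqinter> c = x \<and> y \<sqinter> f c = y \<or> x \<sqinter> c \<in> C \<and> y \<sqinter> f c = f (x \<sqinter> c)" if c: "c \<in> C" for c
      using X(1)[OF c] Y(1)[OF imageI[OF c]] partial_iso_meet[OF f v c] partial_iso_meet_in[OF f v c] cut[OF c] by simp
    show "x \<preceq> c \<longleftrightarrow> y \<preceq> f c" if "c \<in> C" for c using cut[OF that] .
    show le: "c \<preceq> x \<longleftrightarrow> f c \<preceq> y" if c: "c \<in> C" for c
      using X(2)[OF c] Y(2)[OF imageI[OF c]] partial_iso_le[OF f c v] cut[OF c] by simp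
    show "\<not> rel M x a d" if "a \<in> insert x C" "d \<in> insert x C" for a d using X(3)[OF that] .
    show "\<not> rel M y a d" if "a \<in> insert y (f ` C)" "d \<in> insert y (f ` C)" for a d using Y(3)[OF that] .
    show "rel M c x d \<longleftrightarrow> rel M (f c) y (f d)" if c: "c \<in> C" and d: "d \<in> C" for c d
      using X(4)[OF c d] Y(4)[OF imageI[OF c] imageI[OF d]] le[OF c] partial_iso_rel[OF f c v d] by simp
  qed
qed

text \<open>The type of a point that fills a cut is determined by the generators above it: an element
  \<open>c\<close> is above the point exactly if the generators of \<open>c\<close> are, and it is below the point exactly
  if it is below \<open>v\<close> and not above the point.\<close>

lemma partial_iso_insert_cut_cl:
  assumes f: "partial_iso (meet_closure M X) f" and X: "X \<subseteq> U" and v: "v \<in> X" and x: "x \<in> U" "x \<preceq> v" "x \<notin> meet_closure M X"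
    and y: "y \<in> U" "y \<preceq> f v" "y \<notin> meet_closure M (f ` X)" and cut: "\<And>g. g \<in> X \<Longrightarrow> x \<preceq> g \<longleftrightarrow> y \<preceq> f g"
  shows "partial_iso (insert x (meet_closure M X)) (f(x := y))"
proof (rule partial_iso_insert_cut[OF f meet_closure.gen[OF v] x y(1,2)])
  show "y \<notin> f ` meet_closure M X" using y(3) partial_iso_image_cl[OF f cl_gens] by blast
  show "x \<preceq> c \<longleftrightarrow> y \<preceq> f c" if "c \<in> meet_closure M X" for c
    using that
  proof induction
    case (gen c) then show ?case by (rule cut)
  next
    case (meet c d)
    then show ?case
      using partial_iso_meet[OF f meet(1,2)] partial_iso_in[OF f meet(1)] partial_iso_in[OF f meet(2)]
        cl_in_U[OF X meet(1)] cl_in_U[OF X meet(2)] x(1) y(1) by (simp add: le_meet_iff)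
  qed
qed

end

section \<open>Indiscernible sequences and partial isomorphisms\<close>

lemma indiscernible_mono: "indiscernible M B a \<Longrightarrow> B' \<subseteq> B \<Longrightarrow> indiscernible M B' a"
  unfolding indiscernible_def by (meson order_trans)

context dtr_monster begin

lemma tuple_seqD:
  assumes "tuple_seq M a"
  shows "set (a i) \<subseteq> U" "length (a i) = length (a 0)"
  using assms by (auto simp: tuple_seq_def)

lemma seq_elems:
  assumes "tuple_seq M a" "k < length (a 0)"
  shows seq_in: "a i ! k \<in> set (a i)" and seq_in_U: "a i ! k \<in> U"
proof -
  show 1: "a i ! k \<in> set (a i)" using assms(2) tuple_seqD(2)[OF assms(1), of i] by simp
  then show "a i ! k \<in> U" using tuple_seqD(1)[OF assms(1), of i] by blast
qed

lemma indiscernible_tuple_seq: "indiscernible M B a \<Longrightarrow> tuple_seq M a"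
  by (simp add: indiscernible_def)

lemma map_concat_blocks:
  assumes a: "tuple_seq M a" and len: "length is = length js"
    and eq: "map f (concat (map a is)) = concat (map a js)"
  shows "map (\<lambda>i. map f (a i)) is = map a js"
proof -
  have "concat (map (\<lambda>i. map f (a i)) is) = concat (map a js)"
    using eq by (simp add: map_concat o_def)
  then show ?thesis
  proof (rule concat_injective)
    show "length (map (\<lambda>i. map f (a i)) is) = length (map a js)" using len by simp
    show "\<forall>(x, y)\<in>set (zip (map (\<lambda>i. map f (a i)) is) (map a js)). length x = length y"
      using tuple_seqD(2)[OF a] by (auto simp: set_zip) (metis)
  qed
qed

lemma indiscernible_partial_iso:
  assumes a: "indiscernible M B a" and B: "finite B" "B \<subseteq> U"
    and is_js: "sorted_wrt (<) is" "sorted_wrt (<) js" "length is = length js"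
  obtains f where "partial_iso (meet_closure M ((\<Union>i\<in>set is. set (a i)) \<union> B)) f"
    "map (\<lambda>i. map f (a i)) is = map a js" "\<And>x. x \<in> B \<Longrightarrow> f x = x"
proof -
  note ts = indiscernible_tuple_seq[OF a]
  obtain b where b: "set b = B" using finite_list[OF B(1)] by blast
  let ?c = "concat (map a is) @ b" and ?d = "concat (map a js) @ b"
  have l: "length (concat (map a is)) = length (concat (map a js))"
  proof -
    have "map (length \<circ> a) is = map (length \<circ> a) js"
      using is_js(3) tuple_seqD(2)[OF ts] by (intro nth_equalityI) (auto, metis)
    then show ?thesis by (simp add: length_concat o_def)
  qed
  have sub: "set ?c \<subseteq> U" "set ?d \<subseteq> U" using tuple_seqD(1)[OF ts] b B by auto
  have "holds M \<phi> ?c \<longleftrightarrow> holds M \<phi> ?d" if "fv \<phi> \<subseteq> {..<length ?c}" for \<phi>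
    using a is_js that b unfolding indiscernible_def by blast
  then obtain f where f: "partial_iso (meet_closure M (set ?c)) f" "map f ?c = ?d"
    using partial_iso_of_same_type[of ?c ?d] sub l by (metis length_append)
  have "set ?c = (\<Union>i\<in>set is. set (a i)) \<union> B" using b by auto
  moreover have 1: "map f (concat (map a is)) = concat (map a js)" "map f b = b"
    using f(2) l by simp_all
  moreover have "f x = x" if "x \<in> B" for x using that b 1(2) by (metis map_idI map_eq_conv map_ident)
  ultimately show ?thesis using that f(1) map_concat_blocks[OF ts is_js(3) 1(1)] by metis
qed

lemma indiscernible_partial_iso1:
  assumes a: "indiscernible M B a" and B: "finite B" "B \<subseteq> U"
  obtains f where "partial_iso (meet_closure M (set (a i) \<union> B)) f" "map f (a i) = a i'" "\<And>x. x \<in> B \<Longrightarrow> f x = x"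
  using indiscernible_partial_iso[OF a B, of "[i]" "[i']"] by auto

lemma indiscernible_partial_iso2:
  assumes a: "indiscernible M B a" and B: "finite B" "B \<subseteq> U" and ij: "i < j" "i' < j'"
  obtains f where "partial_iso (meet_closure M (set (a i) \<union> set (a j) \<union> B)) f" "map f (a i) = a i'" "map f (a j) = a j'"
    "\<And>x. x \<in> B \<Longrightarrow> f x = x"
  using indiscernible_partial_iso[OF a B, of "[i, j]" "[i', j']"] ij by auto

lemma indiscernibleI:
  assumes ts: "tuple_seq M a"
    and ex: "\<And>(is :: nat list) js. is \<noteq> [] \<Longrightarrow> sorted_wrt (<) is \<Longrightarrow> sorted_wrt (<) js \<Longrightarrow> length is = length js \<Longrightarrow>
      \<exists>f C. partial_iso C f \<and> (\<Union>i\<in>set is. set (a i)) \<union> B \<subseteq> C \<and> map (\<lambda>i. map f (a i)) is = map a js \<and>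
        (\<forall>x\<in>B. f x = x)"
  shows "indiscernible M B a"
  unfolding indiscernible_def
proof (intro conjI allI impI ts)
  fix \<phi> c and "is" js :: "nat list"
  assume H: "set c \<subseteq> B \<and> sorted_wrt (<) is \<and> sorted_wrt (<) js \<and> length is = length js \<and>
    fv \<phi> \<subseteq> {..<length (concat (map a is) @ c)}"
  show "holds M \<phi> (concat (map a is) @ c) \<longleftrightarrow> holds M \<phi> (concat (map a js) @ c)"
  proof (cases "is = []")
    case False
    obtain f C where f: "partial_iso C f" "(\<Union>i\<in>set is. set (a i)) \<union> B \<subseteq> C"
      "map (\<lambda>i. map f (a i)) is = map a js" "\<forall>x\<in>B. f x = x"
      using ex[OF False] H by blast
    have "map f (concat (map a is)) = concat (map a js)" using f(3) by (simp add: map_concat o_def)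
    moreover have "map f c = c" using f(4) H by (intro map_idI) auto
    moreover have "set (concat (map a is) @ c) \<subseteq> C" using f(2) H by auto
    ultimately show ?thesis using partial_iso_preserves[OF f(1), of "concat (map a is) @ c" \<phi>] H by simp
  qed (use H in simp)
qed

lemma nth_blocks:
  assumes "map (\<lambda>i. map f (a i)) is = map a js" "n < length is" "k < length (a (is ! n))"
  shows "f (a (is ! n) ! k) = a (js ! n) ! k"
proof -
  have "map f (a (is ! n)) = a (js ! n)" using assms(1,2) by (metis length_map nth_map)
  then show ?thesis using assms(3) by (metis nth_map)
qed

lemma automorphism_partial_iso: "automorphism \<sigma> M \<Longrightarrow> partial_iso U \<sigma>"
  by (auto simp: automorphism_def partial_iso_def closed_def restr_def)

lemma automorphism_indiscernible:
  assumes s: "automorphism \<sigma> M" and a: "indiscernible M B a" and B: "B \<subseteq> U"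
  shows "indiscernible M (\<sigma> ` B) (\<lambda>i. map \<sigma> (a i))"
proof -
  note ts = indiscernible_tuple_seq[OF a]
  have \<sigma>U: "\<sigma> x \<in> U" if "x \<in> U" for x using s that by (auto simp: automorphism_def)
  show ?thesis
    unfolding indiscernible_def
  proof (intro conjI allI impI)
    show "tuple_seq M (\<lambda>i. map \<sigma> (a i))"
      using ts \<sigma>U by (auto simp: tuple_seq_def)
    fix \<phi> c and "is" js :: "nat list"
    assume H: "set c \<subseteq> \<sigma> ` B \<and> sorted_wrt (<) is \<and> sorted_wrt (<) js \<and> length is = length js \<and>
      fv \<phi> \<subseteq> {..<length (concat (map (\<lambda>i. map \<sigma> (a i)) is) @ c)}"
    then have c: "z \<in> \<sigma> ` B" if "z \<in> set c" for z using that by blast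
    define b where "b = map (inv_into B \<sigma>) c"
    have b: "set b \<subseteq> B" "c = map \<sigma> b"
      using c by (auto simp: b_def inv_into_into f_inv_into_f intro!: map_idI[symmetric])
    have eq: "concat (map (\<lambda>i. map \<sigma> (a i)) ks) @ c = map \<sigma> (concat (map a ks) @ b)" for ks
      by (simp add: b map_concat o_def)
    have len: "length (concat (map a is) @ b) = length (concat (map a js) @ b)"
    proof -
      have "map (length \<circ> a) is = map (length \<circ> a) js"
        using H tuple_seqD(2)[OF ts] by (intro nth_equalityI) (auto, metis)
      then show ?thesis by (simp add: length_concat o_def)
    qed
    have pres: "holds M \<phi> (map \<sigma> (concat (map a ks) @ b)) \<longleftrightarrow> holds M \<phi> (concat (map a ks) @ b)"
      if "fv \<phi> \<subseteq> {..<length (concat (map a ks) @ b)}" for ks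
      using that tuple_seqD(1)[OF ts] b(1) B by (intro partial_iso_preserves[OF automorphism_partial_iso[OF s]]) auto
    have fv: "fv \<phi> \<subseteq> {..<length (concat (map a is) @ b)}" using H unfolding eq by simp
    have "holds M \<phi> (concat (map a is) @ b) \<longleftrightarrow> holds M \<phi> (concat (map a js) @ b)"
      using a H b fv unfolding indiscernible_def by blast
    then show "holds M \<phi> (concat (map (\<lambda>i. map \<sigma> (a i)) is) @ c) \<longleftrightarrow>
        holds M \<phi> (concat (map (\<lambda>i. map \<sigma> (a i)) js) @ c)"
      unfolding eq using pres[of "is"] pres[of js] fv len by simp
  qed
qed

text \<open>By homogeneity a sequence with the same type over \<open>a 0\<close> as \<open>a\<close> may be taken to be the
  image of \<open>a\<close> under an automorphism that fixes \<open>a 0\<close>.\<close>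

definition indisc_copy :: "(nat \<Rightarrow> 'a list) \<Rightarrow> 'a \<Rightarrow> bool" where
  "indisc_copy a y \<longleftrightarrow> (\<exists>\<sigma>. automorphism \<sigma> M \<and> (\<forall>z\<in>set (a 0). \<sigma> z = z) \<and>
     indiscernible M {y} (\<lambda>i. map \<sigma> (a i)))"

lemma indisc_copy_same_type:
  assumes "indisc_copy a y" "tuple_seq M a"
  shows "\<exists>a'. indiscernible M {y} a' \<and> same_type M (set (a 0)) a' a"
proof -
  obtain \<sigma> where s: "automorphism \<sigma> M" "\<forall>z\<in>set (a 0). \<sigma> z = z" "indiscernible M {y} (\<lambda>i. map \<sigma> (a i))"
    using assms by (auto simp: indisc_copy_def)
  have "same_type M (set (a 0)) (\<lambda>i. map \<sigma> (a i)) a"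
    unfolding same_type_def
  proof (intro conjI allI impI)
    fix \<phi> c "is" assume H: "set c \<subseteq> set (a 0) \<and> fv \<phi> \<subseteq> {..<length (concat (map a is) @ c)}"
    have "map \<sigma> c = c" using H s(2) by (intro map_idI) auto
    then have "concat (map (\<lambda>i. map \<sigma> (a i)) is) @ c = map \<sigma> (concat (map a is) @ c)"
      by (simp add: map_concat o_def)
    moreover have "set (concat (map a is) @ c) \<subseteq> U" using tuple_seqD(1)[OF assms(2)] H by auto
    ultimately show "holds M \<phi> (concat (map (\<lambda>i. map \<sigma> (a i)) is) @ c) \<longleftrightarrow> holds M \<phi> (concat (map a is) @ c)"
      using partial_iso_preserves[OF automorphism_partial_iso[OF s(1)], of "concat (map a is) @ c" \<phi>] H by (simp only:)
  qed simp
  then show ?thesis using s(3) by blast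
qed

lemma automorphism_comp: "automorphism \<sigma> M \<Longrightarrow> automorphism \<tau> M \<Longrightarrow> automorphism (\<tau> \<circ> \<sigma>) M"
  unfolding automorphism_def using embedding_comp[of \<sigma> M M \<tau> M] by (metis image_comp)

lemma indisc_copy_refl:
  assumes "indiscernible M {y} a"
  shows "indisc_copy a y"
proof -
  have "automorphism (\<lambda>x. x) M" by (simp add: automorphism_def embedding_def)
  then show ?thesis using assms unfolding indisc_copy_def by (intro exI[of _ "\<lambda>x. x"]) simp
qed

lemma indisc_copy_trans:
  assumes s: "automorphism \<sigma> M" "\<forall>z\<in>set (a 0). \<sigma> z = z" and m: "indisc_copy (\<lambda>i. map \<sigma> (a i)) y"
  shows "indisc_copy a y"
proof -
  have 0: "map \<sigma> (a 0) = a 0" using s(2) by (simp add: map_idI)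
  obtain \<tau> where t: "automorphism \<tau> M" "\<forall>z\<in>set (map \<sigma> (a 0)). \<tau> z = z"
    "indiscernible M {y} (\<lambda>i. map \<tau> (map \<sigma> (a i)))" using m by (auto simp: indisc_copy_def)
  have "automorphism (\<tau> \<circ> \<sigma>) M" using automorphism_comp s t by blast
  moreover have "\<forall>z\<in>set (a 0). (\<tau> \<circ> \<sigma>) z = z" using s(2) t(2) unfolding 0 by simp
  moreover have "indiscernible M {y} (\<lambda>i. map (\<tau> \<circ> \<sigma>) (a i))" using t(3) by simp
  ultimately show ?thesis unfolding indisc_copy_def by blast
qed

lemma indisc_copy_of_partial_iso:
  assumes a: "indiscernible M {x} a" and f: "partial_iso C f" "insert x (set (a 0)) \<subseteq> C" "\<forall>z\<in>set (a 0). f z = z"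
  shows "indisc_copy a (f x)"
proof -
  obtain \<sigma> where s: "automorphism \<sigma> M" "\<And>z. z \<in> insert x (set (a 0)) \<Longrightarrow> \<sigma> z = f z"
    using automorphism_of_partial_iso[OF f(1) _ f(2)] by (metis countable_finite finite_insert List.finite_set)
  have "indiscernible M (\<sigma> ` {x}) (\<lambda>i. map \<sigma> (a i))"
    using automorphism_indiscernible[OF s(1) a] f(2) partial_iso_subset[OF f(1)] by auto
  then show ?thesis unfolding indisc_copy_def using s f(3) by (intro exI[of _ \<sigma>]) auto
qed

lemma indisc_copy_of_insert:
  assumes a: "indiscernible M {x} a" and f: "partial_iso (insert x (meet_closure M X)) ((\<lambda>z. z)(x := b))"
    and x: "x \<notin> meet_closure M X" and X: "set (a 0) \<subseteq> X"
  shows "indisc_copy a b"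
proof -
  have 0: "set (a 0) \<subseteq> meet_closure M X" using X cl_gens[of X M] by blast
  then have "\<forall>z\<in>set (a 0). ((\<lambda>z. z)(x := b)) z = z" using x by auto
  moreover have "insert x (set (a 0)) \<subseteq> insert x (meet_closure M X)" using 0 by blast
  ultimately have "indisc_copy a (((\<lambda>z. z)(x := b)) x)" using indisc_copy_of_partial_iso[OF a f] by blast
  then show ?thesis by simp
qed

section \<open>Adding a point above or in a cut\<close>

text \<open>This is why the edges required by the terms of a sequence never conflict. For \<open>i < j\<close>, both
  \<open>a 1 ! l\<close> and \<open>a 2 ! l\<close> lie in the cone of \<open>a 0 ! k\<close>. So the entries with index \<open>l\<close> of any two
  terms lie in one cone, and \<open>a 1 ! l\<close> links \<open>a 0 ! k\<close> to \<open>a 0 ! l\<close>.\<close>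

lemma same_cone_transfer:
  assumes a: "indiscernible M {e} a" and e: "e \<in> U" and kl: "k < length (a 0)" "l < length (a 0)"
    and cone: "e \<prec> a i ! k \<sqinter> a j ! l"
  shows "e \<prec> a 0 ! k \<sqinter> a 0 ! l"
proof -
  note ts = indiscernible_tuple_seq[OF a]
  have len: "length (a i) = length (a 0)" for i using tuple_seqD(2)[OF ts] .
  note aU = seq_in_U[OF ts]
  have T1: "e \<prec> a i' ! k \<sqinter> a i' ! l" if kl: "k < length (a 0)" "l < length (a 0)" and c: "e \<prec> a i ! k \<sqinter> a i ! l"
    for i i' k l
  proof -
    obtain f where f: "partial_iso (meet_closure M (set (a i) \<union> {e})) f" "map f (a i) = a i'" "f e = e"
      using indiscernible_partial_iso1[OF a, of i i'] e by auto
    have mem: "a i ! k \<in> meet_closure M (set (a i) \<union> {e})" "a i ! l \<in> meet_closure M (set (a i) \<union> {e})" "e \<in> meet_closure M (set (a i) \<union> {e})"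
      using kl len[of i] by (auto intro!: meet_closure.gen)
    have "f (a i ! k) = a i' ! k" "f (a i ! l) = a i' ! l" using f(2) kl len[of i] by (metis nth_map)+
    then show ?thesis
      using c partial_iso_meet[OF f(1) mem(1,2)] partial_iso_meet_in[OF f(1) mem(1,2)] mem(3) f(3)
        partial_iso_le[OF f(1) mem(3), of "a i ! k \<sqinter> a i ! l"] partial_iso_eq[OF f(1) mem(3), of "a i ! k \<sqinter> a i ! l"] by simp
  qed
  have T2: "e \<prec> a i' ! k \<sqinter> a j' ! l" if ij: "i < j" "i' < j'" and kl: "k < length (a 0)" "l < length (a 0)"
    and c: "e \<prec> a i ! k \<sqinter> a j ! l" for i j i' j' k l
  proof -
    let ?X = "set (a i) \<union> set (a j) \<union> {e}"
    obtain f where f: "partial_iso (meet_closure M ?X) f" "map f (a i) = a i'" "map f (a j) = a j'" "f e = e"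
      using indiscernible_partial_iso2[OF a _ _ ij] e by auto
    have mem: "a i ! k \<in> meet_closure M ?X" "a j ! l \<in> meet_closure M ?X" "e \<in> meet_closure M ?X"
      using kl len[of i] len[of j] by (auto intro!: meet_closure.gen)
    have "f (a i ! k) = a i' ! k" "f (a j ! l) = a j' ! l"
      using f(2,3) kl len[of i] len[of j] by (metis nth_map)+
    then show ?thesis
      using c partial_iso_meet[OF f(1) mem(1,2)] partial_iso_meet_in[OF f(1) mem(1,2)] mem(3) f(4)
        partial_iso_le[OF f(1) mem(3), of "a i ! k \<sqinter> a j ! l"] partial_iso_eq[OF f(1) mem(3), of "a i ! k \<sqinter> a j ! l"] by simp
  qed
  have lt: "e \<prec> a 0 ! k \<sqinter> a 0 ! l" if ij: "i < j" and kl: "k < length (a 0)" "l < length (a 0)"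
    and c: "e \<prec> a i ! k \<sqinter> a j ! l" for i j k l
  proof -
    note U = aU[OF kl(1)] aU[OF kl(2)]
    have "e \<prec> a 0 ! k \<sqinter> a 1 ! l" "e \<prec> a 0 ! k \<sqinter> a 2 ! l" using T2[OF ij _ kl c] by simp_all
    then have "e \<prec> a 1 ! l \<sqinter> a 2 ! l"
      using cone_trans[of e "a 1 ! l" "a 0 ! k" "a 2 ! l"] U e meet_comm[of "a 0 ! k" "a 1 ! l"] by simp
    then have "e \<prec> a 0 ! l \<sqinter> a 1 ! l" using T2[of 1 2 0 1 l l] kl by simp
    then show ?thesis
      using cone_trans[of e "a 0 ! k" "a 1 ! l" "a 0 ! l"] U e meet_comm[of "a 0 ! l" "a 1 ! l"]
        \<open>e \<prec> a 0 ! k \<sqinter> a 1 ! l\<close> by simp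
  qed
  consider "i < j" | "i = j" | "j < i" by linarith
  then show ?thesis
  proof cases
    case 1 then show ?thesis using lt kl cone by blast
  next
    case 2 then show ?thesis using T1 kl cone by blast
  next
    case 3
    have "e \<prec> a j ! l \<sqinter> a i ! k" using cone meet_comm[OF aU[OF kl(1)] aU[OF kl(2)]] by simp
    then have "e \<prec> a 0 ! l \<sqinter> a 0 ! k" using lt[OF 3 kl(2,1)] by blast
    then show ?thesis using meet_comm[OF aU[OF kl(1)] aU[OF kl(2)]] by simp
  qed
qed

text \<open>For \<open>e < b\<close>, the type of \<open>b\<close> over \<open>a 0\<close> and \<open>e\<close> says that \<open>b\<close> lies in a new cone above
  \<open>e\<close> and to which of the cones above \<open>e\<close> this cone is joined. A point \<open>x\<close> in a cone that is new
  for the whole sequence, with the edges to all terms copied from those of \<open>b\<close> to \<open>a 0\<close>, has this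
  type, and the sequence is indiscernible over it.\<close>

lemma indisc_copy_above:
  assumes a: "indiscernible M {e} a" and e: "e \<in> U" and b: "b \<in> U" "e \<preceq> b"
    and new: "\<And>z. z \<in> set (a 0) \<Longrightarrow> \<not> e \<prec> b \<sqinter> z"
  shows "indisc_copy a b"
proof (cases "e = b")
  case True then show ?thesis using a indisc_copy_refl by simp
next
  case False
  note ts = indiscernible_tuple_seq[OF a]
  have len: "length (a i) = length (a 0)" for i using tuple_seqD(2)[OF ts] .
  note aU = seq_in_U[OF ts]
  define A where "A = (\<Union>i. set (a i))"
  have aA: "a i ! k \<in> A" if "k < length (a 0)" for i k using seq_in[OF ts that] by (auto simp: A_def)
  have AU: "A \<subseteq> U" using tuple_seqD(1)[OF ts] by (auto simp: A_def)
  have in_A: "\<exists>i k. k < length (a 0) \<and> z = a i ! k" if z: "z \<in> A" for z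
  proof -
    obtain i where "z \<in> set (a i)" using z by (auto simp: A_def)
    then show ?thesis using len[of i] by (auto simp: in_set_conv_nth)
  qed
  define P where "P z \<longleftrightarrow> (\<exists>i k. k < length (a 0) \<and> z = a i ! k \<and> rel M e b (a 0 ! k))" for z
  have rel_eq: "rel M e b (a 0 ! k) \<longleftrightarrow> rel M e b (a 0 ! l)"
    if "k < length (a 0)" "l < length (a 0)" "e \<prec> a i ! k \<sqinter> a j ! l" for i j k l
    using same_cone_transfer[OF a e that] rel_cong_cone(2)[of e "a 0 ! k" "a 0 ! l" b] e b aU that by blast
  have P_iff: "P (a i ! k) \<longleftrightarrow> rel M e b (a 0 ! k)" if k: "k < length (a 0)" and lt: "e \<prec> a i ! k" for i k
  proof
    assume "P (a i ! k)"
    then obtain j l where jl: "l < length (a 0)" "a i ! k = a j ! l" "rel M e b (a 0 ! l)" by (auto simp: P_def)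
    have "a i ! k \<sqinter> a j ! l = a i ! k" 
      unfolding jl(2)[symmetric] by (rule meet_eq1[OF aU[OF k] aU[OF k] refl[OF aU[OF k]]])
    then show "rel M e b (a 0 ! k)" using rel_eq[OF k jl(1), of i j] lt jl(3) by simp
  qed (use k in \<open>auto simp: P_def\<close>)
  let ?Y = "{z\<in>A. e \<prec> z}"
  obtain x where x: "x \<in> U" "e \<prec> x" "\<And>z. z \<in> ?Y \<Longrightarrow> \<not> e \<prec> x \<sqinter> z" "\<And>z. z \<in> ?Y \<Longrightarrow> rel M e x z \<longleftrightarrow> P z"
  proof (rule realize_cone[OF e, of ?Y P])
    have "countable A" unfolding A_def by (intro countable_UN) (auto intro: countable_finite)
    then show "countable ?Y" by (rule countable_subset[rotated]) auto
    show "?Y \<subseteq> U" using AU by auto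
    show "P z'" if z: "z \<in> ?Y" "z' \<in> ?Y" "e \<prec> z \<sqinter> z'" "P z" for z z'
    proof -
      obtain i k where k: "k < length (a 0)" "z = a i ! k" using in_A z(1) by blast
      obtain j l where l: "l < length (a 0)" "z' = a j ! l" using in_A z(2) by blast
      show ?thesis using rel_eq[OF k(1) l(1), of i j] P_iff[OF k(1)] P_iff[OF l(1)] z k l by auto
    qed
  qed auto
  have rel_x: "rel M e x (a i ! k) \<longleftrightarrow> rel M e b (a 0 ! k)" if k: "k < length (a 0)" and lt: "e \<prec> a i ! k" for i k
  proof -
    have "a i ! k \<in> ?Y" using aA[OF k] lt by blast
    then show ?thesis using x(4) P_iff[OF k lt] by simp
  qed
  have new_x: "\<not> e \<prec> x \<sqinter> z" if z: "z \<in> insert e A" for z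
  proof
    assume lt: "e \<prec> x \<sqinter> z"
    have zU: "z \<in> U" using z AU e by auto
    then have "e \<prec> z" using lt_le_trans[of e "x \<sqinter> z" z] lt meet_le2[of x z] x(1) e by auto
    then have "z \<in> ?Y" using z by auto
    then show False using x(3) lt by blast
  qed
  have eAU: "insert e A \<subseteq> U" using e AU by auto
  have new_x_cl: "\<not> e \<prec> x \<sqinter> c" if "c \<in> meet_closure M (insert e A)" for c
    using new_cone_cl[OF eAU x(1) e new_x that] .
  (* An element above e generated by entries of the sequence and e lies in the cone of one of
     these entries, which determines whether it is joined to x. *)
  have below: "\<exists>i\<in>I. \<exists>k<length (a 0). c \<preceq> a i ! k \<and> a i ! k \<in> U \<and> c \<in> U \<and> e \<prec> a i ! k"
    if c: "c \<in> meet_closure M ((\<Union>i\<in>I. set (a i)) \<union> {e})" and lt: "e \<prec> c" for c I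
  proof -
    have X: "(\<Union>i\<in>I. set (a i)) \<union> {e} \<subseteq> U" using AU e by (auto simp: A_def)
    obtain g where g: "g \<in> (\<Union>i\<in>I. set (a i)) \<union> {e}" "c \<preceq> g" using cl_below_generator[OF X c] by blast
    have U: "c \<in> U" "g \<in> U" using cl_in_U[OF X c] g X by auto
    have eg: "e \<prec> g" using lt_le_trans[of e c g] lt g U e by auto
    then obtain i where i: "i \<in> I" "g \<in> set (a i)" using g by auto
    then obtain k where "k < length (a 0)" "g = a i ! k" using len[of i] by (auto simp: in_set_conv_nth)
    then show ?thesis using i g(2) eg U by blast
  qed
  have rel_le: "rel M e y c \<longleftrightarrow> rel M e y d" if "e \<prec> c" "c \<preceq> d" "c \<in> U" "d \<in> U" "y \<in> U" for y c d
    using rel_cong_cone(2)[of e c d y] cone_mono[of e c d] that e by blast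
  have "indiscernible M {x} a"
  proof (rule indiscernibleI[OF ts])
    fix "is" js :: "nat list"
    assume ij: "sorted_wrt (<) is" "sorted_wrt (<) js" "length is = length js"
    let ?X = "(\<Union>i\<in>set is. set (a i)) \<union> {e}"
    let ?C = "meet_closure M ?X"
    obtain f where f: "partial_iso ?C f" "map (\<lambda>i. map f (a i)) is = map a js" "f e = e"
      using indiscernible_partial_iso[OF a _ _ ij] e by auto
    have XC: "?X \<subseteq> ?C" by (rule cl_gens)
    have CA: "?C \<subseteq> meet_closure M (insert e A)" by (rule cl_mono) (auto simp: A_def)
    have idx: "f (a i ! k) \<in> A \<and> (\<exists>j. f (a i ! k) = a j ! k)" if i: "i \<in> set is" and k: "k < length (a 0)" for i k
    proof -
      obtain n where n: "n < length is" "i = is ! n" using i by (auto simp: in_set_conv_nth)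
      have "f (a i ! k) = a (js ! n) ! k" using nth_blocks[OF f(2) n(1)] k len n(2) by metis
      then show ?thesis using aA[OF k] by auto
    qed
    have fX: "f ` ?X \<subseteq> insert e A"
    proof -
      have "f z \<in> A" if "i \<in> set is" "z \<in> set (a i)" for i z
        using idx[OF that(1)] that(2) len[of i] by (auto simp: in_set_conv_nth)
      then show ?thesis using f(3) by auto
    qed
    have fC: "f c \<in> meet_closure M (insert e A)" if "c \<in> ?C" for c
      using partial_iso_image_cl[OF f(1) XC that] cl_mono[OF fX] by blast
    have eC: "e \<in> ?C" using XC by auto
    have rel: "rel M e x c \<longleftrightarrow> rel M (f e) x (f c)" if c: "c \<in> ?C" "e \<prec> c" for c
    proof -
      obtain i k where ik: "i \<in> set is" "k < length (a 0)" "c \<preceq> a i ! k" "a i ! k \<in> U" "c \<in> U" "e \<prec> a i ! k"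
        using below[OF c] by blast
      obtain j where j: "f (a i ! k) = a j ! k" using idx[OF ik(1,2)] by blast
      have aC: "a i ! k \<in> ?C" using XC ik(1) seq_in[OF ts ik(2), of i] by blast
      have fc: "e \<prec> f c" "f c \<preceq> a j ! k" "e \<prec> a j ! k"
        using partial_iso_le[OF f(1) eC c(1)] partial_iso_eq[OF f(1) eC c(1)] partial_iso_le[OF f(1) c(1) aC]
          partial_iso_le[OF f(1) eC aC] partial_iso_eq[OF f(1) eC aC] c(2) ik f(3) j by auto
      have "rel M e x c \<longleftrightarrow> rel M e x (a i ! k)" using rel_le c(2) ik x(1) by blast
      also have "\<dots> \<longleftrightarrow> rel M e x (a j ! k)" using rel_x ik(2,6) fc(3) by blast
      also have "\<dots> \<longleftrightarrow> rel M e x (f c)"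
        using rel_le[OF fc(1,2)] partial_iso_in[OF f(1) c(1)] aU[OF ik(2)] x(1) by blast
      finally show ?thesis using f(3) by simp
    qed
    have xC: "x \<notin> ?C" and g: "partial_iso (insert x ?C) (f(x := x))"
      using partial_iso_insert_cone[OF f(1) eC x(1,2) x(1) _ _ _ rel] f(3) x(2) new_x_cl CA fC by auto
    have "map (\<lambda>i. map (f(x := x)) (a i)) is = map (\<lambda>i. map f (a i)) is"
      using xC XC by (intro map_cong) auto
    then show "\<exists>f C. partial_iso C f \<and> (\<Union>i\<in>set is. set (a i)) \<union> {x} \<subseteq> C \<and>
        map (\<lambda>i. map f (a i)) is = map a js \<and> (\<forall>x\<in>{x}. f x = x)"
      using g f(2) XC by (intro exI[of _ "f(x := x)"] exI[of _ "insert x ?C"]) auto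
  qed
  moreover have "partial_iso (insert x (meet_closure M (set (a 0) \<union> {e}))) ((\<lambda>z. z)(x := b))" "x \<notin> meet_closure M (set (a 0) \<union> {e})"
  proof -
    let ?C = "meet_closure M (set (a 0) \<union> {e})"
    have X: "set (a 0) \<union> {e} \<subseteq> U" using tuple_seqD(1)[OF ts] e by auto
    have eC: "e \<in> ?C" by (auto intro: meet_closure.gen)
    have new_b: "\<not> e \<prec> b \<sqinter> g" if "g \<in> set (a 0) \<union> {e}" for g
      using that new meet_le2[of b e] antisym[of e "b \<sqinter> e"] e b by auto
    have CA: "?C \<subseteq> meet_closure M (insert e A)" by (rule cl_mono) (auto simp: A_def)
    have rel: "rel M e x c \<longleftrightarrow> rel M e b c" if c: "c \<in> ?C" "e \<prec> c" for c
    proof -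
      obtain k where k: "k < length (a 0)" "c \<preceq> a 0 ! k" "a 0 ! k \<in> U" "c \<in> U" "e \<prec> a 0 ! k"
        using below[of c "{0}"] c by auto
      have "rel M e x c \<longleftrightarrow> rel M e x (a 0 ! k)" using rel_le c(2) k x(1) by blast
      also have "\<dots> \<longleftrightarrow> rel M e b (a 0 ! k)" using rel_x k by blast
      also have "\<dots> \<longleftrightarrow> rel M e b c" using rel_le c(2) k b(1) by blast
      finally show ?thesis .
    qed
    show "partial_iso (insert x ?C) ((\<lambda>z. z)(x := b))" "x \<notin> ?C"
      using partial_iso_insert_cone[OF partial_iso_id[OF closed_cl[OF X]] eC x(1,2) b(1) _ _ _ rel] b(2) False
        new_x_cl CA new_cone_cl[OF X b(1) e new_b] by auto
  qed
  ultimately show ?thesis using indisc_copy_of_insert[of x a "set (a 0) \<union> {e}" b] by blast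
qed

end

context dtr_monster begin

text \<open>The term \<open>a i\<close> has a cut whose upper end is the meet of the entries with index in \<open>K\<close>, one
  of them being \<open>k0\<close>, and whose lower end is the greatest \<open>a i ! k \<sqinter> a i ! k0\<close> with \<open>k \<notin> K\<close>.
  Two such cuts overlap if the lower end of each is strictly below the meet of the upper ends of
  both. The cuts of the terms \<open>0\<close> and \<open>1\<close>, interchanged by \<open>\<lambda>i. 1 - i\<close>, stand for any two.\<close>

definition compatible_cuts :: "(nat \<Rightarrow> 'a list) \<Rightarrow> nat set \<Rightarrow> nat \<Rightarrow> bool" where
  "compatible_cuts a K k0 \<longleftrightarrow> (\<forall>k k' i. k < length (a 0) \<and> k \<notin> K \<and> k' \<in> K \<and> i \<in> {0, 1} \<longrightarrow>
     a i ! k \<sqinter> a i ! k0 \<prec> a i ! k0 \<sqinter> a (1 - i) ! k')"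

lemma below_cut:
  assumes ts: "tuple_seq M a" and e: "e \<in> U" "e \<notin> meet_closure M (set (a 0))"
    and K: "K = {k. k < length (a 0) \<and> e \<preceq> a 0 ! k}" "k0 \<in> K" and k: "k < length (a 0)" "k \<notin> K"
  shows "a 0 ! k \<sqinter> a 0 ! k0 \<prec> e"
proof -
  have k0: "k0 < length (a 0)" "e \<preceq> a 0 ! k0" using K by auto
  let ?u = "a 0 ! k \<sqinter> a 0 ! k0"
  note U = seq_in_U[OF ts k(1), of 0] seq_in_U[OF ts k0(1), of 0]
  have uU: "?u \<in> U" using U by auto
  have "?u \<preceq> e \<or> e \<preceq> ?u" using chain[of "a 0 ! k0" ?u e] meet_le2[of "a 0 ! k" "a 0 ! k0"] k0 U uU e by blast
  moreover have "\<not> e \<preceq> ?u" using k K(1) U e by (simp add: le_meet_iff)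
  ultimately show ?thesis using e(1) refl[of e] by auto
qed

text \<open>If any two of the cuts overlap, they all have a common point \<open>x\<close>, and it can be taken outside
  of the substructure generated by the sequence. It then fills the same cut in all the
  substructures generated by terms of the sequence, namely that below the entries with index in
  \<open>K\<close>.\<close>

lemma indisc_copy_into_cut:
  assumes a: "indiscernible M {} a" and e: "e \<in> U" "e \<notin> meet_closure M (set (a 0))"
    and K: "K = {k. k < length (a 0) \<and> e \<preceq> a 0 ! k}" "k0 \<in> K"
    and good: "compatible_cuts a K k0"
  shows "indisc_copy a e"
proof -
  note ts = indiscernible_tuple_seq[OF a]
  have len: "length (a i) = length (a 0)" for i using tuple_seqD(2)[OF ts] .
  have k0: "k0 < length (a 0)" "e \<preceq> a 0 ! k0" using K by auto
  note aU = seq_in_U[OF ts]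
  have Kl: "k < length (a 0)" "e \<preceq> a 0 ! k" if "k \<in> K" for k using that K by auto
  have eU: "e \<prec> a 0 ! k0 \<sqinter> a 0 ! k" if "k \<in> K" for k
  proof -
    have "e \<preceq> a 0 ! k0 \<sqinter> a 0 ! k" using k0 Kl[OF that] aU e by (simp add: le_meet_iff)
    moreover have "a 0 ! k0 \<sqinter> a 0 ! k \<in> meet_closure M (set (a 0))"
      using seq_in[OF ts] k0 Kl(1)[OF that] by (intro meet_closure.meet meet_closure.gen)
    ultimately show ?thesis using e(2) by blast
  qed
  have low: "a i ! k \<sqinter> a i ! k0 \<prec> a i ! k0 \<sqinter> a j ! k'"
    if k: "k < length (a 0)" "k \<notin> K" "k' \<in> K" for i j k k'
  proof -
    have transfer: "a i ! k \<sqinter> a i ! k0 \<prec> a i ! k0 \<sqinter> a j ! k'"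
      if f: "partial_iso (meet_closure M X) f" "map f (a i') = a i" "map f (a j') = a j" "set (a i') \<union> set (a j') \<subseteq> X"
        and base: "a i' ! k \<sqinter> a i' ! k0 \<prec> a i' ! k0 \<sqinter> a j' ! k'" for f X i' j'
    proof -
      have mem: "a i' ! k \<in> meet_closure M X" "a i' ! k0 \<in> meet_closure M X" "a j' ! k' \<in> meet_closure M X"
        using f(4) seq_in[OF ts k(1), of i'] seq_in[OF ts k0(1), of i'] seq_in[OF ts Kl(1)[OF k(3)], of j']
        by (auto intro!: meet_closure.gen)
      have img: "f (a i' ! k) = a i ! k" "f (a i' ! k0) = a i ! k0" "f (a j' ! k') = a j ! k'"
        using f(2,3) k k0 Kl(1)[OF k(3)] len[of i'] len[of j'] by (metis nth_map)+
      show ?thesis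
        using partial_iso_lt[OF f(1) partial_iso_meet_in[OF f(1) mem(1,2)] partial_iso_meet_in[OF f(1) mem(2,3)]] base
        unfolding partial_iso_meet[OF f(1) mem(1,2)] partial_iso_meet[OF f(1) mem(2,3)] img by blast
    qed
    consider "i < j" | "i = j" | "j < i" by linarith
    then show ?thesis
    proof cases
      case 1
      obtain f where f: "partial_iso (meet_closure M (set (a 0) \<union> set (a 1) \<union> {})) f" "map f (a 0) = a i" "map f (a 1) = a j"
        using indiscernible_partial_iso2[OF a _ _ _ 1, of 0 1] by auto
      have "a 0 ! k \<sqinter> a 0 ! k0 \<prec> a 0 ! k0 \<sqinter> a 1 ! k'"
        using good[unfolded compatible_cuts_def, rule_format, of k k' 0] k by simp
      then show ?thesis by (intro transfer[OF f(1,2,3)]) auto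
    next
      case 2
      obtain f where f: "partial_iso (meet_closure M (set (a 0) \<union> {})) f" "map f (a 0) = a i"
        using indiscernible_partial_iso1[OF a, of 0 i] by auto
      have "a 0 ! k \<sqinter> a 0 ! k0 \<prec> e" by (rule below_cut[OF ts e K k(1,2)])
      then have "a 0 ! k \<sqinter> a 0 ! k0 \<prec> a 0 ! k0 \<sqinter> a 0 ! k'"
        using eU[OF k(3)] lt_le_trans[of "a 0 ! k \<sqinter> a 0 ! k0" e "a 0 ! k0 \<sqinter> a 0 ! k'"]
          aU[OF k(1)] aU[OF k0(1)] aU[OF Kl(1)[OF k(3)]] e(1) by auto
      then show ?thesis using f 2 by (intro transfer[OF f(1,2)]) auto
    next
      case 3
      obtain f where f: "partial_iso (meet_closure M (set (a 0) \<union> set (a 1) \<union> {})) f" "map f (a 0) = a j" "map f (a 1) = a i"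
        using indiscernible_partial_iso2[OF a _ _ _ 3, of 0 1] by auto
      have "a 1 ! k \<sqinter> a 1 ! k0 \<prec> a 1 ! k0 \<sqinter> a 0 ! k'"
        using good[unfolded compatible_cuts_def, rule_format, of k k' 1] k by simp
      then show ?thesis by (intro transfer[OF f(1,3,2)]) auto
    qed
  qed
  define A where "A = (\<Union>i. set (a i))"
  define L where "L = {a i ! k \<sqinter> a i ! k0 | i k. k < length (a 0) \<and> k \<notin> K}"
  define V where "V = {a j ! k | j k. k \<in> K}"
  have AU: "A \<subseteq> U" using tuple_seqD(1)[OF ts] by (auto simp: A_def)
  have "countable A" unfolding A_def by (intro countable_UN) (auto intro: countable_finite)
  then have cA: "countable (meet_closure M A)" by (rule countable_cl)
  have aA: "a i ! k \<in> A" if "k < length (a 0)" for i k using seq_in[OF ts that] by (auto simp: A_def)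
  have LA: "L \<subseteq> meet_closure M A" unfolding L_def using aA k0(1) by (blast intro: meet_closure.meet meet_closure.gen)
  have VA: "V \<subseteq> meet_closure M A" using aA Kl by (auto simp: V_def intro!: meet_closure.gen)
  have clU: "meet_closure M A \<subseteq> U" using cl_in_U[OF AU] by blast
  have cone: "u \<prec> v \<sqinter> v'" if uv: "u \<in> L" "v \<in> V" "v' \<in> V" for u v v'
  proof -
    obtain i k where u: "u = a i ! k \<sqinter> a i ! k0" "k < length (a 0)" "k \<notin> K" using uv(1) by (auto simp: L_def)
    obtain j l where v: "v = a j ! l" "l \<in> K" using uv(2) by (auto simp: V_def)
    obtain j' l' where v': "v' = a j' ! l'" "l' \<in> K" using uv(3) by (auto simp: V_def)
    note U = aU[OF u(2)] aU[OF k0(1)] aU[OF Kl(1)[OF v(2)]] aU[OF Kl(1)[OF v'(2)]]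
    have "u \<prec> v \<sqinter> a i ! k0"
      using low[OF u(2,3) v(2), of i j] u(1) v(1) meet_comm[of "a i ! k0" "a j ! l"] U by simp
    moreover have "u \<prec> a i ! k0 \<sqinter> v'" using low[OF u(2,3) v'(2), of i j'] u(1) v'(1) by simp
    ultimately show ?thesis using cone_trans[of u v "a i ! k0" v'] u(1) v(1) v'(1) U by simp
  qed
  obtain x where x: "x \<in> U" "\<And>u. u \<in> L \<Longrightarrow> u \<prec> x" "\<And>v. v \<in> V \<Longrightarrow> x \<preceq> v" "x \<notin> meet_closure M A"
  proof (rule realize_cut[of L V "meet_closure M A"])
    show "countable L" "countable V" using LA VA cA by (auto intro: countable_subset)
    show "L \<subseteq> U" "V \<subseteq> U" using LA VA clU by auto
    show "V \<noteq> {}" using K(2) by (auto simp: V_def)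
  qed (use cA clU cone in blast)+
  have x_iff: "x \<preceq> a i ! k \<longleftrightarrow> k \<in> K" if k: "k < length (a 0)" for i k
  proof
    show "x \<preceq> a i ! k" if "k \<in> K" using x(3)[of "a i ! k"] that by (auto simp: V_def)
    show "k \<in> K" if le: "x \<preceq> a i ! k"
    proof (rule ccontr)
      assume nk: "k \<notin> K"
      have "x \<preceq> a i ! k0" using x(3)[of "a i ! k0"] K(2) by (auto simp: V_def)
      then have "x \<preceq> a i ! k \<sqinter> a i ! k0" using le aU[OF k] aU[OF k0(1)] x(1) by (simp add: le_meet_iff)
      moreover have "a i ! k \<sqinter> a i ! k0 \<prec> x" using x(2) nk k by (auto simp: L_def)
      ultimately show False using antisym[of x "a i ! k \<sqinter> a i ! k0"] aU[OF k] aU[OF k0(1)] x(1) by auto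
    qed
  qed
  have "indiscernible M {x} a"
  proof (rule indiscernibleI[OF ts])
    fix "is" js :: "nat list"
    assume ne: "is \<noteq> []" and ij: "sorted_wrt (<) is" "sorted_wrt (<) js" "length is = length js"
    let ?X = "\<Union>i\<in>set is. set (a i)"
    obtain f where f: "partial_iso (meet_closure M ?X) f" "map (\<lambda>i. map f (a i)) is = map a js"
      using indiscernible_partial_iso[OF a _ _ ij] by auto
    have idx: "\<exists>j k. k < length (a 0) \<and> g = a i ! k \<and> f g = a j ! k" if i: "i \<in> set is" "g \<in> set (a i)" for i g
    proof -
      obtain n where n: "n < length is" "i = is ! n" using i by (auto simp: in_set_conv_nth)
      obtain k where k: "k < length (a 0)" "g = a i ! k" using i(2) len[of i] by (auto simp: in_set_conv_nth)
      have "f (a i ! k) = a (js ! n) ! k" using nth_blocks[OF f(2) n(1)] k len n(2) by metis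
      then show ?thesis using k by blast
    qed
    have XA: "?X \<subseteq> A" by (auto simp: A_def)
    have fXA: "f ` ?X \<subseteq> A" using idx aA by fastforce
    let ?v = "a (hd is) ! k0"
    have v: "?v \<in> ?X" using seq_in[OF ts k0(1)] hd_in_set[OF ne] by blast
    have cut: "x \<preceq> g \<longleftrightarrow> x \<preceq> f g" if "g \<in> ?X" for g using that idx x_iff by fastforce
    have xv: "x \<preceq> ?v" using x_iff[OF k0(1)] K(2) by blast
    have xX: "x \<notin> meet_closure M ?X" using cl_mono[OF XA, of M] x(4) by blast
    have g: "partial_iso (insert x (meet_closure M ?X)) (f(x := x))"
    proof (rule partial_iso_insert_cut_cl[OF f(1) _ v x(1) xv xX x(1)])
      show "?X \<subseteq> U" using XA AU by blast
      show "x \<preceq> f ?v" using cut[OF v] xv by blast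
      show "x \<notin> meet_closure M (f ` ?X)" using cl_mono[OF fXA, of M] x(4) by blast
    qed (rule cut)
    have "map (\<lambda>i. map (f(x := x)) (a i)) is = map (\<lambda>i. map f (a i)) is"
      using xX cl_gens[of ?X M] by (intro map_cong) auto
    then show "\<exists>f C. partial_iso C f \<and> (\<Union>i\<in>set is. set (a i)) \<union> {x} \<subseteq> C \<and>
        map (\<lambda>i. map f (a i)) is = map a js \<and> (\<forall>x\<in>{x}. f x = x)"
      using g f(2) cl_gens[of ?X M] by (intro exI[of _ "f(x := x)"] exI[of _ "insert x (meet_closure M ?X)"]) auto
  qed
  moreover have x0: "x \<notin> meet_closure M (set (a 0))" using cl_mono[of "set (a 0)" A M] x(4) by (auto simp: A_def)
  moreover have "partial_iso (insert x (meet_closure M (set (a 0)))) ((\<lambda>z. z)(x := e))"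
  proof (rule partial_iso_insert_cut_cl)
    show "partial_iso (meet_closure M (set (a 0))) (\<lambda>z. z)" by (intro partial_iso_id closed_cl tuple_seqD(1)[OF ts])
    show "a 0 ! k0 \<in> set (a 0)" using k0 by simp
    show "x \<preceq> a 0 ! k0" using x_iff[OF k0(1)] K(2) by blast
    show "x \<preceq> g \<longleftrightarrow> e \<preceq> g" if "g \<in> set (a 0)" for g
      using that x_iff[of _ 0] K(1) by (auto simp: in_set_conv_nth)
  qed (use x(1) x0 e k0 tuple_seqD(1)[OF ts] in auto)
  ultimately show ?thesis using indisc_copy_of_insert[of x a "set (a 0)" e] by blast
qed

lemma mutual_partial_iso:
  assumes a: "indiscernible M (\<Union>i. set (c i)) a" and c: "indiscernible M (\<Union>i. set (a i)) c"
  obtains f where "partial_iso (meet_closure M (set (a i) \<union> set (c j))) f" "map f (a i) = a i'" "map f (c j) = c j'"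
proof -
  note ta = tuple_seqD[OF indiscernible_tuple_seq[OF a]] and tc = tuple_seqD[OF indiscernible_tuple_seq[OF c]]
  have a': "indiscernible M (set (c j)) a" by (rule indiscernible_mono[OF a]) auto
  have c': "indiscernible M (set (a i')) c" by (rule indiscernible_mono[OF c]) auto
  obtain f where f: "partial_iso (meet_closure M (set (a i) \<union> set (c j))) f" "map f (a i) = a i'" "\<And>x. x \<in> set (c j) \<Longrightarrow> f x = x"
    using indiscernible_partial_iso1[OF a', of i i'] tc(1) by auto
  obtain g where g: "partial_iso (meet_closure M (set (c j) \<union> set (a i'))) g" "map g (c j) = c j'" "\<And>x. x \<in> set (a i') \<Longrightarrow> g x = x"
    using indiscernible_partial_iso1[OF c', of j j'] ta(1) by auto
  have "f ` set (a i) = set (a i')" using f(2) by (metis list.set_map)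
  then have img: "f ` (set (a i) \<union> set (c j)) \<subseteq> set (c j) \<union> set (a i')" using f(3) by auto
  have "f ` meet_closure M (set (a i) \<union> set (c j)) \<subseteq> meet_closure M (set (c j) \<union> set (a i'))"
    using partial_iso_image_cl[OF f(1) cl_gens] cl_mono[OF img, of M] by blast
  then have "partial_iso (meet_closure M (set (a i) \<union> set (c j))) (g \<circ> f)" using partial_iso_comp[OF f(1) g(1)] by blast
  moreover have "map (g \<circ> f) (a i) = a i'"
  proof -
    have "map (g \<circ> f) (a i) = map g (map f (a i))" by simp
    also have "\<dots> = a i'" unfolding f(2) using g(3) by (simp add: map_idI)
    finally show ?thesis .
  qed
  moreover have "map (g \<circ> f) (c j) = c j'"
  proof -
    have "map f (c j) = c j" using f(3) by (simp add: map_idI)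
    then have "map (g \<circ> f) (c j) = map g (c j)" by (metis map_map)
    then show ?thesis using g(2) by simp
  qed
  ultimately show ?thesis by (rule that)
qed

text \<open>Two families of cuts that overlap crosswise cannot both consist of disjoint cuts. Since \<open>e\<close>
  lies in the cuts of \<open>a 0\<close> and \<open>c 0\<close>, each lower end of a cut of \<open>a\<close> or \<open>c\<close> is below the
  upper ends of all cuts of the other sequence. Suppose that the upper ends \<open>z\<close> and \<open>z'\<close> of two
  cuts of \<open>c\<close> meet at or below the lower end \<open>w\<close> of the cut of \<open>z\<close>. Each lower end \<open>u\<close> of a
  cut of \<open>a\<close> is below \<open>z\<close> and \<open>z'\<close>, hence at or below \<open>w\<close>, while all the upper ends of the cuts
  of \<open>a\<close> lie in the cone of \<open>z\<close> above \<open>w\<close>. So their meets are strictly above \<open>w\<close>, hence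
  above \<open>u\<close>.\<close>

lemma cuts_compatible_or:
  assumes a: "indiscernible M (\<Union>i. set (c i)) a" and c: "indiscernible M (\<Union>i. set (a i)) c"
    and e: "e \<in> U" "e \<notin> meet_closure M (set (a 0))" "e \<notin> meet_closure M (set (c 0))"
    and K: "K = {k. k < length (a 0) \<and> e \<preceq> a 0 ! k}" "k0 \<in> K"
    and L: "L = {l. l < length (c 0) \<and> e \<preceq> c 0 ! l}" "l0 \<in> L"
  shows "compatible_cuts a K k0 \<or> compatible_cuts c L l0"
proof (rule disjCI)
  assume "\<not> compatible_cuts c L l0"
  note ta = indiscernible_tuple_seq[OF a] and tc = indiscernible_tuple_seq[OF c]
  note aU = seq_in_U[OF ta] and cU = seq_in_U[OF tc]
  have len: "length (a i) = length (a 0)" "length (c i) = length (c 0)" for i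
    using tuple_seqD(2)[OF ta] tuple_seqD(2)[OF tc] .
  have Kl: "k < length (a 0)" "e \<preceq> a 0 ! k" if "k \<in> K" for k using that K by auto
  have Ll: "l < length (c 0)" "e \<preceq> c 0 ! l" if "l \<in> L" for l using that L by auto
  note k0 = Kl(1)[OF K(2)] and l0 = Ll(1)[OF L(2)]
  obtain l l' p where l: "l < length (c 0)" "l \<notin> L" and l': "l' \<in> L"
    and bad: "\<not> c p ! l \<sqinter> c p ! l0 \<prec> c p ! l0 \<sqinter> c (1 - p) ! l'"
    using \<open>\<not> compatible_cuts c L l0\<close> unfolding compatible_cuts_def by blast
  let ?w = "c p ! l \<sqinter> c p ! l0" let ?z = "c p ! l0" let ?z' = "c (1 - p) ! l'"
  note l'l = Ll(1)[OF l']
  have wU: "?w \<in> U" using cU l l0 by auto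
  have w0: "c 0 ! l \<sqinter> c 0 ! l0 \<prec> e" by (rule below_cut[OF tc e(1,3) L l])
  (* For the terms 0 the point e separates the lower ends from the upper ends; the other terms
     follow by mutual indiscernibility. *)
  have w_lt: "?w \<prec> ?z \<sqinter> a i ! k" if k: "k \<in> K" for i k
  proof -
    obtain f where f: "partial_iso (meet_closure M (set (a 0) \<union> set (c 0))) f" "map f (a 0) = a i" "map f (c 0) = c p"
      using mutual_partial_iso[OF a c] by blast
    let ?C = "meet_closure M (set (a 0) \<union> set (c 0))"
    have mem: "c 0 ! l \<in> ?C" "c 0 ! l0 \<in> ?C" "a 0 ! k \<in> ?C"
      using l l0 Kl(1)[OF k] by (auto intro!: meet_closure.gen)
    have img: "f (c 0 ! l) = c p ! l" "f (c 0 ! l0) = ?z" "f (a 0 ! k) = a i ! k"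
      using f(2,3) l l0 Kl(1)[OF k] by (metis nth_map)+
    have "e \<preceq> c 0 ! l0 \<sqinter> a 0 ! k"
      using Kl[OF k] Ll[OF L(2)] aU cU e(1) by (simp add: le_meet_iff)
    then have "c 0 ! l \<sqinter> c 0 ! l0 \<prec> c 0 ! l0 \<sqinter> a 0 ! k"
      using w0 lt_le_trans[of "c 0 ! l \<sqinter> c 0 ! l0" e "c 0 ! l0 \<sqinter> a 0 ! k"] cU[OF l(1)] cU[OF l0] aU[OF Kl(1)[OF k]] e(1)
      by auto
    then show ?thesis
      using partial_iso_lt[OF f(1) partial_iso_meet_in[OF f(1) mem(1,2)] partial_iso_meet_in[OF f(1) mem(2,3)]]
      unfolding partial_iso_meet[OF f(1) mem(1,2)] partial_iso_meet[OF f(1) mem(2,3)] img by blast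
  qed
  have u_le: "a i ! k \<sqinter> a i ! k0 \<preceq> c q ! m" if k: "k < length (a 0)" "k \<notin> K" and m: "m \<in> L" for i k q m
  proof -
    obtain f where f: "partial_iso (meet_closure M (set (a 0) \<union> set (c 0))) f" "map f (a 0) = a i" "map f (c 0) = c q"
      using mutual_partial_iso[OF a c] by blast
    let ?C = "meet_closure M (set (a 0) \<union> set (c 0))"
    have mem: "a 0 ! k \<in> ?C" "a 0 ! k0 \<in> ?C" "c 0 ! m \<in> ?C"
      using k k0 Ll(1)[OF m] by (auto intro!: meet_closure.gen)
    have img: "f (a 0 ! k) = a i ! k" "f (a 0 ! k0) = a i ! k0" "f (c 0 ! m) = c q ! m"
      using f(2,3) k k0 Ll(1)[OF m] by (metis nth_map)+
    have "a 0 ! k \<sqinter> a 0 ! k0 \<preceq> e" using below_cut[OF ta e(1,2) K k] by blast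
    then have "a 0 ! k \<sqinter> a 0 ! k0 \<preceq> c 0 ! m"
      using trans[of "a 0 ! k \<sqinter> a 0 ! k0" e "c 0 ! m"] Ll[OF m] aU[OF k(1)] aU[OF k0] cU[OF Ll(1)[OF m]] e(1) by auto
    then show ?thesis
      using partial_iso_le[OF f(1) partial_iso_meet_in[OF f(1) mem(1,2)] mem(3)]
      unfolding partial_iso_meet[OF f(1) mem(1,2)] img by blast
  qed
  have zz_w: "?z \<sqinter> ?z' \<preceq> ?w"
    using chain[of ?z ?w "?z \<sqinter> ?z'"] bad meet_le2[of "c p ! l" ?z] meet_le1[of ?z ?z'] wU
      cU[OF l(1)] cU[OF l0] cU[OF l'l] refl[OF wU] by auto
  show "compatible_cuts a K k0"
    unfolding compatible_cuts_def
  proof (intro allI impI; elim conjE)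
    fix k k' i assume k: "k < length (a 0)" "k \<notin> K" "k' \<in> K"
    let ?u = "a i ! k \<sqinter> a i ! k0"
    note U = wU cU[OF l0, of p] cU[OF l'l, of "1 - p"] aU[OF k0, of i] aU[OF Kl(1)[OF k(3)], of "1 - i"]
      aU[OF k(1), of i]
    have "?u \<preceq> ?z \<sqinter> ?z'" using u_le[OF k(1,2) L(2)] u_le[OF k(1,2) l'] U by (simp add: le_meet_iff)
    then have "?u \<preceq> ?w" using zz_w trans[of ?u "?z \<sqinter> ?z'" ?w] U by auto
    moreover have "?w \<prec> a i ! k0 \<sqinter> a (1 - i) ! k'"
      using cone_trans[of ?w "a i ! k0" ?z "a (1 - i) ! k'"] w_lt[OF K(2), of i] w_lt[OF k(3), of "1 - i"]
        meet_comm[of ?z "a i ! k0"] U by simp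
    ultimately show "?u \<prec> a i ! k0 \<sqinter> a (1 - i) ! k'"
      using le_lt_trans[of ?u ?w "a i ! k0 \<sqinter> a (1 - i) ! k'"] U by auto
  qed
qed

section \<open>Two mutually indiscernible sequences\<close>

lemma indiscernible_over_cl:
  assumes a: "indiscernible M (set d) a" and d: "set d \<subseteq> U" and e: "e \<in> meet_closure M (set d)"
  shows "indiscernible M {e} a"
proof (rule indiscernibleI[OF indiscernible_tuple_seq[OF a]])
  fix "is" js :: "nat list"
  assume ij: "sorted_wrt (<) is" "sorted_wrt (<) js" "length is = length js"
  let ?X = "(\<Union>i\<in>set is. set (a i)) \<union> set d"
  obtain f where f: "partial_iso (meet_closure M ?X) f" "map (\<lambda>i. map f (a i)) is = map a js" "\<And>x. x \<in> set d \<Longrightarrow> f x = x"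
    using indiscernible_partial_iso[OF a _ d ij] by auto
  have X: "?X \<subseteq> meet_closure M ?X" by (rule cl_gens)
  have "f e = e" using partial_iso_fixes_cl[OF f(1) _ f(3) e] X by auto
  moreover have "e \<in> meet_closure M ?X" using e cl_mono[of "set d" ?X M] by auto
  ultimately show "\<exists>f C. partial_iso C f \<and> (\<Union>i\<in>set is. set (a i)) \<union> {e} \<subseteq> C \<and>
      map (\<lambda>i. map f (a i)) is = map a js \<and> (\<forall>x\<in>{e}. f x = x)"
    using f(1,2) X by (intro exI[of _ f] exI[of _ "meet_closure M ?X"]) auto
qed

text \<open>Here \<open>z\<close> itself has the type of \<open>b\<close> over \<open>a 0\<close>: both lie in the same cone above \<open>e\<close>, which
  contains no entry of \<open>a 0\<close>.\<close>

lemma indisc_copy_same_cone: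
  assumes a: "indiscernible M {z} a" and b: "b \<in> U" and z: "z \<in> U" and e: "e \<in> U"
    and lt: "e \<prec> b \<sqinter> z" and new: "\<And>g. g \<in> set (a 0) \<Longrightarrow> \<not> e \<prec> b \<sqinter> g"
  shows "indisc_copy a b"
proof -
  note ts = indiscernible_tuple_seq[OF a]
  let ?X = "set (a 0) \<union> {e}"
  have X: "?X \<subseteq> U" using tuple_seqD(1)[OF ts] e by auto
  have eC: "e \<in> meet_closure M ?X" by (auto intro: meet_closure.gen)
  have e_lt: "e \<prec> b" "e \<prec> z"
    using lt lt_le_trans[of e "b \<sqinter> z" b] lt_le_trans[of e "b \<sqinter> z" z] meet_le1[OF b z] meet_le2[OF b z] b z e
    by auto
  have new_b: "\<not> e \<prec> b \<sqinter> g" if "g \<in> ?X" for g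
    using that new meet_le2[OF b e] antisym[of e "b \<sqinter> e"] b e by auto
  have new_z: "\<not> e \<prec> z \<sqinter> g" if g: "g \<in> ?X" for g
    using new_b[OF g] cone_trans[of e b z g] lt b z e g X by blast
  have rel: "rel M e z c \<longleftrightarrow> rel M e b c" if "c \<in> meet_closure M ?X" for c
    using rel_cong_cone(1)[of e b z c] lt b z e cl_in_U[OF X that] by blast
  have ext: "partial_iso (insert z (meet_closure M ?X)) ((\<lambda>x. x)(z := b))" "z \<notin> meet_closure M ?X"
    using partial_iso_insert_cone[OF partial_iso_id[OF closed_cl[OF X]] eC z e_lt(2) b e_lt(1)] rel
      new_cone_cl[OF X z e new_z] new_cone_cl[OF X b e new_b] by auto
  show ?thesis by (rule indisc_copy_of_insert[OF a ext]) blast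
qed

lemma max_branch_point:
  assumes "tuple_seq M a" "a 0 \<noteq> []" "b \<in> U"
  obtains k where "k < length (a 0)" "\<And>z. z \<in> set (a 0) \<Longrightarrow> b \<sqinter> z \<preceq> b \<sqinter> a 0 ! k"
proof -
  have aU: "set (a 0) \<subseteq> U" using tuple_seqD(1)[OF assms(1)] .
  have "\<exists>m\<in>(\<lambda>z. b \<sqinter> z) ` set (a 0). \<forall>u\<in>(\<lambda>z. b \<sqinter> z) ` set (a 0). u \<preceq> m"
    using assms aU meet_le1 by (intro finite_chain_max[of _ b]) auto
  then show ?thesis using that by (auto simp: in_set_conv_nth)
qed

lemma indisc_copy_empty:
  assumes ts: "tuple_seq M a" and "a 0 = []"
  shows "indisc_copy a b"
proof -
  have "a i = []" for i using tuple_seqD(2)[OF ts, of i] assms(2) by simp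
  then have 1: "concat (map a is) = []" for "is" by simp
  have "indiscernible M {b} a" unfolding indiscernible_def 1 using ts by simp
  then show ?thesis by (rule indisc_copy_refl)
qed

lemma indisc_copy_or:
  assumes a: "indiscernible M (\<Union>i. set (c i)) a" and c: "indiscernible M (\<Union>i. set (a i)) c" and b: "b \<in> U"
  shows "indisc_copy a b \<or> indisc_copy c b"
proof (cases "a 0 = [] \<or> c 0 = []")
  case True
  then show ?thesis using indisc_copy_empty indiscernible_tuple_seq[OF a] indiscernible_tuple_seq[OF c] by blast
next
  case False
  note ta = indiscernible_tuple_seq[OF a] and tc = indiscernible_tuple_seq[OF c]
  obtain k0 where k0: "k0 < length (a 0)" "\<And>z. z \<in> set (a 0) \<Longrightarrow> b \<sqinter> z \<preceq> b \<sqinter> a 0 ! k0"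
    using max_branch_point[OF ta _ b] False by blast
  obtain l0 where l0: "l0 < length (c 0)" "\<And>z. z \<in> set (c 0) \<Longrightarrow> b \<sqinter> z \<preceq> b \<sqinter> c 0 ! l0"
    using max_branch_point[OF tc _ b] False by blast
  let ?e = "b \<sqinter> a 0 ! k0" let ?e' = "b \<sqinter> c 0 ! l0"
  have U: "a 0 ! k0 \<in> U" "c 0 ! l0 \<in> U" using seq_in_U[OF ta k0(1)] seq_in_U[OF tc l0(1)] .
  then have eU: "?e \<in> U" "?e' \<in> U" using b by auto
  have aU: "set (a 0) \<subseteq> U" "set (c 0) \<subseteq> U" using tuple_seqD(1)[OF ta] tuple_seqD(1)[OF tc] .
  have new: "\<not> ?e \<prec> b \<sqinter> z" if "z \<in> set (a 0)" for z
    using k0(2)[OF that] antisym[of ?e "b \<sqinter> z"] eU that aU b by blast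
  have new': "\<not> ?e' \<prec> b \<sqinter> z" if "z \<in> set (c 0)" for z
    using l0(2)[OF that] antisym[of ?e' "b \<sqinter> z"] eU that aU b by blast
  consider "?e \<prec> ?e'" | "?e' \<prec> ?e" | "?e = ?e'"
    using chain[OF b eU meet_le1[OF b U(1)] meet_le1[OF b U(2)]] by (cases "?e = ?e'") auto
  then show ?thesis
  proof cases
    case 1
    have "indiscernible M {c 0 ! l0} a"
      by (rule indiscernible_mono[OF a]) (use seq_in[OF tc l0(1)] in auto)
    then show ?thesis using indisc_copy_same_cone[OF _ b U(2) eU(1) 1 new] by blast
  next
    case 2
    have "indiscernible M {a 0 ! k0} c"
      by (rule indiscernible_mono[OF c]) (use seq_in[OF ta k0(1)] in auto)
    then show ?thesis using indisc_copy_same_cone[OF _ b U(1) eU(2) 2 new'] by blast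
  next
    case 3
    have eb: "?e \<preceq> b" using meet_le1[OF b U(1)] .
    have new'': "\<not> ?e \<prec> b \<sqinter> z" if "z \<in> set (c 0)" for z using new'[OF that] unfolding 3 .
    have "indiscernible M (set (c 0)) a" by (rule indiscernible_mono[OF a]) auto
    then have a_e: "indisc_copy a b" if "?e \<in> meet_closure M (set (c 0))"
      using indiscernible_over_cl[OF _ aU(2) that] indisc_copy_above[OF _ eU(1) b eb new] by blast
    have "indiscernible M (set (a 0)) c" by (rule indiscernible_mono[OF c]) auto
    then have c_e: "indisc_copy c b" if "?e \<in> meet_closure M (set (a 0))"
      using indiscernible_over_cl[OF _ aU(1) that] indisc_copy_above[OF _ eU(1) b eb new''] by blast
    have lift: "indisc_copy s b" if s: "indisc_copy s ?e" and ts: "\<And>z. z \<in> set (s 0) \<Longrightarrow> \<not> ?e \<prec> b \<sqinter> z" for s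
    proof -
      obtain \<sigma> where \<sigma>: "automorphism \<sigma> M" "\<forall>z\<in>set (s 0). \<sigma> z = z" "indiscernible M {?e} (\<lambda>i. map \<sigma> (s i))"
        using s by (auto simp: indisc_copy_def)
      have "indisc_copy (\<lambda>i. map \<sigma> (s i)) b"
        using ts \<sigma>(2) by (intro indisc_copy_above[OF \<sigma>(3) eU(1) b eb]) auto
      then show ?thesis using indisc_copy_trans \<sigma> by blast
    qed
    show ?thesis
    proof (cases "?e \<in> meet_closure M (set (a 0)) \<or> ?e \<in> meet_closure M (set (c 0))")
      case True then show ?thesis using a_e c_e by blast
    next
      case False
      let ?K = "{k. k < length (a 0) \<and> ?e \<preceq> a 0 ! k}" and ?L = "{l. l < length (c 0) \<and> ?e \<preceq> c 0 ! l}"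
      have K: "k0 \<in> ?K" "l0 \<in> ?L" using k0 l0 meet_le2[OF b U(1)] meet_le2[OF b U(2)] 3 by auto
      have "compatible_cuts a ?K k0 \<or> compatible_cuts c ?L l0"
        by (rule cuts_compatible_or[OF a c eU(1) _ _ HOL.refl K(1) HOL.refl K(2)]) (use False in blast)+
      moreover have ind: "indiscernible M {} a" "indiscernible M {} c"
        using indiscernible_mono a c by blast+
      ultimately have "indisc_copy a ?e \<or> indisc_copy c ?e"
        using indisc_copy_into_cut[OF ind(1) eU(1) _ HOL.refl K(1)]
          indisc_copy_into_cut[OF ind(2) eU(1) _ HOL.refl K(2)] False by blast
      then show ?thesis using lift new new'' by blast
    qed
  qed
qed

end

theorem proposition4p31:
  fixes DTR :: "fm set"
  assumes "model_completion TR DTR"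
  shows "inp_minimal TYPE('a) DTR"
  unfolding inp_minimal_def bdn_less_def
proof (intro allI impI; elim conjE)
  fix \<kappa> :: "'a rel" and M :: "'a struct" and a :: "bool \<Rightarrow> nat \<Rightarrow> 'a list" and b
  assume "monster_model \<kappa> DTR M"
  then interpret dtr_monster DTR \<kappa> M using assms by unfold_locales
  assume mut: "mutually_indiscernible M {} (Field ctwo) a" and len: "length b = 1"
    and b: "realizes M b {(Eq (Var 0) (Var 0), [])}"
  obtain x where x: "b = [x]" "x \<in> univ M"
    using len b by (cases b) (auto simp: realizes_def)
  have F: "Field ctwo = (UNIV :: bool set)" by (simp add: ctwo_def Field_card_of)
  have "UNIV - {True} = {False}" "UNIV - {False} = {True}" by auto
  then have 1: "indiscernible M (\<Union>i. set (a False i)) (a True)" "indiscernible M (\<Union>i. set (a True i)) (a False)"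
    using mut[unfolded mutually_indiscernible_def F, rule_format, of True]
      mut[unfolded mutually_indiscernible_def F, rule_format, of False] by auto
  then have "indisc_copy (a True) x \<or> indisc_copy (a False) x" using x(2) by (intro indisc_copy_or)
  then obtain \<beta> where \<beta>: "indisc_copy (a \<beta>) x" by blast
  have "tuple_seq M (a \<beta>)" using 1 indiscernible_tuple_seq by (cases \<beta>) auto
  then obtain a' where "indiscernible M {x} a'" "same_type M (set (a \<beta> 0)) a' (a \<beta>)"
    using indisc_copy_same_type[OF \<beta>] by blast
  then show "\<exists>\<beta>\<in>Field ctwo. \<exists>a'. indiscernible M (set b \<union> {}) a' \<and> same_type M (set (a \<beta> 0) \<union> {}) a' (a \<beta>)"
    using x(1) unfolding F by (intro bexI[of _ \<beta>] exI[of _ a']) auto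
qed

end
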